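(* Let $(\mathfrak g,\varphi_i,\xi_i,\eta_i,g)$ be an almost $3$-contact metric Lie algebra endowed with a non-parallel canonical abelian structure, i.e. $\mathcal Z=0$ and $2\psi=-\beta I$, with $\beta\neq0$. Then $\beta=2\delta$ and $\mathfrak g\cong\mathfrak{so}(3)\ltimes\mathbb R^{4n}$ (with $\mathfrak{so}(3)$ corresponding to $\mathfrak v$ and the abelian ideal $\mathbb R^{4n}$ to $\mathfrak h$), with non-zero brackets given by $$[\xi_i,\xi_j]=2\delta\xi_k,\qquad[\xi_i,X]=\delta\varphi_iX,$$ for any even permutation $(i,j,k)$ of $(1,2,3)$ and $X\in\mathfrak h$. If $G$ is any Lie group with Lie algebra $\mathfrak g$, endowed with the left invariant structure $(\varphi_i,\xi_i,\eta_i,g)$, the canonical connection of $G$ is the connection with skew torsion $T=2\delta\,\eta_1\wedge\eta_2\wedge\eta_3$.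
   Context: An almost contact structure on a real Lie algebra $\mathfrak g$ is a triple $(\varphi,\xi,\eta)$, $\varphi\in\mathrm{End}(\mathfrak g)$, $\xi\in\mathfrak g$, $\eta\in\mathfrak g^*$, with $\varphi^2=-I+\eta\otimes\xi$ and $\eta(\xi)=1$. It is abelian if $\mathrm{ad}_\xi\circ\varphi=\varphi\circ\mathrm{ad}_\xi$ and $[\varphi X,\varphi Y]=[X,Y]$ for all $X,Y\in\operatorname{Ker}\eta$. An almost $3$-contact metric Lie algebra is a real Lie algebra $\mathfrak g$ of dimension $4n+3$, $n\ge1$, with three almost contact structures $(\varphi_i,\xi_i,\eta_i)$, $i=1,2,3$, such that for every even permutation $(i,j,k)$ of $(1,2,3)$: $\varphi_k=\varphi_i\varphi_j-\eta_j\otimes\xi_i=-\varphi_j\varphi_i+\eta_i\otimes\xi_j$, $\xi_k=\varphi_i\xi_j=-\varphi_j\xi_i$, $\eta_k=\eta_i\circ\varphi_j=-\eta_j\circ\varphi_i$, together with an inner product $g$ satisfying $g(\varphi_iX,\varphi_iY)=g(X,Y)-\eta_i(X)\eta_i(Y)$ for all $X,Y,i$. It is abelian if each $(\varphi_i,\xi_i,\eta_i)$ is abelian. Set $\mathfrak h=\bigcap_i\operatorname{Ker}\eta_i$, $\mathfrak v=\langle\xi_1,\xi_2,\xi_3\rangle$. For an abelian structure the following are well defined: $\mathcal Z:=\varphi_i([\xi_j,\xi_k])\in\mathfrak h$ and $\delta\in\mathbb R$ with $2\delta=\eta_i([\xi_j,\xi_k])$ (independent of the even permutation $(i,j,k)$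 of $(1,2,3)$); and $\psi:=(\mathrm{ad}_{\xi_i}\circ\varphi_i)|_{\mathfrak h}=(\varphi_i\circ\mathrm{ad}_{\xi_i})|_{\mathfrak h}$ (independent of $i$). An abelian structure is canonical if $\mathcal Z=0$ and $2\psi=-\beta I$ for some $\beta\in\mathbb R$, and parallel canonical if $\mathcal Z=0$ and $\psi=0$. For a canonical abelian structure, the canonical connection of $G$ is the unique metric connection $\nabla$ with totally skew-symmetric torsion (i.e. $T(X,Y,Z)=g(T(X,Y),Z)$ is a $3$-form) such that $\nabla_X\varphi_i=\beta(\eta_k(X)\varphi_j-\eta_j(X)\varphi_k)$ for every vector field $X$ and every even permutation $(i,j,k)$ of $(1,2,3)$. Convention: $(\eta_1\wedge\eta_2\wedge\eta_3)(\xi_1,\xi_2,\xi_3)=1$. *)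

theory Defs
  imports "HOL-Analysis.Analysis"
begin

section \<open>Abelian almost 3-contact metric Lie algebras\<close>

definition real_lie_algebra :: "('a::real_vector \<Rightarrow> 'a \<Rightarrow> 'a) \<Rightarrow> bool" where
  "real_lie_algebra br \<longleftrightarrow>
     bilinear br \<and> (\<forall>x. br x x = 0) \<and>
     (\<forall>x y z. br x (br y z) + br y (br z x) + br z (br x y) = 0)"

definition almost_contact_structure ::
    "('a::real_vector \<Rightarrow> 'a) \<Rightarrow> 'a \<Rightarrow> ('a \<Rightarrow> real) \<Rightarrow> bool" where
  "almost_contact_structure \<phi> \<xi> \<eta> \<longleftrightarrow>
     linear \<phi> \<and> linear \<eta> \<and> (\<forall>x. \<phi> (\<phi> x) = - x + \<eta> x *\<^sub>R \<xi>) \<and> \<eta> \<xi> = 1"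

definition abelian_almost_contact ::
    "('a::real_vector \<Rightarrow> 'a \<Rightarrow> 'a) \<Rightarrow> ('a \<Rightarrow> 'a) \<Rightarrow> 'a \<Rightarrow> ('a \<Rightarrow> real) \<Rightarrow> bool" where
  "abelian_almost_contact br \<phi> \<xi> \<eta> \<longleftrightarrow>
     (\<forall>x. br \<xi> (\<phi> x) = \<phi> (br \<xi> x)) \<and>
     (\<forall>x y. \<eta> x = 0 \<longrightarrow> \<eta> y = 0 \<longrightarrow> br (\<phi> x) (\<phi> y) = br x y)"

text \<open>The index set \<open>{1, 2, 3}\<close> is the type \<open>3\<close> (in which \<open>3 = 0\<close>).\<close>

definition even_perm3 :: "3 \<Rightarrow> 3 \<Rightarrow> 3 \<Rightarrow> bool" where
  "even_perm3 i j k \<longleftrightarrow> (i, j, k) \<in> {(1, 2, 3), (2, 3, 1), (3, 1, 2)}"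

text \<open>The inner product \<open>g\<close> is the inner product of the type \<open>'a\<close>: up to isometry, the types of
  class \<open>euclidean_space\<close> are exactly the non-zero finite-dimensional real inner product spaces.\<close>

definition almost_3_contact_metric_lie_algebra ::
    "nat \<Rightarrow> ('a::euclidean_space \<Rightarrow> 'a \<Rightarrow> 'a) \<Rightarrow> (3 \<Rightarrow> 'a \<Rightarrow> 'a) \<Rightarrow> (3 \<Rightarrow> 'a) \<Rightarrow> (3 \<Rightarrow> 'a \<Rightarrow> real) \<Rightarrow> bool"
  where
  "almost_3_contact_metric_lie_algebra n br \<phi> \<xi> \<eta> \<longleftrightarrow>
     real_lie_algebra br \<and> n \<ge> 1 \<and> DIM('a) = 4 * n + 3 \<and>
     (\<forall>i. almost_contact_structure (\<phi> i) (\<xi> i) (\<eta> i)) \<and>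
     (\<forall>i j k. even_perm3 i j k \<longrightarrow>
        (\<forall>x. \<phi> k x = \<phi> i (\<phi> j x) - \<eta> j x *\<^sub>R \<xi> i \<and>
             \<phi> k x = - \<phi> j (\<phi> i x) + \<eta> i x *\<^sub>R \<xi> j) \<and>
        \<xi> k = \<phi> i (\<xi> j) \<and> \<xi> k = - \<phi> j (\<xi> i) \<and>
        (\<forall>x. \<eta> k x = \<eta> i (\<phi> j x) \<and> \<eta> k x = - \<eta> j (\<phi> i x))) \<and>
     (\<forall>i x y. \<phi> i x \<bullet> \<phi> i y = x \<bullet> y - \<eta> i x * \<eta> i y)"

definition abelian_3_structure ::
    "('a::real_vector \<Rightarrow> 'a \<Rightarrow> 'a) \<Rightarrow> (3 \<Rightarrow> 'a \<Rightarrow> 'a) \<Rightarrow> (3 \<Rightarrow> 'a) \<Rightarrow> (3 \<Rightarrow> 'a \<Rightarrow> real) \<Rightarrow> bool" where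
  "abelian_3_structure br \<phi> \<xi> \<eta> \<longleftrightarrow> (\<forall>i. abelian_almost_contact br (\<phi> i) (\<xi> i) (\<eta> i))"

definition horizontal :: "(3 \<Rightarrow> 'a \<Rightarrow> real) \<Rightarrow> 'a set" where
  "horizontal \<eta> = {x. \<forall>i. \<eta> i x = 0}"

definition vertical :: "(3 \<Rightarrow> 'a::real_vector) \<Rightarrow> 'a set" where
  "vertical \<xi> = span (range \<xi>)"

text \<open>For abelian structures the following three objects do not depend on the even permutation
  (resp. the index) used to define them; see \<open>reeb_invariants_indep\<close>.\<close>

definition reeb_Z :: "('a \<Rightarrow> 'a \<Rightarrow> 'a) \<Rightarrow> (3 \<Rightarrow> 'a \<Rightarrow> 'a) \<Rightarrow> (3 \<Rightarrow> 'a) \<Rightarrow> 'a" where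
  "reeb_Z br \<phi> \<xi> = \<phi> 1 (br (\<xi> 2) (\<xi> 3))"

definition reeb_delta :: "('a \<Rightarrow> 'a \<Rightarrow> 'a) \<Rightarrow> (3 \<Rightarrow> 'a) \<Rightarrow> (3 \<Rightarrow> 'a \<Rightarrow> real) \<Rightarrow> real" where
  "reeb_delta br \<xi> \<eta> = \<eta> 1 (br (\<xi> 2) (\<xi> 3)) / 2"

definition reeb_psi :: "('a \<Rightarrow> 'a \<Rightarrow> 'a) \<Rightarrow> (3 \<Rightarrow> 'a \<Rightarrow> 'a) \<Rightarrow> (3 \<Rightarrow> 'a) \<Rightarrow> 'a \<Rightarrow> 'a" where
  "reeb_psi br \<phi> \<xi> x = br (\<xi> 1) (\<phi> 1 x)"

lemma even_perm3_cyc: "even_perm3 i j k \<Longrightarrow> even_perm3 j k i"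
  by (auto simp: even_perm3_def)

lemma almost_contact_basic:
  assumes "almost_contact_structure \<phi> \<xi> \<eta>"
  shows "\<phi> \<xi> = 0" and "\<eta> (\<phi> x) = 0"
proof -
  have lin: "linear \<phi>" "linear \<eta>" and sq: "\<And>x. \<phi> (\<phi> x) = - x + \<eta> x *\<^sub>R \<xi>" and one: "\<eta> \<xi> = 1"
    using assms by (auto simp: almost_contact_structure_def)
  have nz: "\<xi> \<noteq> 0"
    using one linear_0[OF lin(2)] by auto
  have "\<phi> (\<phi> \<xi>) = 0"
    by (simp add: sq one)
  then have "- \<phi> \<xi> + \<eta> (\<phi> \<xi>) *\<^sub>R \<xi> = 0"
    using sq[of "\<phi> \<xi>"] linear_0[OF lin(1)] by simp
  then have e: "\<phi> \<xi> = \<eta> (\<phi> \<xi>) *\<^sub>R \<xi>"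
    by (simp add: algebra_simps)
  then have "\<phi> (\<phi> \<xi>) = \<eta> (\<phi> \<xi>) *\<^sub>R \<phi> \<xi>"
    by (metis lin(1) linear_scale)
  then show f0: "\<phi> \<xi> = 0"
    using e \<open>\<phi> (\<phi> \<xi>) = 0\<close> by (metis scaleR_eq_0_iff)
  have "- \<phi> x + \<eta> (\<phi> x) *\<^sub>R \<xi> = \<phi> (- x + \<eta> x *\<^sub>R \<xi>)"
    using sq[of "\<phi> x"] sq[of x] by simp
  also have "\<dots> = - \<phi> x"
    using lin(1) f0 by (simp add: linear_add linear_neg linear_scale linear_diff)
  finally show "\<eta> (\<phi> x) = 0"
    using nz by simp
qed

lemma reeb_invariants_indep:
  assumes S: "almost_3_contact_metric_lie_algebra n br \<phi> \<xi> \<eta>" and ab: "abelian_3_structure br \<phi> \<xi> \<eta>"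
  shows "even_perm3 i j k \<Longrightarrow> \<phi> i (br (\<xi> j) (\<xi> k)) = reeb_Z br \<phi> \<xi>"
    and "even_perm3 i j k \<Longrightarrow> \<eta> i (br (\<xi> j) (\<xi> k)) = 2 * reeb_delta br \<xi> \<eta>"
    and "x \<in> horizontal \<eta> \<Longrightarrow> br (\<xi> i) (\<phi> i x) = reeb_psi br \<phi> \<xi> x"
    and "x \<in> horizontal \<eta> \<Longrightarrow> \<phi> i (br (\<xi> i) x) = reeb_psi br \<phi> \<xi> x"
proof -
  have bil: "bilinear br" and alt: "\<And>x. br x x = 0"
    using S by (auto simp: almost_3_contact_metric_lie_algebra_def real_lie_algebra_def)
  have skew: "br y x = - br x y" for x y
  proof -
    have "br (x + y) (x + y) = (br x x + br x y) + (br y x + br y y)"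
      by (simp only: bilinear_ladd[OF bil] bilinear_radd[OF bil] ac_simps)
    then show ?thesis
      by (simp add: alt add_eq_0_iff)
  qed
  have ac: "almost_contact_structure (\<phi> i) (\<xi> i) (\<eta> i)" for i
    using S by (auto simp: almost_3_contact_metric_lie_algebra_def)
  note phixi = almost_contact_basic(1)[OF ac] and etaphi = almost_contact_basic(2)[OF ac]
  have lin: "linear (\<phi> i)" "linear (\<eta> i)" and one: "\<eta> i (\<xi> i) = 1" for i
    using ac[of i] by (auto simp: almost_contact_structure_def)
  have adc: "br (\<xi> i) (\<phi> i x) = \<phi> i (br (\<xi> i) x)"
    and br_inv: "\<eta> i x = 0 \<Longrightarrow> \<eta> i y = 0 \<Longrightarrow> br (\<phi> i x) (\<phi> i y) = br x y" for i x y
    using ab by (auto simp: abelian_3_structure_def abelian_almost_contact_def)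
  have ph: "\<phi> k x = \<phi> i (\<phi> j x) - \<eta> j x *\<^sub>R \<xi> i" "\<phi> k x = - \<phi> j (\<phi> i x) + \<eta> i x *\<^sub>R \<xi> j"
    and xi: "\<phi> i (\<xi> j) = \<xi> k" "\<phi> j (\<xi> i) = - \<xi> k"
    and et: "\<eta> k x = \<eta> i (\<phi> j x)" "\<eta> k x = - \<eta> j (\<phi> i x)"
    if "even_perm3 i j k" for i j k x
  proof -
    have *: "(\<forall>x. \<phi> k x = \<phi> i (\<phi> j x) - \<eta> j x *\<^sub>R \<xi> i \<and>
             \<phi> k x = - \<phi> j (\<phi> i x) + \<eta> i x *\<^sub>R \<xi> j) \<and>
        \<xi> k = \<phi> i (\<xi> j) \<and> \<xi> k = - \<phi> j (\<xi> i) \<and>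
        (\<forall>x. \<eta> k x = \<eta> i (\<phi> j x) \<and> \<eta> k x = - \<eta> j (\<phi> i x))"
      using S that unfolding almost_3_contact_metric_lie_algebra_def by blast
    then show "\<phi> k x = \<phi> i (\<phi> j x) - \<eta> j x *\<^sub>R \<xi> i" "\<phi> k x = - \<phi> j (\<phi> i x) + \<eta> i x *\<^sub>R \<xi> j"
      "\<phi> i (\<xi> j) = \<xi> k" "\<eta> k x = \<eta> i (\<phi> j x)" "\<eta> k x = - \<eta> j (\<phi> i x)"
      by metis+
    show "\<phi> j (\<xi> i) = - \<xi> k"
      using * by (metis minus_minus)
  qed
  have adxi: "br (\<xi> k) (\<xi> i) = - \<phi> i (br (\<xi> i) (\<xi> j))" if "even_perm3 i j k" for i j k
    using adc[of i "\<xi> j"] xi(1)[OF that] skew[of "\<xi> k" "\<xi> i"] by simp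
  have eta0: "\<eta> i (br (\<xi> i) (\<xi> j)) = 0" if p: "even_perm3 i j k" for i j k
  proof -
    have "\<phi> i (\<xi> k) = - \<xi> j"
      using xi(2)[OF even_perm3_cyc[OF even_perm3_cyc[OF p]]] .
    then have "br (\<xi> i) (- \<xi> j) = \<phi> i (br (\<xi> i) (\<xi> k))"
      using adc[of i "\<xi> k"] by simp
    then have "\<eta> i (br (\<xi> i) (- \<xi> j)) = 0"
      using etaphi by metis
    then show ?thesis
      by (simp add: bilinear_rneg[OF bil] linear_neg[OF lin(2)])
  qed
  have Zc: "\<phi> j (br (\<xi> k) (\<xi> i)) = \<phi> k (br (\<xi> i) (\<xi> j))" if p: "even_perm3 i j k" for i j k
    using ph(2)[OF p, of "br (\<xi> i) (\<xi> j)"] eta0[OF p] adxi[OF p] by (simp add: linear_neg[OF lin(1)])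
  have dc: "\<eta> j (br (\<xi> k) (\<xi> i)) = \<eta> k (br (\<xi> i) (\<xi> j))" if p: "even_perm3 i j k" for i j k
    using et(2)[OF p, of "br (\<xi> i) (\<xi> j)"] adxi[OF p] by (simp add: linear_neg[OF lin(2)])
  have e: "even_perm3 1 2 3" "even_perm3 2 3 1" "even_perm3 3 1 2"
    by (auto simp: even_perm3_def)
  show "\<phi> i (br (\<xi> j) (\<xi> k)) = reeb_Z br \<phi> \<xi>" if "even_perm3 i j k"
    using that Zc[OF e(1)] Zc[OF e(2)] Zc[OF e(3)] unfolding even_perm3_def reeb_Z_def by auto
  show "\<eta> i (br (\<xi> j) (\<xi> k)) = 2 * reeb_delta br \<xi> \<eta>" if "even_perm3 i j k"
    using that dc[OF e(1)] dc[OF e(2)] dc[OF e(3)] unfolding even_perm3_def reeb_delta_def by auto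
  have psic: "br (\<xi> i) (\<phi> i x) = br (\<xi> k) (\<phi> k x)" if p: "even_perm3 i j k" and h: "x \<in> horizontal \<eta>" for i j k x
  proof -
    have ex: "\<eta> l x = 0" for l
      using h by (simp add: horizontal_def)
    have q: "even_perm3 j k i"
      using even_perm3_cyc[OF p] .
    have "\<phi> i x = \<phi> j (\<phi> k x)"
      using ph(1)[OF q, of x] ex by simp
    moreover have "\<xi> i = \<phi> j (\<xi> k)"
      using xi(1)[OF q] by simp
    moreover have "\<eta> j (\<xi> k) = 0"
      using etaphi[of j "\<xi> i"] xi(2)[OF p] by (simp add: linear_neg[OF lin(2)])
    moreover have "\<eta> j (\<phi> k x) = 0"
      using et(1)[OF q, of x] ex by simp
    ultimately show ?thesis
      using br_inv[of j "\<xi> k" "\<phi> k x"] by simp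
  qed
  show "br (\<xi> i) (\<phi> i x) = reeb_psi br \<phi> \<xi> x" if "x \<in> horizontal \<eta>" for i
    using psic[OF e(1) that] psic[OF e(2) that] psic[OF e(3) that] exhaust_3[of i]
    unfolding reeb_psi_def by auto
  then show "\<phi> i (br (\<xi> i) x) = reeb_psi br \<phi> \<xi> x" if "x \<in> horizontal \<eta>"
    using that adc by metis
qed

definition canonical_abelian ::
    "('a::real_vector \<Rightarrow> 'a \<Rightarrow> 'a) \<Rightarrow> (3 \<Rightarrow> 'a \<Rightarrow> 'a) \<Rightarrow> (3 \<Rightarrow> 'a) \<Rightarrow> (3 \<Rightarrow> 'a \<Rightarrow> real) \<Rightarrow> real \<Rightarrow> bool"
  where
  "canonical_abelian br \<phi> \<xi> \<eta> \<beta> \<longleftrightarrow>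
     abelian_3_structure br \<phi> \<xi> \<eta> \<and> reeb_Z br \<phi> \<xi> = 0 \<and>
     (\<forall>x \<in> horizontal \<eta>. 2 *\<^sub>R reeb_psi br \<phi> \<xi> x = - \<beta> *\<^sub>R x)"


section \<open>The semidirect product of so(3) and a Euclidean space\<close>

definition so3 :: "(real^3^3) set" where
  "so3 = {A. transpose A = - A}"

definition commutator :: "real^3^3 \<Rightarrow> real^3^3 \<Rightarrow> real^3^3" where
  "commutator A B = A ** B - B ** A"

definition so3_representation :: "(real^3^3 \<Rightarrow> 'b::real_vector \<Rightarrow> 'b) \<Rightarrow> bool" where
  "so3_representation \<rho> \<longleftrightarrow>
     (\<forall>A\<in>so3. linear (\<rho> A)) \<and>
     (\<forall>A\<in>so3. \<forall>B\<in>so3. \<forall>r s u. \<rho> (r *\<^sub>R A + s *\<^sub>R B) u = r *\<^sub>R \<rho> A u + s *\<^sub>R \<rho> B u) \<and>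
     (\<forall>A\<in>so3. \<forall>B\<in>so3. \<forall>u. \<rho> (commutator A B) u = \<rho> A (\<rho> B u) - \<rho> B (\<rho> A u))"

definition semidirect_bracket ::
    "(real^3^3 \<Rightarrow> 'b::real_vector \<Rightarrow> 'b) \<Rightarrow> (real^3^3) \<times> 'b \<Rightarrow> (real^3^3) \<times> 'b \<Rightarrow> (real^3^3) \<times> 'b" where
  "semidirect_bracket \<rho> p q =
     (commutator (fst p) (fst q), \<rho> (fst p) (snd q) - \<rho> (fst q) (snd p))"

definition so3_semidirect_iso ::
    "('a::real_vector \<Rightarrow> 'a \<Rightarrow> 'a) \<Rightarrow> (real^3^3 \<Rightarrow> 'b::real_vector \<Rightarrow> 'b) \<Rightarrow> ('a \<Rightarrow> (real^3^3) \<times> 'b) \<Rightarrow> bool"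
  where
  "so3_semidirect_iso br \<rho> F \<longleftrightarrow>
     so3_representation \<rho> \<and> linear F \<and> bij_betw F UNIV (so3 \<times> UNIV) \<and>
     (\<forall>x y. F (br x y) = semidirect_bracket \<rho> (F x) (F y))"


section \<open>Smooth manifolds, vector fields and Lie groups\<close>

text \<open>Only meaningful for open \<open>S\<close>.\<close>

primrec Ck_on :: "nat \<Rightarrow> ('a::real_normed_vector \<Rightarrow> 'b::real_normed_vector) \<Rightarrow> 'a set \<Rightarrow> bool" where
  "Ck_on 0 f S \<longleftrightarrow> continuous_on S f"
| "Ck_on (Suc k) f S \<longleftrightarrow>
     (\<forall>x\<in>S. f differentiable (at x)) \<and>
     (\<forall>v. Ck_on k (\<lambda>x. frechet_derivative f (at x) v) S)"

definition smooth_on :: "('a::real_normed_vector \<Rightarrow> 'b::real_normed_vector) \<Rightarrow> 'a set \<Rightarrow> bool" where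
  "smooth_on f S \<longleftrightarrow> (\<forall>k. Ck_on k f S)"

text \<open>A chart is a pair of its domain and its coordinate map.\<close>

type_synonym ('p, 'm) chart = "'p set \<times> ('p \<Rightarrow> 'm)"

definition chart_inv :: "('p, 'm) chart \<Rightarrow> 'm \<Rightarrow> 'p" where
  "chart_inv c = inv_into (fst c) (snd c)"

definition smooth_atlas ::
    "('p::{t2_space,second_countable_topology}, 'm::euclidean_space) chart set \<Rightarrow> bool" where
  "smooth_atlas A \<longleftrightarrow>
     (\<Union>c\<in>A. fst c) = UNIV \<and>
     (\<forall>c\<in>A. open (fst c) \<and> open (snd c ` fst c) \<and>
        homeomorphism (fst c) (snd c ` fst c) (snd c) (chart_inv c)) \<and>
     (\<forall>c\<in>A. \<forall>d\<in>A. smooth_on (snd d \<circ> chart_inv c) (snd c ` (fst c \<inter> fst d)))"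

definition chart_at :: "('p, 'm) chart set \<Rightarrow> 'p \<Rightarrow> ('p, 'm) chart" where
  "chart_at A p = (SOME c. c \<in> A \<and> p \<in> fst c)"

definition smooth_map ::
    "('p::topological_space, 'm::real_normed_vector) chart set \<Rightarrow>
     ('q::topological_space, 'n::real_normed_vector) chart set \<Rightarrow> ('p \<Rightarrow> 'q) \<Rightarrow> bool" where
  "smooth_map A B F \<longleftrightarrow>
     continuous_on UNIV F \<and>
     (\<forall>c\<in>A. \<forall>d\<in>B. smooth_on (snd d \<circ> F \<circ> chart_inv c) (snd c ` (fst c \<inter> F -` fst d)))"

definition smooth_fun ::
    "('p, 'm::real_normed_vector) chart set \<Rightarrow> ('p \<Rightarrow> real) \<Rightarrow> bool" where
  "smooth_fun A f \<longleftrightarrow> (\<forall>c\<in>A. smooth_on (f \<circ> chart_inv c) (snd c ` fst c))"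

definition product_atlas :: "('p, 'm) chart set \<Rightarrow> ('q, 'n) chart set \<Rightarrow> ('p \<times> 'q, 'm \<times> 'n) chart set" where
  "product_atlas A B = (\<lambda>(c, d). (fst c \<times> fst d, map_prod (snd c) (snd d))) ` (A \<times> B)"

text \<open>A tangent vector at \<open>p\<close> is the family of its coordinate expressions in the charts of the atlas
  around \<open>p\<close>, related by the derivatives of the coordinate changes. It is set to \<open>0\<close> on
  everything else, so that equality of tangent vectors is equality of functions.\<close>

type_synonym ('p, 'm) tangent_vector = "('p, 'm) chart \<Rightarrow> 'm"

definition tangent_space ::
    "('p, 'm::real_normed_vector) chart set \<Rightarrow> 'p \<Rightarrow> ('p, 'm) tangent_vector set" where
  "tangent_space A p =
     {v. (\<forall>c\<in>A. \<forall>d\<in>A. p \<in> fst c \<longrightarrow> p \<in> fst d \<longrightarrow>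
            v d = frechet_derivative (snd d \<circ> chart_inv c) (at (snd c p)) (v c)) \<and>
         (\<forall>c. \<not> (c \<in> A \<and> p \<in> fst c) \<longrightarrow> v c = 0)}"

definition tangent_map ::
    "('p, 'm::real_normed_vector) chart set \<Rightarrow> ('q, 'n::real_normed_vector) chart set \<Rightarrow>
     ('p \<Rightarrow> 'q) \<Rightarrow> 'p \<Rightarrow> ('p, 'm) tangent_vector \<Rightarrow> ('q, 'n) tangent_vector" where
  "tangent_map A B F p v = (\<lambda>d. if d \<in> B \<and> F p \<in> fst d
     then let c = chart_at A p in frechet_derivative (snd d \<circ> F \<circ> chart_inv c) (at (snd c p)) (v c)
     else 0)"

type_synonym ('p, 'm) vfield = "'p \<Rightarrow> ('p, 'm) tangent_vector"

definition vfields :: "('p, 'm::real_normed_vector) chart set \<Rightarrow> ('p, 'm) vfield set" where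
  "vfields A = {X. (\<forall>p. X p \<in> tangent_space A p) \<and>
     (\<forall>c\<in>A. smooth_on (\<lambda>u. X (chart_inv c u) c) (snd c ` fst c))}"

definition vf_add :: "('p, 'm::real_vector) vfield \<Rightarrow> ('p, 'm) vfield \<Rightarrow> ('p, 'm) vfield" where
  "vf_add X Y = (\<lambda>p c. X p c + Y p c)"

definition vf_diff :: "('p, 'm::real_vector) vfield \<Rightarrow> ('p, 'm) vfield \<Rightarrow> ('p, 'm) vfield" where
  "vf_diff X Y = (\<lambda>p c. X p c - Y p c)"

definition vf_scale :: "('p \<Rightarrow> real) \<Rightarrow> ('p, 'm::real_vector) vfield \<Rightarrow> ('p, 'm) vfield" where
  "vf_scale f X = (\<lambda>p c. f p *\<^sub>R X p c)"

definition vf_apply ::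
    "('p, 'm::real_normed_vector) chart set \<Rightarrow> ('p, 'm) vfield \<Rightarrow> ('p \<Rightarrow> real) \<Rightarrow> 'p \<Rightarrow> real" where
  "vf_apply A X f p =
     (let c = chart_at A p in frechet_derivative (f \<circ> chart_inv c) (at (snd c p)) (X p c))"

text \<open>The coordinate expression of the bracket satisfying \<open>[X, Y] f = X (Y f) - Y (X f)\<close>.\<close>

definition vf_bracket ::
    "('p, 'm::real_normed_vector) chart set \<Rightarrow> ('p, 'm) vfield \<Rightarrow> ('p, 'm) vfield \<Rightarrow> ('p, 'm) vfield"
  where
  "vf_bracket A X Y = (\<lambda>p c. if c \<in> A \<and> p \<in> fst c
     then frechet_derivative (\<lambda>u. Y (chart_inv c u) c) (at (snd c p)) (X p c)
        - frechet_derivative (\<lambda>u. X (chart_inv c u) c) (at (snd c p)) (Y p c)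
     else 0)"

definition lie_group ::
    "('p::{t2_space,second_countable_topology}, 'm::euclidean_space) chart set \<Rightarrow>
     ('p \<Rightarrow> 'p \<Rightarrow> 'p) \<Rightarrow> 'p \<Rightarrow> ('p \<Rightarrow> 'p) \<Rightarrow> bool" where
  "lie_group A mul e iv \<longleftrightarrow>
     smooth_atlas A \<and> Groups.group mul e iv \<and>
     smooth_map (product_atlas A A) A (\<lambda>(p, q). mul p q) \<and> smooth_map A A iv"

definition left_invariant_vfields ::
    "('p, 'm::real_normed_vector) chart set \<Rightarrow> ('p \<Rightarrow> 'p \<Rightarrow> 'p) \<Rightarrow> ('p, 'm) vfield set" where
  "left_invariant_vfields A mul =
     {X \<in> vfields A. \<forall>p q. X (mul p q) = tangent_map A A (mul p) q (X q)}"

text \<open>\<open>\<iota>\<close> identifies the Lie algebra \<open>('a, br)\<close> with the Lie algebra of left invariant vector fields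
  of the group.\<close>

definition lie_algebra_of_group ::
    "('p, 'm::real_normed_vector) chart set \<Rightarrow> ('p \<Rightarrow> 'p \<Rightarrow> 'p) \<Rightarrow>
     ('a::real_vector \<Rightarrow> 'a \<Rightarrow> 'a) \<Rightarrow> ('a \<Rightarrow> ('p, 'm) vfield) \<Rightarrow> bool" where
  "lie_algebra_of_group A mul br \<iota> \<longleftrightarrow>
     bij_betw \<iota> UNIV (left_invariant_vfields A mul) \<and>
     (\<forall>x y. \<iota> (x + y) = vf_add (\<iota> x) (\<iota> y)) \<and>
     (\<forall>r x. \<iota> (r *\<^sub>R x) = vf_scale (\<lambda>p. r) (\<iota> x)) \<and>
     (\<forall>x y. \<iota> (br x y) = vf_bracket A (\<iota> x) (\<iota> y))"


section \<open>Left invariant tensor fields\<close>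

text \<open>The element of the Lie algebra whose left invariant vector field agrees with \<open>X\<close> at \<open>p\<close>.\<close>

definition left_triv ::
    "('a \<Rightarrow> ('p, 'm) vfield) \<Rightarrow> ('p, 'm) vfield \<Rightarrow> 'p \<Rightarrow> 'a" where
  "left_triv \<iota> X p = (THE x. \<iota> x p = X p)"

definition li_endo ::
    "('a \<Rightarrow> ('p, 'm) vfield) \<Rightarrow> ('a \<Rightarrow> 'a) \<Rightarrow> ('p, 'm) vfield \<Rightarrow> ('p, 'm) vfield" where
  "li_endo \<iota> \<phi> X = (\<lambda>p. \<iota> (\<phi> (left_triv \<iota> X p)) p)"

definition li_form ::
    "('a \<Rightarrow> ('p, 'm) vfield) \<Rightarrow> ('a \<Rightarrow> real) \<Rightarrow> ('p, 'm) vfield \<Rightarrow> 'p \<Rightarrow> real" where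
  "li_form \<iota> \<eta> X p = \<eta> (left_triv \<iota> X p)"

definition li_metric ::
    "('a::real_inner \<Rightarrow> ('p, 'm) vfield) \<Rightarrow> ('p, 'm) vfield \<Rightarrow> ('p, 'm) vfield \<Rightarrow> 'p \<Rightarrow> real" where
  "li_metric \<iota> X Y p = left_triv \<iota> X p \<bullet> left_triv \<iota> Y p"

text \<open>Normalised by \<open>(a\<^sub>1 \<and> a\<^sub>2 \<and> a\<^sub>3)(x\<^sub>1, x\<^sub>2, x\<^sub>3) = det (a\<^sub>i(x\<^sub>j))\<close>.\<close>

definition wedge3 ::
    "('v \<Rightarrow> real) \<Rightarrow> ('v \<Rightarrow> real) \<Rightarrow> ('v \<Rightarrow> real) \<Rightarrow> 'v \<Rightarrow> 'v \<Rightarrow> 'v \<Rightarrow> real" where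
  "wedge3 a b c x y z =
     a x * b y * c z + a y * b z * c x + a z * b x * c y
     - a x * b z * c y - a y * b x * c z - a z * b y * c x"


section \<open>Connections\<close>

text \<open>Only the values of a connection on smooth vector fields are meaningful.\<close>

definition affine_connection ::
    "('p, 'm::real_normed_vector) chart set \<Rightarrow>
     (('p, 'm) vfield \<Rightarrow> ('p, 'm) vfield \<Rightarrow> ('p, 'm) vfield) \<Rightarrow> bool" where
  "affine_connection A D \<longleftrightarrow>
     (\<forall>X\<in>vfields A. \<forall>Y\<in>vfields A. D X Y \<in> vfields A) \<and>
     (\<forall>X\<in>vfields A. \<forall>Y\<in>vfields A. \<forall>Z\<in>vfields A.
        D (vf_add X Y) Z = vf_add (D X Z) (D Y Z) \<and>
        D X (vf_add Y Z) = vf_add (D X Y) (D X Z)) \<and>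
     (\<forall>f X Y. smooth_fun A f \<longrightarrow> X \<in> vfields A \<longrightarrow> Y \<in> vfields A \<longrightarrow>
        D (vf_scale f X) Y = vf_scale f (D X Y) \<and>
        D X (vf_scale f Y) = vf_add (vf_scale (vf_apply A X f) Y) (vf_scale f (D X Y)))"

definition torsion ::
    "('p, 'm::real_normed_vector) chart set \<Rightarrow>
     (('p, 'm) vfield \<Rightarrow> ('p, 'm) vfield \<Rightarrow> ('p, 'm) vfield) \<Rightarrow>
     ('p, 'm) vfield \<Rightarrow> ('p, 'm) vfield \<Rightarrow> ('p, 'm) vfield" where
  "torsion A D X Y = vf_diff (vf_diff (D X Y) (D Y X)) (vf_bracket A X Y)"

definition metric_connection ::
    "('p, 'm::real_normed_vector) chart set \<Rightarrow> ('a::real_inner \<Rightarrow> ('p, 'm) vfield) \<Rightarrow>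
     (('p, 'm) vfield \<Rightarrow> ('p, 'm) vfield \<Rightarrow> ('p, 'm) vfield) \<Rightarrow> bool" where
  "metric_connection A \<iota> D \<longleftrightarrow> affine_connection A D \<and>
     (\<forall>X\<in>vfields A. \<forall>Y\<in>vfields A. \<forall>Z\<in>vfields A. \<forall>p.
        vf_apply A X (li_metric \<iota> Y Z) p = li_metric \<iota> (D X Y) Z p + li_metric \<iota> Y (D X Z) p)"

definition torsion_form ::
    "('p, 'm::real_normed_vector) chart set \<Rightarrow> ('a::real_inner \<Rightarrow> ('p, 'm) vfield) \<Rightarrow>
     (('p, 'm) vfield \<Rightarrow> ('p, 'm) vfield \<Rightarrow> ('p, 'm) vfield) \<Rightarrow>
     ('p, 'm) vfield \<Rightarrow> ('p, 'm) vfield \<Rightarrow> ('p, 'm) vfield \<Rightarrow> 'p \<Rightarrow> real" where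
  "torsion_form A \<iota> D X Y Z = li_metric \<iota> (torsion A D X Y) Z"

definition totally_skew_torsion ::
    "('p, 'm::real_normed_vector) chart set \<Rightarrow> ('a::real_inner \<Rightarrow> ('p, 'm) vfield) \<Rightarrow>
     (('p, 'm) vfield \<Rightarrow> ('p, 'm) vfield \<Rightarrow> ('p, 'm) vfield) \<Rightarrow> bool" where
  "totally_skew_torsion A \<iota> D \<longleftrightarrow>
     (\<forall>X\<in>vfields A. \<forall>Y\<in>vfields A. \<forall>Z\<in>vfields A. \<forall>p.
        torsion_form A \<iota> D X Y Z p = - torsion_form A \<iota> D Y X Z p \<and>
        torsion_form A \<iota> D X Y Z p = - torsion_form A \<iota> D X Z Y p)"

definition canonical_connection ::
    "('p, 'm::real_normed_vector) chart set \<Rightarrow> ('a::real_inner \<Rightarrow> ('p, 'm) vfield) \<Rightarrow>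
     (3 \<Rightarrow> 'a \<Rightarrow> 'a) \<Rightarrow> (3 \<Rightarrow> 'a \<Rightarrow> real) \<Rightarrow> real \<Rightarrow>
     (('p, 'm) vfield \<Rightarrow> ('p, 'm) vfield \<Rightarrow> ('p, 'm) vfield) \<Rightarrow> bool" where
  "canonical_connection A \<iota> \<phi> \<eta> \<beta> D \<longleftrightarrow>
     metric_connection A \<iota> D \<and> totally_skew_torsion A \<iota> D \<and>
     (\<forall>i j k. even_perm3 i j k \<longrightarrow> (\<forall>X\<in>vfields A. \<forall>Y\<in>vfields A.
        vf_diff (D X (li_endo \<iota> (\<phi> i) Y)) (li_endo \<iota> (\<phi> i) (D X Y)) =
        vf_scale (\<lambda>p. \<beta>)
          (vf_diff (vf_scale (li_form \<iota> (\<eta> k) X) (li_endo \<iota> (\<phi> j) Y))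
                   (vf_scale (li_form \<iota> (\<eta> j) X) (li_endo \<iota> (\<phi> k) Y)))))"

end

(*
  The Jacobi identity on (xi_1, xi_2, x) with x horizontal gives beta = 2 delta. On
  horizontal vectors ad xi_i = delta phi_i, so by the Jacobi identity and the invariance of the bracket under
  phi_i it kills [x, y] for horizontal x, y; the common kernel of the ad xi_i is zero, hence [x, y] = 0.

  Left invariant fields form a global smooth frame of the group, in which nabla_x y = [vertical part of x, y]
  defines a metric connection with torsion 2 delta eta_1 wedge eta_2 wedge eta_3. For another metric connection with
  skew torsion the difference tensor B is a 3-form. If the torsions agree, B = 0. If both connections satisfy
  the condition on the derivatives of phi_i, then B(x, phi_i y) = phi_i B(x, y), and a 3-form with this property
  satisfies B(phi_i x, y, z) = - B(phi_i x, y, z), so again B = 0.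
*)
theory Submission
  imports Defs
begin

section \<open>Calculus of smooth maps\<close>

text \<open>The condition that defines the canonical connection ranges over all smooth fields on an
  arbitrary Lie group given by charts, and a competing connection is not assumed left invariant.
  Both difficulties are met by reading fields as functions from the group to the Lie algebra: the
  connection laws determine \<open>D\<close> from its values on the fields \<open>\<iota> x\<close>,
  and at a fixed point the values \<open>D (\<iota> x) (\<iota> y)\<close> form a bilinear map on
  the Lie algebra. The comparison is then algebra, carried out separately at each point. Most of the
  calculus serves to show that this reading preserves smoothness. The formula for nabla is suggested
  by the algebra: ad \<xi>_l is skew for the metric, and its commutator with \<phi>_i is already the
  derivative prescribed along \<xi>_l. Along horizontal directions the prescribed derivative is
  zero, and the zero operator serves. That \<beta> is nonzero enters twice: it is cancelled in
  \<beta> (\<beta> - 2\<delta>) = 0, and in the form \<delta> \<noteq> 0 it makes the common kernel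
  trivial and lets the vertical space be rescaled to so(3).\<close>

lemma Ck_on_cong:
  assumes "open S" "\<And>x. x \<in> S \<Longrightarrow> f x = g x" "Ck_on k f S"
  shows "Ck_on k g S"
  using assms(2,3)
proof (induction k arbitrary: f g)
  case 0
  then show ?case
    using continuous_on_cong[of S S f g] by simp
next
  case (Suc k)
  have d: "f differentiable (at x)" if "x \<in> S" for x
    using Suc.prems that by simp
  have e: "frechet_derivative f (at x) = frechet_derivative g (at x)" if "x \<in> S" for x
    using frechet_derivative_transform_within_open[OF d[OF that] assms(1) that] Suc.prems(1) by blast
  have "g differentiable (at x)" if "x \<in> S" for x
  proof -
    have "(f has_derivative frechet_derivative f (at x)) (at x)"
      using d[OF that] frechet_derivative_works by blast
    then have "(g has_derivative frechet_derivative f (at x)) (at x)"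
      using has_derivative_transform_within_open[OF _ assms(1) that] Suc.prems(1) by blast
    then show ?thesis
      by (auto simp: differentiable_def)
  qed
  moreover have "Ck_on k (\<lambda>x. frechet_derivative g (at x) v) S" for v
    using Suc.IH[of "\<lambda>x. frechet_derivative f (at x) v"] e Suc.prems(2) by simp
  ultimately show ?case
    by simp
qed

lemma Ck_on_subset: "Ck_on k f S \<Longrightarrow> T \<subseteq> S \<Longrightarrow> Ck_on k f T"
  by (induction k arbitrary: f) (auto intro: continuous_on_subset)

text \<open>Continuity and differentiability are conditions near each point, and the induction hands
  the same neighbourhood on to the derivatives. Needed where a formula is available only in a chart
  around a moving point.\<close>

lemma Ck_on_local:
  assumes "\<And>x. x \<in> S \<Longrightarrow> \<exists>T. open T \<and> x \<in> T \<and> Ck_on k f T"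
  shows "Ck_on k f S"
  using assms
proof (induction k arbitrary: f)
  case 0
  have "continuous (at x within S) f" if x: "x \<in> S" for x
  proof -
    obtain T where T: "open T" "x \<in> T" "continuous_on T f"
      using 0[OF x] by auto
    then have "continuous (at x) f"
      by (simp add: continuous_on_eq_continuous_at)
    then show ?thesis
      by (rule continuous_at_imp_continuous_at_within)
  qed
  then show ?case
    by (simp add: continuous_on_eq_continuous_within)
next
  case (Suc k)
  have "f differentiable (at x)" if "x \<in> S" for x
    using Suc.prems[OF that] by auto
  moreover have "Ck_on k (\<lambda>x. frechet_derivative f (at x) v) S" for v
  proof (rule Suc.IH)
    fix x assume "x \<in> S"
    then show "\<exists>T. open T \<and> x \<in> T \<and> Ck_on k (\<lambda>x. frechet_derivative f (at x) v) T"
      using Suc.prems[of x] by auto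
  qed
  ultimately show ?case
    by simp
qed

lemma Ck_on_SucD:
  assumes "open S" "Ck_on (Suc k) f S"
  shows "Ck_on k f S"
  using assms(2)
proof (induction k arbitrary: f)
  case 0
  then show ?case
    using assms(1) by (simp add: continuous_on_eq_continuous_at differentiable_imp_continuous_within)
next
  case (Suc k)
  then show ?case
    by auto
qed

lemma Ck_on_const: "Ck_on k (\<lambda>x. c) S"
  by (induction k arbitrary: c) auto

lemma Ck_on_bounded_linear:
  assumes "bounded_linear L"
  shows "Ck_on k L S"
proof (cases k)
  case 0
  then show ?thesis
    using assms by (simp add: linear_continuous_on)
next
  case (Suc l)
  have "frechet_derivative L (at x) = L" for x
    using frechet_derivative_at[OF bounded_linear_imp_has_derivative[OF assms]] by simp
  moreover have "L differentiable (at x)" for x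
    by (simp add: assms bounded_linear_imp_differentiable)
  ultimately show ?thesis
    using Suc by (simp add: Ck_on_const)
qed

lemma frechet_derivative_has_derivative:
  "f differentiable (at x) \<Longrightarrow> (f has_derivative frechet_derivative f (at x)) (at x)"
  using frechet_derivative_works by blast

lemma linear_frechet_derivative: "f differentiable (at x) \<Longrightarrow> linear (frechet_derivative f (at x))"
  using has_derivative_linear frechet_derivative_has_derivative by blast

text \<open>\<open>Ck_on\<close> controls derivatives in fixed directions only. A direction that
  varies with the point is brought to this form by expansion over the basis.\<close>

lemma frechet_derivative_expand:
  fixes f :: "'a::euclidean_space \<Rightarrow> 'b::real_normed_vector"
  assumes "f differentiable (at x)"
  shows "frechet_derivative f (at x) v = (\<Sum>b\<in>Basis. (v \<bullet> b) *\<^sub>R frechet_derivative f (at x) b)"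
proof -
  have "frechet_derivative f (at x) (\<Sum>b\<in>Basis. (v \<bullet> b) *\<^sub>R b) =
      (\<Sum>b\<in>Basis. (v \<bullet> b) *\<^sub>R frechet_derivative f (at x) b)"
    using linear_frechet_derivative[OF assms] by (simp add: linear_sum linear_scale)
  then show ?thesis
    by (simp add: euclidean_representation)
qed

lemma Ck_on_compose_bounded_linear:
  assumes L: "bounded_linear L" and "open S" "Ck_on k f S"
  shows "Ck_on k (\<lambda>x. L (f x)) S"
  using assms(3)
proof (induction k arbitrary: f)
  case 0
  then show ?case
    using L bounded_linear.continuous_on by auto
next
  case (Suc k)
  have d: "((\<lambda>x. L (f x)) has_derivative (\<lambda>v. L (frechet_derivative f (at x) v))) (at x)" if "x \<in> S" for x
    by (rule bounded_linear.has_derivative[OF L frechet_derivative_has_derivative]) (use Suc.prems that in auto)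
  have e: "frechet_derivative (\<lambda>x. L (f x)) (at x) = (\<lambda>v. L (frechet_derivative f (at x) v))" if "x \<in> S" for x
    using frechet_derivative_at[OF d[OF that]] by simp
  have "Ck_on k (\<lambda>x. frechet_derivative (\<lambda>x. L (f x)) (at x) v) S" for v
    by (rule Ck_on_cong[OF assms(2) _ Suc.IH[of "\<lambda>x. frechet_derivative f (at x) v"]])
      (use e Suc.prems in auto)
  then show ?case
    using d by (auto simp: differentiable_def)
qed

lemma Ck_on_add:
  assumes "open S" "Ck_on k f S" "Ck_on k g S"
  shows "Ck_on k (\<lambda>x. f x + g x) S"
  using assms(2,3)
proof (induction k arbitrary: f g)
  case 0
  then show ?case
    by (auto intro: continuous_on_add)
next
  case (Suc k)
  have d: "((\<lambda>x. f x + g x) has_derivative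
      (\<lambda>v. frechet_derivative f (at x) v + frechet_derivative g (at x) v)) (at x)" if "x \<in> S" for x
    using Suc.prems that by (intro has_derivative_add frechet_derivative_has_derivative) auto
  have e: "frechet_derivative (\<lambda>x. f x + g x) (at x) =
      (\<lambda>v. frechet_derivative f (at x) v + frechet_derivative g (at x) v)" if "x \<in> S" for x
    using frechet_derivative_at[OF d[OF that]] by simp
  have "Ck_on k (\<lambda>x. frechet_derivative (\<lambda>x. f x + g x) (at x) v) S" for v
    by (rule Ck_on_cong[OF assms(1) _ Suc.IH[of "\<lambda>x. frechet_derivative f (at x) v"
      "\<lambda>x. frechet_derivative g (at x) v"]]) (use e Suc.prems in auto)
  then show ?case
    using d by (auto simp: differentiable_def)
qed

lemma Ck_on_sum:
  assumes "open S" "\<And>i. i \<in> I \<Longrightarrow> Ck_on k (f i) S"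
  shows "Ck_on k (\<lambda>x. \<Sum>i\<in>I. f i x) S"
  using assms by (induction I rule: infinite_finite_induct) (auto simp: Ck_on_const Ck_on_add)

text \<open>The product rule yields two expressions of the same shape, each with one factor
  differentiated, so the induction runs over both factors at once and the undifferentiated one is
  lowered by \<open>Ck_on_SucD\<close>.\<close>

lemma Ck_on_bilinear:
  assumes B: "bounded_bilinear B" and "open S" "Ck_on k f S" "Ck_on k g S"
  shows "Ck_on k (\<lambda>x. B (f x) (g x)) S"
  using assms(3,4)
proof (induction k arbitrary: f g)
  case 0
  then show ?case
    using bounded_bilinear.continuous_on[OF B] by auto
next
  case (Suc k)
  have d: "((\<lambda>x. B (f x) (g x)) has_derivative
      (\<lambda>v. B (f x) (frechet_derivative g (at x) v) + B (frechet_derivative f (at x) v) (g x))) (at x)"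
    if "x \<in> S" for x
    using Suc.prems that
    by (intro bounded_bilinear.FDERIV[OF B] frechet_derivative_has_derivative) auto
  have e: "frechet_derivative (\<lambda>x. B (f x) (g x)) (at x) =
      (\<lambda>v. B (f x) (frechet_derivative g (at x) v) + B (frechet_derivative f (at x) v) (g x))"
    if "x \<in> S" for x
    using frechet_derivative_at[OF d[OF that]] by simp
  have "Ck_on k (\<lambda>x. B (f x) (frechet_derivative g (at x) v) + B (frechet_derivative f (at x) v) (g x)) S"
    for v
    using Suc.prems Ck_on_SucD[OF assms(2) Suc.prems(1)] Ck_on_SucD[OF assms(2) Suc.prems(2)]
    by (intro Ck_on_add Suc.IH assms(2)) auto
  then have "Ck_on k (\<lambda>x. frechet_derivative (\<lambda>x. B (f x) (g x)) (at x) v) S" for v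
    by (rule Ck_on_cong[OF assms(2), rotated]) (use e in auto)
  then show ?case
    using d by (auto simp: differentiable_def)
qed

text \<open>Only \<open>g\<close> varies in the induction: the chain rule leaves derivatives of
  \<open>g\<close> composed with the same \<open>f\<close>. Their direction is the derivative of
  \<open>f\<close>, which depends on the point and is expanded over a basis, whence the Euclidean
  middle space.\<close>

lemma Ck_on_compose:
  fixes f :: "'a::real_normed_vector \<Rightarrow> 'b::euclidean_space" and g :: "'b \<Rightarrow> 'c::real_normed_vector"
  assumes "open S" "open T" "f ` S \<subseteq> T" "Ck_on k f S" "Ck_on k g T"
  shows "Ck_on k (\<lambda>x. g (f x)) S"
  using assms(4,5)
proof (induction k arbitrary: g)
  case 0
  then show ?case
    using assms(3) continuous_on_compose2[of T g S f] by simp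
next
  case (Suc k)
  have fT: "f x \<in> T" if "x \<in> S" for x
    using that assms(3) by auto
  have d: "((\<lambda>x. g (f x)) has_derivative
      (\<lambda>v. frechet_derivative g (at (f x)) (frechet_derivative f (at x) v))) (at x)" if "x \<in> S" for x
    by (rule has_derivative_compose[OF frechet_derivative_has_derivative frechet_derivative_has_derivative])
      (use Suc.prems that fT in auto)
  have e: "frechet_derivative (\<lambda>x. g (f x)) (at x) v =
      (\<Sum>b\<in>Basis. (frechet_derivative f (at x) v \<bullet> b) *\<^sub>R frechet_derivative g (at (f x)) b)"
    if "x \<in> S" for x v
    using frechet_derivative_at[OF d[OF that], symmetric]
      frechet_derivative_expand[of g "f x" "frechet_derivative f (at x) v"] Suc.prems(2) fT[OF that] by simp
  have "Ck_on k (\<lambda>x. frechet_derivative g (at (f x)) b) S" for b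
    using Suc.IH[of "\<lambda>z. frechet_derivative g (at z) b"] Suc.prems(2)
      Ck_on_SucD[OF assms(1) Suc.prems(1)] by simp
  then have "Ck_on k (\<lambda>x. (frechet_derivative f (at x) v \<bullet> b) *\<^sub>R frechet_derivative g (at (f x)) b) S" for v b
    using Suc.prems
    by (intro Ck_on_bilinear[OF bounded_bilinear_scaleR assms(1)]
        Ck_on_compose_bounded_linear[OF bounded_linear_inner_left assms(1)]) auto
  then have "Ck_on k (\<lambda>x. \<Sum>b\<in>Basis.
      (frechet_derivative f (at x) v \<bullet> b) *\<^sub>R frechet_derivative g (at (f x)) b) S" for v
    by (intro Ck_on_sum assms(1))
  then have "Ck_on k (\<lambda>x. frechet_derivative (\<lambda>x. g (f x)) (at x) v) S" for v
    by (rule Ck_on_cong[OF assms(1), rotated]) (use e in auto)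
  then show ?case
    using d by (auto simp: differentiable_def)
qed

section \<open>Closure rules for smooth maps\<close>

lemma smooth_on_cong:
  "smooth_on f S \<Longrightarrow> open S \<Longrightarrow> (\<And>x. x \<in> S \<Longrightarrow> f x = g x) \<Longrightarrow> smooth_on g S"
  unfolding smooth_on_def using Ck_on_cong by blast

lemma smooth_on_subset: "smooth_on f S \<Longrightarrow> T \<subseteq> S \<Longrightarrow> smooth_on f T"
  unfolding smooth_on_def using Ck_on_subset by blast

lemma smooth_on_local:
  "(\<And>x. x \<in> S \<Longrightarrow> \<exists>T. open T \<and> x \<in> T \<and> smooth_on f T) \<Longrightarrow> smooth_on f S"
  unfolding smooth_on_def using Ck_on_local by metis

lemma smooth_on_differentiable: "smooth_on f S \<Longrightarrow> x \<in> S \<Longrightarrow> f differentiable (at x)"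
  unfolding smooth_on_def using Ck_on.simps(2)[of 0 f S] by blast

lemma smooth_on_has_derivative:
  "smooth_on f S \<Longrightarrow> x \<in> S \<Longrightarrow> (f has_derivative frechet_derivative f (at x)) (at x)"
  using smooth_on_differentiable frechet_derivative_has_derivative by blast

lemma smooth_on_frechet_derivative:
  "smooth_on f S \<Longrightarrow> smooth_on (\<lambda>x. frechet_derivative f (at x) v) S"
  unfolding smooth_on_def using Ck_on.simps(2)[of _ f S] by blast

lemma smooth_on_const: "smooth_on (\<lambda>x. c) S"
  by (simp add: smooth_on_def Ck_on_const)

lemma smooth_on_bounded_linear: "bounded_linear L \<Longrightarrow> smooth_on L S"
  by (simp add: smooth_on_def Ck_on_bounded_linear)

lemma smooth_on_compose_bounded_linear:
  "bounded_linear L \<Longrightarrow> open S \<Longrightarrow> smooth_on f S \<Longrightarrow> smooth_on (\<lambda>x. L (f x)) S"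
  by (simp add: smooth_on_def Ck_on_compose_bounded_linear)

lemma smooth_on_add:
  "open S \<Longrightarrow> smooth_on f S \<Longrightarrow> smooth_on g S \<Longrightarrow> smooth_on (\<lambda>x. f x + g x) S"
  by (simp add: smooth_on_def Ck_on_add)

lemma smooth_on_sum:
  "open S \<Longrightarrow> (\<And>i. i \<in> I \<Longrightarrow> smooth_on (f i) S) \<Longrightarrow> smooth_on (\<lambda>x. \<Sum>i\<in>I. f i x) S"
  by (simp add: smooth_on_def Ck_on_sum)

lemma smooth_on_bilinear:
  "bounded_bilinear B \<Longrightarrow> open S \<Longrightarrow> smooth_on f S \<Longrightarrow> smooth_on g S \<Longrightarrow>
    smooth_on (\<lambda>x. B (f x) (g x)) S"
  by (simp add: smooth_on_def Ck_on_bilinear)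

lemma smooth_on_compose:
  fixes f :: "'a::real_normed_vector \<Rightarrow> 'b::euclidean_space" and g :: "'b \<Rightarrow> 'c::real_normed_vector"
  assumes "open S" "open T" "f ` S \<subseteq> T" "smooth_on f S" "smooth_on g T"
  shows "smooth_on (\<lambda>x. g (f x)) S"
  using assms Ck_on_compose unfolding smooth_on_def by blast

lemma smooth_on_Pair:
  assumes "open S" "smooth_on f S" "smooth_on g S"
  shows "smooth_on (\<lambda>x. (f x, g x)) S"
proof -
  \<comment> \<open>A pair is the sum of two linear embeddings, so the rules for sums and for linear
    maps suffice.\<close>
  have "smooth_on (\<lambda>x. (f x, 0) + (0, g x)) S"
    using assms
    by (intro smooth_on_add smooth_on_compose_bounded_linear[where L = "\<lambda>z. (z, 0)"]
        smooth_on_compose_bounded_linear[where L = "\<lambda>z. (0, z)"])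
      (auto intro!: bounded_linear_Pair bounded_linear_ident bounded_linear_zero)
  then show ?thesis
    by simp
qed

lemma smooth_on_directional_derivative:
  fixes f :: "'b::euclidean_space \<Rightarrow> 'c::real_normed_vector"
  assumes "open U" "open S" "smooth_on f S" "a ` U \<subseteq> S" "smooth_on a U" "smooth_on Y U"
  shows "smooth_on (\<lambda>u. frechet_derivative f (at (a u)) (Y u)) U"
proof (rule smooth_on_cong[OF _ assms(1)])
  have "smooth_on (\<lambda>u. frechet_derivative f (at (a u)) b) U" for b
    by (rule smooth_on_compose[OF assms(1,2,4,5) smooth_on_frechet_derivative[OF assms(3)]])
  then show "smooth_on (\<lambda>u. \<Sum>b\<in>Basis. (Y u \<bullet> b) *\<^sub>R frechet_derivative f (at (a u)) b) U"
    using assms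
    by (intro smooth_on_sum smooth_on_bilinear[OF bounded_bilinear_scaleR]
        smooth_on_compose_bounded_linear[OF bounded_linear_inner_left]) auto
  show "(\<Sum>b\<in>Basis. (Y u \<bullet> b) *\<^sub>R frechet_derivative f (at (a u)) b) =
      frechet_derivative f (at (a u)) (Y u)" if "u \<in> U" for u
    using frechet_derivative_expand[of f "a u" "Y u"] smooth_on_differentiable[OF assms(3), of "a u"]
      that assms(4) by auto
qed

lemma smooth_on_partial_derivative:
  fixes h :: "'a::euclidean_space \<times> 'b::euclidean_space \<Rightarrow> 'c::real_normed_vector"
  assumes "open U" "open W" "smooth_on h W" "\<And>u. u \<in> U \<Longrightarrow> (s u, a u) \<in> W"
    and "smooth_on s U" "smooth_on a U" "smooth_on Y U"
  shows "smooth_on (\<lambda>u. frechet_derivative (\<lambda>w. h (s u, w)) (at (a u)) (Y u)) U"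
proof (rule smooth_on_cong[OF _ assms(1)])
  show "smooth_on (\<lambda>u. frechet_derivative h (at (s u, a u)) (0, Y u)) U"
    by (rule smooth_on_directional_derivative[OF assms(1,2,3) _ smooth_on_Pair smooth_on_Pair])
      (use assms in \<open>auto simp: smooth_on_const\<close>)
  show "frechet_derivative h (at (s u, a u)) (0, Y u) =
      frechet_derivative (\<lambda>w. h (s u, w)) (at (a u)) (Y u)" if "u \<in> U" for u
  proof -
    have "(h has_derivative frechet_derivative h (at (s u, a u))) (at (s u, a u))"
      using smooth_on_has_derivative[OF assms(3) assms(4)[OF that]] .
    moreover have "((\<lambda>w. (s u, w)) has_derivative (\<lambda>v. (0, v))) (at (a u))"
      by (intro derivative_eq_intros) auto
    ultimately have "((\<lambda>w. h (s u, w)) has_derivative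
        (\<lambda>v. frechet_derivative h (at (s u, a u)) (0, v))) (at (a u))"
      using has_derivative_compose[of "\<lambda>w. (s u, w)"] by blast
    then show ?thesis
      by (simp add: frechet_derivative_at[symmetric])
  qed
qed

section \<open>Tangent maps\<close>

lemma atlas_chart:
  assumes "smooth_atlas A" "c \<in> A"
  shows "open (fst c)" and "open (snd c ` fst c)" and "continuous_on (fst c) (snd c)"
    and "continuous_on (snd c ` fst c) (chart_inv c)"
    and "p \<in> fst c \<Longrightarrow> chart_inv c (snd c p) = p"
    and "u \<in> snd c ` fst c \<Longrightarrow> chart_inv c u \<in> fst c"
    and "u \<in> snd c ` fst c \<Longrightarrow> snd c (chart_inv c u) = u"
    and "inj_on (snd c) (fst c)"
proof -
  have h: "open (fst c)" "open (snd c ` fst c)"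
    "homeomorphism (fst c) (snd c ` fst c) (snd c) (chart_inv c)"
    using assms by (auto simp: smooth_atlas_def)
  then show "open (fst c)" "open (snd c ` fst c)" "continuous_on (fst c) (snd c)"
    "continuous_on (snd c ` fst c) (chart_inv c)"
    "p \<in> fst c \<Longrightarrow> chart_inv c (snd c p) = p"
    "u \<in> snd c ` fst c \<Longrightarrow> chart_inv c u \<in> fst c"
    "u \<in> snd c ` fst c \<Longrightarrow> snd c (chart_inv c u) = u"
    by (auto simp: homeomorphism_def)
  show "inj_on (snd c) (fst c)"
    using homeomorphism_apply1[OF h(3)] by (rule inj_on_inverseI)
qed

lemma chart_at:
  assumes "smooth_atlas A"
  shows "chart_at A p \<in> A" and "p \<in> fst (chart_at A p)"
proof -
  have "\<exists>c. c \<in> A \<and> p \<in> fst c"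
    using assms UNIV_I[of p] unfolding smooth_atlas_def by blast
  then have "chart_at A p \<in> A \<and> p \<in> fst (chart_at A p)"
    unfolding chart_at_def by (rule someI_ex)
  then show "chart_at A p \<in> A" "p \<in> fst (chart_at A p)"
    by auto
qed

lemma open_chart_image:
  assumes "smooth_atlas A" "c \<in> A" "open V"
  shows "open (snd c ` (fst c \<inter> V))"
proof -
  have "snd c ` (fst c \<inter> V) = snd c ` fst c \<inter> chart_inv c -` V"
    using atlas_chart(5,6,7)[OF assms(1,2)] by force
  then show ?thesis
    using continuous_open_preimage[OF atlas_chart(4,2)[OF assms(1,2)] assms(3)] by simp
qed

lemma smooth_map_id: "smooth_atlas A \<Longrightarrow> smooth_map A A id"
  unfolding smooth_map_def smooth_atlas_def by (simp add: continuous_on_id')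

text \<open>Besides smooth maps between manifolds, this covers coordinate changes (\<open>F = id\<close>).\<close>

lemma chart_chain_rule:
  assumes A: "smooth_atlas A" and B: "smooth_atlas B" and F: "smooth_map A B F"
    and c: "c \<in> A" "p \<in> fst c" and d: "d \<in> B" "F p \<in> fst d"
    and g: "(g \<circ> chart_inv d) differentiable (at (snd d (F p)))"
  shows "(g \<circ> F \<circ> chart_inv c) differentiable (at (snd c p))"
    and "frechet_derivative (g \<circ> F \<circ> chart_inv c) (at (snd c p)) v =
      frechet_derivative (g \<circ> chart_inv d) (at (snd d (F p)))
        (frechet_derivative (snd d \<circ> F \<circ> chart_inv c) (at (snd c p)) v)"
proof -
  define T where "T = snd c ` (fst c \<inter> F -` fst d)"
  have "open (F -` fst d)"
    using F atlas_chart(1)[OF B d(1)] by (simp add: smooth_map_def open_vimage)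
  then have T: "open T" "snd c p \<in> T"
    using open_chart_image[OF A c(1)] c(2) d(2) unfolding T_def by simp_all
  have F': "(snd d \<circ> F \<circ> chart_inv c has_derivative
      frechet_derivative (snd d \<circ> F \<circ> chart_inv c) (at (snd c p))) (at (snd c p))"
    by (rule smooth_on_has_derivative[OF _ T(2)]) (use F c(1) d(1) in \<open>simp add: smooth_map_def T_def\<close>)
  have e: "(snd d \<circ> F \<circ> chart_inv c) (snd c p) = snd d (F p)"
    using atlas_chart(5)[OF A c] by simp
  have "((g \<circ> chart_inv d) \<circ> (snd d \<circ> F \<circ> chart_inv c) has_derivative
      frechet_derivative (g \<circ> chart_inv d) (at (snd d (F p))) \<circ>
        frechet_derivative (snd d \<circ> F \<circ> chart_inv c) (at (snd c p))) (at (snd c p))"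
    by (rule diff_chain_at[OF F']) (use frechet_derivative_has_derivative[OF g] e in simp)
  then have "(g \<circ> F \<circ> chart_inv c has_derivative
      frechet_derivative (g \<circ> chart_inv d) (at (snd d (F p))) \<circ>
        frechet_derivative (snd d \<circ> F \<circ> chart_inv c) (at (snd c p))) (at (snd c p))"
  proof (rule has_derivative_transform_within_open[OF _ T])
    fix u assume "u \<in> T"
    then have "F (chart_inv c u) \<in> fst d"
      using atlas_chart(5)[OF A c(1)] by (auto simp: T_def)
    then show "((g \<circ> chart_inv d) \<circ> (snd d \<circ> F \<circ> chart_inv c)) u = (g \<circ> F \<circ> chart_inv c) u"
      using atlas_chart(5)[OF B d(1)] by simp
  qed
  then have d: "(g \<circ> F \<circ> chart_inv c has_derivative
      frechet_derivative (g \<circ> chart_inv d) (at (snd d (F p))) \<circ>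
        frechet_derivative (snd d \<circ> F \<circ> chart_inv c) (at (snd c p))) (at (snd c p))" .
  then show "(g \<circ> F \<circ> chart_inv c) differentiable (at (snd c p))"
    unfolding differentiable_def by blast
  show "frechet_derivative (g \<circ> F \<circ> chart_inv c) (at (snd c p)) v =
      frechet_derivative (g \<circ> chart_inv d) (at (snd d (F p)))
        (frechet_derivative (snd d \<circ> F \<circ> chart_inv c) (at (snd c p)) v)"
    by (simp only: frechet_derivative_at[OF d, symmetric] o_apply)
qed

lemma smooth_map_differentiable:
  assumes A: "smooth_atlas A" and F: "smooth_map A B F"
    and c: "c \<in> A" "p \<in> fst c" and d: "d \<in> B" "F p \<in> fst d"
  shows "(snd d \<circ> F \<circ> chart_inv c) differentiable (at (snd c p))"
proof (rule smooth_on_differentiable)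
  show "smooth_on (snd d \<circ> F \<circ> chart_inv c) (snd c ` (fst c \<inter> F -` fst d))"
    using F c(1) d(1) unfolding smooth_map_def by blast
  show "snd c p \<in> snd c ` (fst c \<inter> F -` fst d)"
    using c d by blast
qed

lemma frechet_derivative_chart_inv:
  assumes "smooth_atlas A" "c \<in> A" "p \<in> fst c"
  shows "frechet_derivative (snd c \<circ> chart_inv c) (at (snd c p)) v = v"
proof -
  have "((\<lambda>u. u) has_derivative (\<lambda>v. v)) (at (snd c p))"
    by simp
  then have "(snd c \<circ> chart_inv c has_derivative (\<lambda>v. v)) (at (snd c p))"
    by (rule has_derivative_transform_within_open[OF _ atlas_chart(2)[OF assms(1,2)]])
      (use assms(3) atlas_chart(7)[OF assms(1,2)] in auto)
  then show ?thesis
    by (simp add: frechet_derivative_at[symmetric])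
qed

lemma tangent_space_change:
  assumes "v \<in> tangent_space A p" "c \<in> A" "p \<in> fst c" "d \<in> A" "p \<in> fst d"
  shows "frechet_derivative (snd d \<circ> chart_inv c) (at (snd c p)) (v c) = v d"
  using assms(1)[unfolded tangent_space_def mem_Collect_eq, THEN conjunct1, rule_format, OF assms(2,4,3,5)]
  by (rule sym)

lemma tangent_space_outside:
  "v \<in> tangent_space A p \<Longrightarrow> \<not> (c \<in> A \<and> p \<in> fst c) \<Longrightarrow> v c = 0"
  unfolding tangent_space_def by blast

text \<open>Coordinate changes compose by the chain rule, so the transformation rule from a single
  chart \<open>c\<close> gives it between any two charts.\<close>

lemma tangent_spaceI:
  assumes A: "smooth_atlas A" and c: "c \<in> A" "p \<in> fst c"
    and "\<And>d. d \<in> A \<Longrightarrow> p \<in> fst d \<Longrightarrow> v d = frechet_derivative (snd d \<circ> chart_inv c) (at (snd c p)) (v c)"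
    and "\<And>d. \<not> (d \<in> A \<and> p \<in> fst d) \<Longrightarrow> v d = 0"
  shows "v \<in> tangent_space A p"
proof -
  have "v e = frechet_derivative (snd e \<circ> chart_inv d) (at (snd d p)) (v d)"
    if d: "d \<in> A" "p \<in> fst d" and e: "e \<in> A" "p \<in> fst e" for d e
    using chart_chain_rule(2)[OF A A smooth_map_id[OF A] c, of d "snd e" "v c"]
      smooth_map_differentiable[OF A smooth_map_id[OF A] d, of e]
      d e assms(4)[OF d] assms(4)[OF e] by simp
  then show ?thesis
    using assms(5) unfolding tangent_space_def by blast
qed

lemma tangent_space_subspace:
  assumes A: "smooth_atlas A"
  shows "u \<in> tangent_space A p \<Longrightarrow> v \<in> tangent_space A p \<Longrightarrow> (\<lambda>c. u c + v c) \<in> tangent_space A p"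
    and "v \<in> tangent_space A p \<Longrightarrow> (\<lambda>c. r *\<^sub>R v c) \<in> tangent_space A p"
    and "(\<lambda>c. 0) \<in> tangent_space A p"
proof -
  have l: "linear (frechet_derivative (snd d \<circ> chart_inv c) (at (snd c p)))"
    if "c \<in> A" "p \<in> fst c" "d \<in> A" "p \<in> fst d" for c d
    using smooth_map_differentiable[OF A smooth_map_id[OF A], of c p d] that
    by (simp add: linear_frechet_derivative)
  show "(\<lambda>c. u c + v c) \<in> tangent_space A p" if "u \<in> tangent_space A p" "v \<in> tangent_space A p"
    by (rule tangent_spaceI[OF A chart_at[OF A, of p]])
      (use that chart_at[OF A, of p] in \<open>simp_all add: linear_add[OF l] tangent_space_change tangent_space_outside\<close>)
  show "(\<lambda>c. r *\<^sub>R v c) \<in> tangent_space A p" if "v \<in> tangent_space A p"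
    by (rule tangent_spaceI[OF A chart_at[OF A, of p]])
      (use that chart_at[OF A, of p] in \<open>simp_all add: linear_scale[OF l] tangent_space_change tangent_space_outside\<close>)
  show "(\<lambda>c. 0) \<in> tangent_space A p"
    by (rule tangent_spaceI[OF A chart_at[OF A, of p]])
      (use chart_at[OF A, of p] in \<open>simp_all add: linear_0[OF l]\<close>)
qed

lemma tangent_space_eqI:
  assumes "u \<in> tangent_space A p" "v \<in> tangent_space A p" "c \<in> A" "p \<in> fst c" "u c = v c"
  shows "u = v"
proof
  fix d
  show "u d = v d"
    using assms tangent_space_change[of u A p c d] tangent_space_change[of v A p c d]
      tangent_space_outside[of u A p d] tangent_space_outside[of v A p d]
    by (cases "d \<in> A \<and> p \<in> fst d") simp_all
qed

text \<open>\<open>tangent_map\<close> is computed in a chosen chart; the transformation rule for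
  tangent vectors and the chain rule remove the choice.\<close>

lemma tangent_map_eq:
  assumes A: "smooth_atlas A" and F: "smooth_map A B F" and B: "smooth_atlas B"
    and v: "v \<in> tangent_space A p" and c: "c \<in> A" "p \<in> fst c" and d: "d \<in> B" "F p \<in> fst d"
  shows "tangent_map A B F p v d = frechet_derivative (snd d \<circ> F \<circ> chart_inv c) (at (snd c p)) (v c)"
proof -
  define c' where "c' = chart_at A p"
  have c': "c' \<in> A" "p \<in> fst c'"
    using chart_at[OF A] by (auto simp: c'_def)
  have "frechet_derivative (snd d \<circ> F \<circ> chart_inv c') (at (snd c' p)) (v c') =
    frechet_derivative (snd d \<circ> F \<circ> chart_inv c) (at (snd c p)) (v c)"
    using chart_chain_rule(2)[OF A A smooth_map_id[OF A] c', of c "snd d \<circ> F" "v c'"]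
      smooth_map_differentiable[OF A F c d] c tangent_space_change[OF v c' c] by simp
  then show ?thesis
    using d by (simp add: tangent_map_def Let_def c'_def)
qed

lemma tangent_map_in:
  assumes A: "smooth_atlas A" and F: "smooth_map A B F" and B: "smooth_atlas B"
    and v: "v \<in> tangent_space A p"
  shows "tangent_map A B F p v \<in> tangent_space B (F p)"
proof -
  define c where "c = chart_at A p"
  define d where "d = chart_at B (F p)"
  have c: "c \<in> A" "p \<in> fst c"
    using chart_at[OF A] by (auto simp: c_def)
  have d: "d \<in> B" "F p \<in> fst d"
    using chart_at[OF B] by (auto simp: d_def)
  show ?thesis
  proof (rule tangent_spaceI[OF B d])
    fix e assume e: "e \<in> B" "F p \<in> fst e"
    show "tangent_map A B F p v e =
      frechet_derivative (snd e \<circ> chart_inv d) (at (snd d (F p))) (tangent_map A B F p v d)"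
      using chart_chain_rule(2)[OF A B F c d, of "snd e" "v c"] tangent_map_eq[OF A F B v c d]
        tangent_map_eq[OF A F B v c e]
        smooth_map_differentiable[OF B smooth_map_id[OF B] d, of e] e by simp
  qed (auto simp: tangent_map_def)
qed

lemma tangent_map_comp:
  assumes A: "smooth_atlas A" and F: "smooth_map A B F" and B: "smooth_atlas B"
    and G: "smooth_map B C G" and C: "smooth_atlas C" and GF: "smooth_map A C (G \<circ> F)"
    and v: "v \<in> tangent_space A p"
  shows "tangent_map B C G (F p) (tangent_map A B F p v) = tangent_map A C (G \<circ> F) p v"
proof -
  define c where "c = chart_at A p"
  define d where "d = chart_at B (F p)"
  define e where "e = chart_at C (G (F p))"
  have c: "c \<in> A" "p \<in> fst c"
    using chart_at[OF A] by (auto simp: c_def)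
  have d: "d \<in> B" "F p \<in> fst d"
    using chart_at[OF B] by (auto simp: d_def)
  have e: "e \<in> C" "G (F p) \<in> fst e"
    using chart_at[OF C] by (auto simp: e_def)
  note Fv = tangent_map_in[OF A F B v]
  show ?thesis
  proof (rule tangent_space_eqI[OF tangent_map_in[OF B G C Fv] _ e])
    show "tangent_map A C (G \<circ> F) p v \<in> tangent_space C (G (F p))"
      using tangent_map_in[OF A GF C v] by simp
    show "tangent_map B C G (F p) (tangent_map A B F p v) e = tangent_map A C (G \<circ> F) p v e"
      using tangent_map_eq[OF B G C Fv d e] tangent_map_eq[OF A F B v c d]
        tangent_map_eq[OF A GF C v c, of e] e chart_chain_rule(2)[OF A B F c d, of "snd e \<circ> G" "v c"]
        smooth_map_differentiable[OF B G d e] by (simp add: o_assoc)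
  qed
qed

lemma tangent_map_id:
  assumes A: "smooth_atlas A" and v: "v \<in> tangent_space A p"
  shows "tangent_map A A id p v = v"
proof -
  note c = chart_at[OF A, of p]
  note I = smooth_map_id[OF A]
  show ?thesis
    by (rule tangent_space_eqI[OF _ v c])
      (use tangent_map_in[OF A I A v] tangent_map_eq[OF A I A v c] c
        frechet_derivative_chart_inv[OF A c] in auto)
qed

section \<open>Left invariant vector fields\<close>

text \<open>The inverse of a product chart is defined by \<open>inv_into\<close>. On
  \<open>W\<close> it is the pair of the two inverses, which turns the hypothesis on
  \<open>mul\<close> into smoothness of an explicit function of two coordinate vectors.\<close>

lemma mul_in_charts:
  fixes A :: "('p::{t2_space,second_countable_topology}, 'm::euclidean_space) chart set"
  assumes A: "smooth_atlas A" and mul: "smooth_map (product_atlas A A) A (\<lambda>(p, q). mul p q)"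
    and c: "c \<in> A" and d: "d \<in> A" and e: "e \<in> A"
  defines "W \<equiv> {(u, w). u \<in> snd c ` fst c \<and> w \<in> snd d ` fst d \<and>
    mul (chart_inv c u) (chart_inv d w) \<in> fst e}"
  shows "open W" and "smooth_on (\<lambda>(u, w). snd e (mul (chart_inv c u) (chart_inv d w))) W"
proof -
  let ?U = "snd c ` fst c \<times> snd d ` fst d"
  let ?P = "(fst c \<times> fst d, map_prod (snd c) (snd d))"
  let ?m = "\<lambda>(p, q). mul p q"
  have inv: "chart_inv ?P (u, w) = (chart_inv c u, chart_inv d w)"
    if "u \<in> snd c ` fst c" "w \<in> snd d ` fst d" for u w
    unfolding chart_inv_def[of ?P] fst_conv snd_conv
  proof (rule inv_into_f_eq)
    show "inj_on (map_prod (snd c) (snd d)) (fst c \<times> fst d)"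
      using atlas_chart(8)[OF A c] atlas_chart(8)[OF A d] by (rule map_prod_inj_on)
  qed (use that atlas_chart(6,7)[OF A c] atlas_chart(6,7)[OF A d] in auto)
  have "continuous_on ?U (\<lambda>z. (chart_inv c (fst z), chart_inv d (snd z)))"
    by (intro continuous_on_Pair continuous_on_compose2[OF atlas_chart(4)[OF A c]]
        continuous_on_compose2[OF atlas_chart(4)[OF A d]] continuous_on_fst continuous_on_snd
        continuous_on_id) auto
  moreover have "continuous_on UNIV ?m"
    using mul by (simp add: smooth_map_def)
  ultimately have "continuous_on ?U (\<lambda>z. ?m (chart_inv c (fst z), chart_inv d (snd z)))"
    using continuous_on_compose2[OF _ _ subset_UNIV] by fast
  moreover have "open ?U"
    using atlas_chart(2)[OF A c] atlas_chart(2)[OF A d] by (rule open_Times)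
  ultimately have "open (?U \<inter> (\<lambda>z. ?m (chart_inv c (fst z), chart_inv d (snd z))) -` fst e)"
    using atlas_chart(1)[OF A e] continuous_open_preimage by blast
  moreover have "W = ?U \<inter> (\<lambda>z. ?m (chart_inv c (fst z), chart_inv d (snd z))) -` fst e"
    by (auto simp: W_def)
  ultimately show W: "open W"
    by simp
  have "?P \<in> product_atlas A A"
    unfolding product_atlas_def using c d by force
  then have "smooth_on (snd e \<circ> ?m \<circ> chart_inv ?P) (snd ?P ` (fst ?P \<inter> ?m -` fst e))"
    using mul e unfolding smooth_map_def by blast
  moreover have "W \<subseteq> snd ?P ` (fst ?P \<inter> ?m -` fst e)"
  proof
    fix z assume "z \<in> W"
    then have "(chart_inv c (fst z), chart_inv d (snd z)) \<in> fst ?P \<inter> ?m -` fst e"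
      "z = snd ?P (chart_inv c (fst z), chart_inv d (snd z))"
      using atlas_chart(6,7)[OF A c] atlas_chart(6,7)[OF A d] by (auto simp: W_def)
    then show "z \<in> snd ?P ` (fst ?P \<inter> ?m -` fst e)"
      by blast
  qed
  ultimately have "smooth_on (snd e \<circ> ?m \<circ> chart_inv ?P) W"
    by (rule smooth_on_subset)
  then show "smooth_on (\<lambda>(u, w). snd e (mul (chart_inv c u) (chart_inv d w))) W"
  proof (rule smooth_on_cong[OF _ W])
    show "(snd e \<circ> ?m \<circ> chart_inv ?P) z =
        (case z of (u, w) \<Rightarrow> snd e (mul (chart_inv c u) (chart_inv d w)))" if "z \<in> W" for z
      using that inv[of "fst z" "snd z"] by (auto simp: W_def)
  qed
qed

locale lie_group_with_algebra =
  fixes A :: "('p::{t2_space,second_countable_topology}, 'm::euclidean_space) chart set"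
    and mul :: "'p \<Rightarrow> 'p \<Rightarrow> 'p" and e :: 'p and iv :: "'p \<Rightarrow> 'p"
    and br :: "'a::euclidean_space \<Rightarrow> 'a \<Rightarrow> 'a" and \<iota> :: "'a \<Rightarrow> ('p, 'm) vfield"
  assumes group: "lie_group A mul e iv" and algebra: "lie_algebra_of_group A mul br \<iota>"
begin

lemma atlas: "smooth_atlas A"
  and group_laws: "mul (mul p q) r = mul p (mul q r)" "mul e p = p" "mul p e = p"
    "mul (iv p) p = e" "mul p (iv p) = e"
  and smooth_mul: "smooth_map (product_atlas A A) A (\<lambda>(p, q). mul p q)"
  and smooth_iv: "smooth_map A A iv"
proof -
  interpret g: Groups.group mul e iv
    using group by (simp add: lie_group_def)
  show "mul (mul p q) r = mul p (mul q r)" "mul e p = p" "mul p e = p"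
    "mul (iv p) p = e" "mul p (iv p) = e"
    by (simp_all add: g.assoc)
qed (use group in \<open>simp_all add: lie_group_def\<close>)

lemmas chart = atlas_chart[OF atlas] and chart_at = chart_at[OF atlas]

lemma smooth_left_translation: "smooth_map A A (mul p)"
proof -
  have "continuous_on UNIV (\<lambda>(p, q). mul p q)"
    using smooth_mul by (simp add: smooth_map_def)
  then have "continuous_on UNIV (\<lambda>q. (\<lambda>(p, q). mul p q) (p, q))"
    by (rule continuous_on_compose2) (auto intro!: continuous_intros)
  then have cont: "continuous_on UNIV (mul p)"
    by simp
  have "smooth_on (snd d \<circ> mul p \<circ> chart_inv c) (snd c ` (fst c \<inter> mul p -` fst d))"
    if c: "c \<in> A" and d: "d \<in> A" for c d
  proof -
    define b where "b = chart_at A p"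
    have b: "b \<in> A" "p \<in> fst b"
      using chart_at by (auto simp: b_def)
    note m = mul_in_charts[OF atlas smooth_mul b(1) c d]
    have op: "open (snd c ` (fst c \<inter> mul p -` fst d))"
      using open_chart_image[OF atlas c open_vimage[OF chart(1)[OF d] cont]] .
    \<comment> \<open>Left translation is multiplication restricted to the slice through
      \<open>snd b p\<close>.\<close>
    have "smooth_on (\<lambda>w. (\<lambda>(u, w). snd d (mul (chart_inv b u) (chart_inv c w))) (snd b p, w))
        (snd c ` (fst c \<inter> mul p -` fst d))"
      by (rule smooth_on_compose[OF op m(1) _ smooth_on_Pair[OF op smooth_on_const
            smooth_on_bounded_linear[OF bounded_linear_ident]] m(2)])
        (use b chart(5)[OF c] chart(5)[OF b] in auto)
    then show ?thesis
      using chart(5)[OF b] by (simp add: o_def)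
  qed
  then show ?thesis
    using cont by (simp add: smooth_map_def)
qed

text \<open>The derivative of left translation by \<open>s q\<close> depends smoothly on
  \<open>q\<close>, being a partial derivative of the multiplication. With \<open>s = id\<close>
  this makes left invariant extensions smooth, with \<open>s = iv\<close> it carries the values of a
  field back to \<open>e\<close>. A chart \<open>c1\<close> around one value of \<open>s\<close>
  serves only nearby, so the argument is local.\<close>

lemma smooth_partial_mul:
  assumes s: "smooth_map A A s" and c: "c \<in> A" and b: "b \<in> A" and d: "d \<in> A"
    and a: "smooth_on a (snd c ` fst c)" and Y: "smooth_on Y (snd c ` fst c)"
    and ab: "\<And>u. u \<in> snd c ` fst c \<Longrightarrow> a u \<in> snd b ` fst b"
    and ad: "\<And>u. u \<in> snd c ` fst c \<Longrightarrow> mul (s (chart_inv c u)) (chart_inv b (a u)) \<in> fst d"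
  shows "smooth_on (\<lambda>u. frechet_derivative (snd d \<circ> mul (s (chart_inv c u)) \<circ> chart_inv b)
    (at (a u)) (Y u)) (snd c ` fst c)"
proof (rule smooth_on_local)
  fix u0
  assume u0: "u0 \<in> snd c ` fst c"
  define q where "q = s (chart_inv c u0)"
  define c1 where "c1 = chart_at A q"
  define T where "T = snd c ` (fst c \<inter> s -` fst c1)"
  have c1: "c1 \<in> A" "q \<in> fst c1"
    using chart_at by (auto simp: c1_def)
  have "continuous_on UNIV s"
    using s by (simp add: smooth_map_def)
  then have T: "open T"
    using open_chart_image[OF atlas c open_vimage[OF chart(1)[OF c1(1)]]] by (simp add: T_def)
  have Tc: "T \<subseteq> snd c ` fst c"
    by (auto simp: T_def)
  have u0T: "u0 \<in> T"
    using u0 c1(2) chart(5)[OF c] by (force simp: T_def q_def)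
  have Ts: "s (chart_inv c u) \<in> fst c1" if "u \<in> T" for u
    using that chart(5)[OF c] by (auto simp: T_def)
  define h where "h = (\<lambda>(u, w). snd d (mul (chart_inv c1 u) (chart_inv b w)))"
  define \<sigma> where "\<sigma> = snd c1 \<circ> s \<circ> chart_inv c"
  have \<sigma>: "smooth_on \<sigma> T"
    using s c c1(1) unfolding smooth_map_def T_def \<sigma>_def by blast
  have inv: "chart_inv c1 (\<sigma> u) = s (chart_inv c u)" if "u \<in> T" for u
    using chart(5)[OF c1(1)] Ts[OF that] by (simp add: \<sigma>_def)
  note m = mul_in_charts[OF atlas smooth_mul c1(1) b d]
  have "smooth_on (\<lambda>u. frechet_derivative (\<lambda>w. h (\<sigma> u, w)) (at (a u)) (Y u)) T"
  proof (rule smooth_on_partial_derivative[OF T m(1) m(2)[folded h_def] _ \<sigma>])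
    fix u assume u: "u \<in> T"
    then have "\<sigma> u \<in> snd c1 ` fst c1"
      using Ts by (simp add: \<sigma>_def)
    then show "(\<sigma> u, a u) \<in> {(u, w). u \<in> snd c1 ` fst c1 \<and> w \<in> snd b ` fst b \<and>
        mul (chart_inv c1 u) (chart_inv b w) \<in> fst d}"
      using ab ad u Tc inv[OF u] by auto
  qed (use a Y Tc smooth_on_subset in blast)+
  then have "smooth_on (\<lambda>u. frechet_derivative (snd d \<circ> mul (s (chart_inv c u)) \<circ> chart_inv b)
      (at (a u)) (Y u)) T"
    by (rule smooth_on_cong[OF _ T]) (simp add: h_def inv o_def)
  then show "\<exists>T. open T \<and> u0 \<in> T \<and> smooth_on (\<lambda>u. frechet_derivative
      (snd d \<circ> mul (s (chart_inv c u)) \<circ> chart_inv b) (at (a u)) (Y u)) T"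
    using T u0T by blast
qed

lemma left_translations_comp:
  "v \<in> tangent_space A r \<Longrightarrow>
    tangent_map A A (mul p) (mul q r) (tangent_map A A (mul q) r v) = tangent_map A A (mul (mul p q)) r v"
proof -
  assume v: "v \<in> tangent_space A r"
  have e: "mul p \<circ> mul q = mul (mul p q)"
    by (auto simp: group_laws)
  show ?thesis
    using tangent_map_comp[OF atlas smooth_left_translation[of q] atlas smooth_left_translation[of p] atlas
        _ v] smooth_left_translation[of "mul p q"] e by simp
qed

lemma left_translation_unit: "v \<in> tangent_space A p \<Longrightarrow> tangent_map A A (mul e) p v = v"
proof -
  have "mul e = id"
    by (auto simp: group_laws)
  then show "v \<in> tangent_space A p \<Longrightarrow> tangent_map A A (mul e) p v = v"
    using tangent_map_id[OF atlas] by simp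
qed

lemma left_translation_in:
  "v \<in> tangent_space A q \<Longrightarrow> tangent_map A A (mul p) q v \<in> tangent_space A (mul p q)"
  using tangent_map_in[OF atlas smooth_left_translation atlas] .

text \<open>Supplies enough left invariant fields: through \<open>\<iota>_onto\<close>, every
  tangent vector at \<open>e\<close> becomes the value of some \<open>\<iota> x\<close>.\<close>

lemma left_invariant_extension_unit:
  assumes v: "v \<in> tangent_space A e"
  defines "X \<equiv> \<lambda>q. tangent_map A A (mul q) e v"
  shows "X \<in> left_invariant_vfields A mul"
proof -
  define d where "d = chart_at A e"
  have d: "d \<in> A" "e \<in> fst d"
    using chart_at by (auto simp: d_def)
  have "smooth_on (\<lambda>u. X (chart_inv c u) c) (snd c ` fst c)" if c: "c \<in> A" for c
  proof (rule smooth_on_cong[OF _ chart(2)[OF c]])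
    show "smooth_on (\<lambda>u. frechet_derivative (snd c \<circ> mul (id (chart_inv c u)) \<circ> chart_inv d)
        (at (snd d e)) (v d)) (snd c ` fst c)"
      by (rule smooth_partial_mul[OF smooth_map_id[OF atlas] c d(1) c smooth_on_const smooth_on_const])
        (use d chart(5)[OF d] chart(6)[OF c] in \<open>auto simp: group_laws\<close>)
    show "frechet_derivative (snd c \<circ> mul (id (chart_inv c u)) \<circ> chart_inv d)
        (at (snd d e)) (v d) = X (chart_inv c u) c" if "u \<in> snd c ` fst c" for u
      using tangent_map_eq[OF atlas smooth_left_translation atlas v d c, of "chart_inv c u"]
        chart(6)[OF c that] by (simp add: X_def group_laws)
  qed
  moreover have "X q \<in> tangent_space A q" for q
    using left_translation_in[OF v, of q] by (simp add: X_def group_laws)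
  moreover have "X (mul p q) = tangent_map A A (mul p) q (X q)" for p q
    using left_translations_comp[OF v, of p q] by (simp add: X_def group_laws)
  ultimately show ?thesis
    by (simp add: left_invariant_vfields_def vfields_def)
qed

lemma \<iota>_left_invariant: "\<iota> x \<in> left_invariant_vfields A mul"
  and \<iota>_onto: "X \<in> left_invariant_vfields A mul \<Longrightarrow> \<exists>x. \<iota> x = X"
  and \<iota>_inj: "\<iota> x = \<iota> y \<Longrightarrow> x = y"
  and \<iota>_add: "\<iota> (x + y) p c = \<iota> x p c + \<iota> y p c"
  and \<iota>_scale: "\<iota> (r *\<^sub>R x) p c = r *\<^sub>R \<iota> x p c"
  and \<iota>_bracket: "\<iota> (br x y) = vf_bracket A (\<iota> x) (\<iota> y)"
proof -
  have b: "bij_betw \<iota> UNIV (left_invariant_vfields A mul)"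
    and l: "\<iota> (x + y) = vf_add (\<iota> x) (\<iota> y)" "\<iota> (r *\<^sub>R x) = vf_scale (\<lambda>p. r) (\<iota> x)"
      "\<iota> (br x y) = vf_bracket A (\<iota> x) (\<iota> y)" for x y r
    using algebra by (auto simp: lie_algebra_of_group_def)
  have r: "range \<iota> = left_invariant_vfields A mul" "inj \<iota>"
    using b by (simp_all add: bij_betw_def)
  show "\<iota> x \<in> left_invariant_vfields A mul"
    using r(1) by blast
  show "\<exists>x. \<iota> x = X" if "X \<in> left_invariant_vfields A mul"
    using that unfolding r(1)[symmetric] by blast
  show "x = y" if "\<iota> x = \<iota> y"
    using r(2) that by (rule injD)
  show "\<iota> (x + y) p c = \<iota> x p c + \<iota> y p c" "\<iota> (r *\<^sub>R x) p c = r *\<^sub>R \<iota> x p c"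
    "\<iota> (br x y) = vf_bracket A (\<iota> x) (\<iota> y)"
    by (simp_all add: l vf_add_def vf_scale_def)
qed

lemma \<iota>_vfields: "\<iota> x \<in> vfields A"
  and \<iota>_translate: "\<iota> x (mul p q) = tangent_map A A (mul p) q (\<iota> x q)"
  using \<iota>_left_invariant[of x] by (auto simp: left_invariant_vfields_def)

lemma \<iota>_tangent: "\<iota> x p \<in> tangent_space A p"
  using \<iota>_vfields[of x] by (simp add: vfields_def)

lemma linear_\<iota>: "linear (\<lambda>x. \<iota> x p c)"
  by (intro linearI) (simp_all add: \<iota>_add \<iota>_scale)

text \<open>Translation by \<open>mul q (iv p)\<close> carries the value of a left invariant field
  at \<open>p\<close> to its value at \<open>q\<close>, so one value determines the field.\<close>

lemma frame_inj:
  assumes "\<iota> x p = \<iota> y p"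
  shows "x = y"
proof (rule \<iota>_inj, rule ext)
  fix q
  have "mul (mul q (iv p)) p = q"
    by (simp add: group_laws)
  then show "\<iota> x q = \<iota> y q"
    using \<iota>_translate[of x "mul q (iv p)" p] \<iota>_translate[of y "mul q (iv p)" p] assms by simp
qed

text \<open>The vector is translated to \<open>e\<close>, extended there and brought back, without
  comparing the dimensions of \<open>'a\<close> and \<open>'m\<close>.\<close>

lemma frame_surj:
  assumes v: "v \<in> tangent_space A p"
  shows "\<exists>x. \<iota> x p = v"
proof -
  define w where "w = tangent_map A A (mul (iv p)) p v"
  have "w \<in> tangent_space A e"
    using left_translation_in[OF v, of "iv p"] by (simp add: w_def group_laws)
  then obtain x where x: "\<iota> x = (\<lambda>q. tangent_map A A (mul q) e w)"
    using left_invariant_extension_unit \<iota>_onto by blast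
  have "\<iota> x p = tangent_map A A (mul p) (mul (iv p) p) (tangent_map A A (mul (iv p)) p v)"
    by (simp add: x w_def group_laws)
  also have "\<dots> = v"
    using left_translations_comp[OF v, of p "iv p"] left_translation_unit[OF v] by (simp add: group_laws)
  finally show ?thesis
    by blast
qed

lemma left_triv_eqI: "X p = \<iota> x p \<Longrightarrow> left_triv \<iota> X p = x"
  unfolding left_triv_def using frame_inj by (intro the_equality) auto

lemma left_triv_\<iota> [simp]: "left_triv \<iota> (\<iota> x) p = x"
  by (rule left_triv_eqI) simp

lemma frame_left_triv: "X p \<in> tangent_space A p \<Longrightarrow> \<iota> (left_triv \<iota> X p) p = X p"
  using frame_surj left_triv_eqI by metis

lemma vfields_frame: "X \<in> vfields A \<Longrightarrow> \<iota> (left_triv \<iota> X p) p = X p"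
  by (simp add: vfields_def frame_left_triv)

text \<open>\<open>X p\<close> is compared with the frame at \<open>e\<close> after translation by \<open>p\<inverse>\<close>, so that smoothness comes from
  that of the group operations instead of inverting the matrix of the frame.\<close>

lemma smooth_left_triv:
  assumes X: "X \<in> vfields A" and c: "c \<in> A"
  shows "smooth_on (left_triv \<iota> X \<circ> chart_inv c) (snd c ` fst c)"
proof -
  define d where "d = chart_at A e"
  have d: "d \<in> A" "e \<in> fst d"
    using chart_at by (auto simp: d_def)
  \<comment> \<open>Only the frame at the single point \<open>e\<close> is inverted, by a constant
    linear map \<open>K\<close>.\<close>
  have "inj (\<lambda>x. \<iota> x e d)"
    by (rule injI) (metis tangent_space_eqI[OF \<iota>_tangent \<iota>_tangent d] frame_inj)
  then obtain K where K: "linear K" "K \<circ> (\<lambda>x. \<iota> x e d) = id"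
    using linear_injective_left_inverse[OF linear_\<iota>] by blast
  have Xp: "X p \<in> tangent_space A p" for p
    using X by (simp add: vfields_def)
  show ?thesis
  proof (rule smooth_on_cong[OF _ chart(2)[OF c]])
    show "smooth_on (\<lambda>u. K (frechet_derivative (snd d \<circ> mul (iv (chart_inv c u)) \<circ> chart_inv c)
        (at u) (X (chart_inv c u) c))) (snd c ` fst c)"
      by (rule smooth_on_compose_bounded_linear[OF linear_conv_bounded_linear[THEN iffD1, OF K(1)] chart(2)[OF c]
            smooth_partial_mul[OF smooth_iv c c d(1) smooth_on_bounded_linear[OF bounded_linear_ident]]])
        (use X c d in \<open>auto simp: vfields_def group_laws\<close>)
    show "K (frechet_derivative (snd d \<circ> mul (iv (chart_inv c u)) \<circ> chart_inv c)
        (at u) (X (chart_inv c u) c)) = (left_triv \<iota> X \<circ> chart_inv c) u" if u: "u \<in> snd c ` fst c" for u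
    proof -
      define q where "q = chart_inv c u"
      have q: "q \<in> fst c" "snd c q = u"
        using chart(6,7)[OF c] u by (auto simp: q_def)
      have "frechet_derivative (snd d \<circ> mul (iv q) \<circ> chart_inv c) (at u) (X q c) =
          tangent_map A A (mul (iv q)) q (X q) d"
        using tangent_map_eq[OF atlas smooth_left_translation atlas Xp c q(1) d(1)] d(2) q(2)
        by (simp add: group_laws)
      also have "\<dots> = \<iota> (left_triv \<iota> X q) e d"
        using \<iota>_translate[of "left_triv \<iota> X q" "iv q" q] vfields_frame[OF X] by (simp add: group_laws)
      finally have "K (frechet_derivative (snd d \<circ> mul (iv q) \<circ> chart_inv c) (at u) (X q c)) =
          left_triv \<iota> X q"
        using K(2) by (metis comp_apply id_apply)
      then show ?thesis
        by (simp add: q_def)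
    qed
  qed
qed

end

section \<open>Calculus in a left invariant frame\<close>

text \<open>Counterpart of \<open>smooth_fun\<close> for vector values, since
  \<open>left_triv \<iota> X\<close> takes values in the Lie algebra; \<open>directional\<close>
  extends \<open>vf_apply\<close> in the same way.\<close>

definition smooth_valued ::
    "('p, 'm::real_normed_vector) chart set \<Rightarrow> ('p \<Rightarrow> 'b::real_normed_vector) \<Rightarrow> bool" where
  "smooth_valued A f \<longleftrightarrow> (\<forall>c\<in>A. smooth_on (f \<circ> chart_inv c) (snd c ` fst c))"

definition directional ::
    "('p, 'm::real_normed_vector) chart set \<Rightarrow> ('p, 'm) vfield \<Rightarrow> ('p \<Rightarrow> 'b::real_normed_vector) \<Rightarrow> 'p \<Rightarrow> 'b"
  where
  "directional A X f p =
     (let c = chart_at A p in frechet_derivative (f \<circ> chart_inv c) (at (snd c p)) (X p c))"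

lemma smooth_fun_iff: "smooth_fun A f \<longleftrightarrow> smooth_valued A f"
  by (simp add: smooth_fun_def smooth_valued_def)

lemma vf_apply_eq: "vf_apply A X f = directional A X f"
  by (simp add: fun_eq_iff vf_apply_def directional_def)

text \<open>Inverse of \<open>left_triv\<close>: a function into the Lie algebra read as a
  field.\<close>

definition frame_field :: "('a \<Rightarrow> ('p, 'm) vfield) \<Rightarrow> ('p \<Rightarrow> 'a) \<Rightarrow> ('p, 'm) vfield" where
  "frame_field \<iota> f = (\<lambda>p. \<iota> (f p) p)"

lemma smooth_valued_const: "smooth_valued A (\<lambda>p. v)"
  by (simp add: smooth_valued_def o_def smooth_on_const)

lemma directional_const: "directional A X (\<lambda>p. v) p = 0"
  by (simp add: directional_def o_def)

context
  fixes A :: "('p::{t2_space,second_countable_topology}, 'm::euclidean_space) chart set"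
  assumes A: "smooth_atlas A"
begin

lemma smooth_valued_add:
  "smooth_valued A f \<Longrightarrow> smooth_valued A g \<Longrightarrow> smooth_valued A (\<lambda>p. f p + g p)"
  by (auto simp: smooth_valued_def o_def intro!: smooth_on_add atlas_chart(2)[OF A])

lemma smooth_valued_linear:
  fixes L :: "'b::euclidean_space \<Rightarrow> 'c::real_normed_vector"
  assumes "linear L" "smooth_valued A f"
  shows "smooth_valued A (\<lambda>p. L (f p))"
  using assms smooth_on_compose_bounded_linear[OF linear_conv_bounded_linear[THEN iffD1, OF assms(1)]]
    atlas_chart(2)[OF A]
  unfolding smooth_valued_def o_def by blast

lemma smooth_valued_bilinear:
  assumes "bounded_bilinear B" "smooth_valued A f" "smooth_valued A g"
  shows "smooth_valued A (\<lambda>p. B (f p) (g p))"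
  using assms smooth_on_bilinear[OF assms(1)] atlas_chart(2)[OF A]
  unfolding smooth_valued_def o_def by blast

lemma smooth_valued_has_derivative:
  assumes "smooth_valued A f" "c \<in> A" "p \<in> fst c"
  shows "(f \<circ> chart_inv c has_derivative frechet_derivative (f \<circ> chart_inv c) (at (snd c p))) (at (snd c p))"
  by (rule smooth_on_has_derivative[where S = "snd c ` fst c"]) (use assms in \<open>auto simp: smooth_valued_def\<close>)

text \<open>The coordinate change of \<open>f\<close> cancels against that of \<open>X p\<close>, so
  the chart chosen in \<open>directional\<close> does not matter.\<close>

lemma directional_eq:
  assumes f: "smooth_valued A f" and X: "X p \<in> tangent_space A p" and c: "c \<in> A" "p \<in> fst c"
  shows "directional A X f p = frechet_derivative (f \<circ> chart_inv c) (at (snd c p)) (X p c)"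
proof -
  define d where "d = chart_at A p"
  have d: "d \<in> A" "p \<in> fst d"
    using chart_at[OF A] by (auto simp: d_def)
  have "(f \<circ> chart_inv c) differentiable (at (snd c p))"
    using smooth_valued_has_derivative[OF f c] unfolding differentiable_def by blast
  then have "frechet_derivative (f \<circ> chart_inv d) (at (snd d p)) (X p d) =
      frechet_derivative (f \<circ> chart_inv c) (at (snd c p)) (X p c)"
    using chart_chain_rule(2)[OF A A smooth_map_id[OF A] d, of c f "X p d"]
      tangent_space_change[OF X d c] c by simp
  then show ?thesis
    by (simp add: directional_def d_def Let_def)
qed

lemma smooth_directional:
  assumes f: "smooth_valued A f" and X: "X \<in> vfields A"
  shows "smooth_valued A (directional A X f)"
  unfolding smooth_valued_def
proof
  fix c assume c: "c \<in> A"
  note ch = atlas_chart[OF A c]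
  show "smooth_on (directional A X f \<circ> chart_inv c) (snd c ` fst c)"
  proof (rule smooth_on_cong[OF _ ch(2)])
    show "smooth_on (\<lambda>u. frechet_derivative (f \<circ> chart_inv c) (at u) (X (chart_inv c u) c)) (snd c ` fst c)"
      by (rule smooth_on_directional_derivative[OF ch(2) ch(2)])
        (use f X c in \<open>auto simp: smooth_valued_def vfields_def smooth_on_bounded_linear[OF bounded_linear_ident]\<close>)
    show "frechet_derivative (f \<circ> chart_inv c) (at u) (X (chart_inv c u) c) =
        (directional A X f \<circ> chart_inv c) u" if "u \<in> snd c ` fst c" for u
      using directional_eq[OF f, of X "chart_inv c u" c] X c ch(6,7)[OF that] by (simp add: vfields_def)
  qed
qed

lemma directional_linear_field:
  assumes f: "smooth_valued A f"
  shows "directional A (vf_add X Y) f p = directional A X f p + directional A Y f p"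
    and "directional A (vf_scale h X) f p = h p *\<^sub>R directional A X f p"
  using has_derivative_linear[OF smooth_valued_has_derivative[OF f chart_at[OF A, of p]]]
  by (simp_all add: directional_def Let_def vf_add_def vf_scale_def linear_add linear_scale)

lemma directional_add:
  assumes f: "smooth_valued A f" and g: "smooth_valued A g"
  shows "directional A X (\<lambda>p. f p + g p) p = directional A X f p + directional A X g p"
proof -
  note c = chart_at[OF A, of p]
  show ?thesis
    using frechet_derivative_at[OF has_derivative_add[OF smooth_valued_has_derivative[OF f c]
        smooth_valued_has_derivative[OF g c]], symmetric]
    by (simp add: directional_def Let_def o_def)
qed

lemma directional_linear:
  fixes L :: "'b::euclidean_space \<Rightarrow> 'c::real_normed_vector"
  assumes L: "linear L" and f: "smooth_valued A f"
  shows "directional A X (\<lambda>p. L (f p)) p = L (directional A X f p)"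
proof -
  note c = chart_at[OF A, of p]
  show ?thesis
    using frechet_derivative_at[OF bounded_linear.has_derivative[OF linear_conv_bounded_linear[THEN iffD1, OF L]
        smooth_valued_has_derivative[OF f c]], symmetric]
    by (simp add: directional_def Let_def o_def)
qed

lemma directional_bilinear:
  assumes B: "bounded_bilinear B" and f: "smooth_valued A f" and g: "smooth_valued A g"
  shows "directional A X (\<lambda>p. B (f p) (g p)) p = B (f p) (directional A X g p) + B (directional A X f p) (g p)"
proof -
  note c = chart_at[OF A, of p]
  show ?thesis
    using frechet_derivative_at[OF bounded_bilinear.FDERIV[OF B smooth_valued_has_derivative[OF f c]
        smooth_valued_has_derivative[OF g c]], symmetric] atlas_chart(5)[OF A c]
    by (simp add: directional_def Let_def o_def)
qed

lemma vfields_add: "X \<in> vfields A \<Longrightarrow> Y \<in> vfields A \<Longrightarrow> vf_add X Y \<in> vfields A"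
  using tangent_space_subspace(1)[OF A] atlas_chart(2)[OF A]
  by (auto simp: vfields_def vf_add_def intro!: smooth_on_add)

lemma vfields_scale:
  assumes f: "smooth_fun A f" and X: "X \<in> vfields A"
  shows "vf_scale f X \<in> vfields A"
  using tangent_space_subspace(2)[OF A] atlas_chart(2)[OF A] X f
  by (auto simp: vfields_def vf_scale_def smooth_fun_def o_def
      intro!: smooth_on_bilinear[OF bounded_bilinear_scaleR])

end

context lie_group_with_algebra
begin

lemma \<iota>_linear_combination:
  "\<iota> v p c = (\<Sum>b\<in>Basis. (v \<bullet> b) *\<^sub>R \<iota> b p c)"
proof -
  have "\<iota> (\<Sum>b\<in>Basis. (v \<bullet> b) *\<^sub>R b) p c = (\<Sum>b\<in>Basis. (v \<bullet> b) *\<^sub>R \<iota> b p c)"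
    using linear_\<iota> by (simp add: linear_sum[OF linear_\<iota>] \<iota>_scale)
  then show ?thesis
    by (simp add: euclidean_representation)
qed

lemma frame_field_vfields:
  assumes f: "smooth_valued A f"
  shows "frame_field \<iota> f \<in> vfields A"
proof -
  have "smooth_on (\<lambda>u. \<iota> (f (chart_inv c u)) (chart_inv c u) c) (snd c ` fst c)" if c: "c \<in> A" for c
    using f c \<iota>_vfields chart(2)[OF c]
    by (subst \<iota>_linear_combination)
      (auto simp: smooth_valued_def vfields_def o_def intro!: smooth_on_sum
        smooth_on_bilinear[OF bounded_bilinear_scaleR] smooth_on_compose_bounded_linear[OF bounded_linear_inner_left])
  then show ?thesis
    by (simp add: vfields_def frame_field_def \<iota>_tangent)
qed

lemma smooth_valued_left_triv: "X \<in> vfields A \<Longrightarrow> smooth_valued A (left_triv \<iota> X)"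
  using smooth_left_triv by (simp add: smooth_valued_def)

lemma left_triv_frame_field [simp]: "left_triv \<iota> (frame_field \<iota> f) p = f p"
  by (rule left_triv_eqI) (simp add: frame_field_def)

lemma frame_field_left_triv: "X \<in> vfields A \<Longrightarrow> frame_field \<iota> (left_triv \<iota> X) = X"
  by (simp add: frame_field_def fun_eq_iff vfields_frame)

text \<open>Turns identities between fields into pointwise identities in the Lie algebra; the laws
  of an affine connection are checked this way.\<close>

lemma vfields_eqI:
  "X \<in> vfields A \<Longrightarrow> Y \<in> vfields A \<Longrightarrow> (\<And>p. left_triv \<iota> X p = left_triv \<iota> Y p) \<Longrightarrow> X = Y"
  using frame_field_left_triv[of X] frame_field_left_triv[of Y] by (simp add: frame_field_def)

lemma left_triv_vf_add:
  "X \<in> vfields A \<Longrightarrow> Y \<in> vfields A \<Longrightarrow>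
    left_triv \<iota> (vf_add X Y) p = left_triv \<iota> X p + left_triv \<iota> Y p"
  by (rule left_triv_eqI) (simp add: vf_add_def fun_eq_iff \<iota>_add vfields_frame)

lemma left_triv_vf_scale:
  "X \<in> vfields A \<Longrightarrow> left_triv \<iota> (vf_scale f X) p = f p *\<^sub>R left_triv \<iota> X p"
  by (rule left_triv_eqI) (simp add: vf_scale_def fun_eq_iff \<iota>_scale vfields_frame)

lemma vf_diff_eq: "vf_diff X Y = vf_add X (vf_scale (\<lambda>p. - 1) Y)"
  by (simp add: vf_diff_def vf_add_def vf_scale_def)

lemma vfields_diff: "X \<in> vfields A \<Longrightarrow> Y \<in> vfields A \<Longrightarrow> vf_diff X Y \<in> vfields A"
  by (simp add: vf_diff_eq vfields_add[OF atlas] vfields_scale[OF atlas] smooth_fun_iff smooth_valued_const)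

lemma left_triv_vf_diff:
  "X \<in> vfields A \<Longrightarrow> Y \<in> vfields A \<Longrightarrow>
    left_triv \<iota> (vf_diff X Y) p = left_triv \<iota> X p - left_triv \<iota> Y p"
  by (simp add: vf_diff_eq left_triv_vf_add left_triv_vf_scale vfields_scale[OF atlas]
      smooth_fun_iff smooth_valued_const)

lemma li_endo_eq: "li_endo \<iota> \<phi> X = frame_field \<iota> (\<lambda>p. \<phi> (left_triv \<iota> X p))"
  by (simp add: li_endo_def frame_field_def)

lemma li_endo_vfields: "linear \<phi> \<Longrightarrow> X \<in> vfields A \<Longrightarrow> li_endo \<iota> \<phi> X \<in> vfields A"
  unfolding li_endo_eq
  by (rule frame_field_vfields[OF smooth_valued_linear[OF atlas _ smooth_valued_left_triv]])

text \<open>A field is a finite sum of left invariant fields with the smooth coefficients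
  \<open>left_triv \<iota> X p \<bullet> b\<close>. The proof adds the basis vectors one at a
  time.\<close>

lemma vfields_induct [consumes 1, case_names left_invariant add scale]:
  assumes X: "X \<in> vfields A"
    and left_invariant: "\<And>x. P (\<iota> x)"
    and add: "\<And>X Y. X \<in> vfields A \<Longrightarrow> Y \<in> vfields A \<Longrightarrow> P X \<Longrightarrow> P Y \<Longrightarrow> P (vf_add X Y)"
    and scale: "\<And>f X. smooth_fun A f \<Longrightarrow> X \<in> vfields A \<Longrightarrow> P X \<Longrightarrow> P (vf_scale f X)"
  shows "P X"
proof -
  let ?x = "left_triv \<iota> X"
  let ?X = "\<lambda>S. frame_field \<iota> (\<lambda>p. \<Sum>b\<in>S. (?x p \<bullet> b) *\<^sub>R b)"
  have sm: "smooth_fun A (\<lambda>p. ?x p \<bullet> b)" for b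
    using smooth_valued_linear[OF atlas _ smooth_valued_left_triv[OF X], of "\<lambda>v. v \<bullet> b"]
    by (simp add: smooth_fun_iff bounded_linear_inner_left bounded_linear.linear)
  have "?X S \<in> vfields A \<and> P (?X S)" if "finite S" for S
    using that
  proof (induction S)
    case empty
    have "?X {} = \<iota> 0"
      by (simp add: frame_field_def)
    then show ?case
      using left_invariant[of 0] \<iota>_vfields[of 0] by simp
  next
    case (insert b S)
    have e: "?X (insert b S) = vf_add (vf_scale (\<lambda>p. ?x p \<bullet> b) (\<iota> b)) (?X S)"
      using insert.hyps by (simp add: frame_field_def vf_add_def vf_scale_def fun_eq_iff \<iota>_add \<iota>_scale)
    note b = vfields_scale[OF atlas sm[of b] \<iota>_vfields[of b]] scale[OF sm[of b] \<iota>_vfields left_invariant[of b]]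
    show ?case
      unfolding e using vfields_add[OF atlas b(1)] add[OF b(1) _ b(2)] insert.IH by blast
  qed
  from this[OF finite_Basis] show ?thesis
    by (simp add: euclidean_representation frame_field_left_triv[OF X])
qed

text \<open>Product rule for \<open>Y\<close> written as a sum of coefficients times frame fields:
  the first term differentiates the coefficients, the second the frame with the coefficients frozen
  at \<open>p\<close>.\<close>

lemma frechet_derivative_frame:
  assumes Y: "Y \<in> vfields A" and c: "c \<in> A" "p \<in> fst c" and v: "v \<in> tangent_space A p" "X p = v"
  shows "frechet_derivative (\<lambda>u. Y (chart_inv c u) c) (at (snd c p)) (v c) =
    \<iota> (directional A X (left_triv \<iota> Y) p) p c +
    frechet_derivative (\<lambda>u. \<iota> (left_triv \<iota> Y p) (chart_inv c u) c) (at (snd c p)) (v c)"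
proof -
  let ?y = "left_triv \<iota> Y"
  let ?D = "\<lambda>y w. frechet_derivative (\<lambda>u. \<iota> y (chart_inv c u) c) (at (snd c p)) w"
  let ?Dy = "frechet_derivative (?y \<circ> chart_inv c) (at (snd c p))"
  have sy: "smooth_valued A ?y"
    using smooth_valued_left_triv[OF Y] .
  have p: "chart_inv c (snd c p) = p"
    using chart(5)[OF c] .
  have D: "((\<lambda>u. \<iota> y (chart_inv c u) c) has_derivative ?D y) (at (snd c p))" for y
    by (rule smooth_on_has_derivative[where S = "snd c ` fst c"]) (use \<iota>_vfields[of y] c in \<open>auto simp: vfields_def\<close>)
  have comb: "((\<lambda>u. \<Sum>b\<in>Basis. (g u \<bullet> b) *\<^sub>R \<iota> b (chart_inv c u) c) has_derivative
      (\<lambda>w. \<Sum>b\<in>Basis. (g (snd c p) \<bullet> b) *\<^sub>R ?D b w + (g' w \<bullet> b) *\<^sub>R \<iota> b p c)) (at (snd c p))"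
    if "(g has_derivative g') (at (snd c p))" for g g'
    using has_derivative_sum[of Basis, OF has_derivative_scaleR[OF
        bounded_linear.has_derivative[OF bounded_linear_inner_left that] D]] p by simp
  have "(\<lambda>u. \<Sum>b\<in>Basis. (?y p \<bullet> b) *\<^sub>R \<iota> b (chart_inv c u) c) = (\<lambda>u. \<iota> (?y p) (chart_inv c u) c)"
    by (simp add: \<iota>_linear_combination[of "?y p"])
  then have const: "?D (?y p) w = (\<Sum>b\<in>Basis. (?y p \<bullet> b) *\<^sub>R ?D b w)" for w
    using frechet_derivative_at[OF comb[OF has_derivative_const[of "?y p"]]] by (metis (no_types, lifting)
        add.right_neutral inner_zero_left scaleR_zero_left sum.cong)
  have "(\<lambda>u. \<Sum>b\<in>Basis. ((?y \<circ> chart_inv c) u \<bullet> b) *\<^sub>R \<iota> b (chart_inv c u) c) = (\<lambda>u. Y (chart_inv c u) c)"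
    using vfields_frame[OF Y] \<iota>_linear_combination by (metis comp_apply)
  then have "(\<lambda>w. \<Sum>b\<in>Basis. (?y p \<bullet> b) *\<^sub>R ?D b w + (?Dy w \<bullet> b) *\<^sub>R \<iota> b p c) =
      frechet_derivative (\<lambda>u. Y (chart_inv c u) c) (at (snd c p))"
    using frechet_derivative_at[OF comb[OF smooth_valued_has_derivative[OF atlas sy c]]] p by simp
  from fun_cong[OF this, of "v c", symmetric]
  have "frechet_derivative (\<lambda>u. Y (chart_inv c u) c) (at (snd c p)) (v c) =
      ?D (?y p) (v c) + \<iota> (?Dy (v c)) p c"
    unfolding const[of "v c"] \<iota>_linear_combination[of "?Dy (v c)"] sum.distrib .
  then show ?thesis
    using directional_eq[OF atlas sy _ c, of X] v by simp
qed

text \<open>The terms with frozen coefficients form the bracket of the left invariant fields that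
  agree with \<open>X\<close> and \<open>Y\<close> at \<open>p\<close>, and
  \<open>\<iota>_bracket\<close> evaluates it; the derivatives of the coefficients remain.\<close>

lemma vf_bracket_frame:
  assumes X: "X \<in> vfields A" and Y: "Y \<in> vfields A"
  shows "vf_bracket A X Y = frame_field \<iota> (\<lambda>p. directional A X (left_triv \<iota> Y) p
    - directional A Y (left_triv \<iota> X) p + br (left_triv \<iota> X p) (left_triv \<iota> Y p))"
proof (intro ext)
  fix p c
  let ?x = "left_triv \<iota> X p" and ?y = "left_triv \<iota> Y p"
  let ?z = "directional A X (left_triv \<iota> Y) p - directional A Y (left_triv \<iota> X) p + br ?x ?y"
  show "vf_bracket A X Y p c = frame_field \<iota> (\<lambda>p. directional A X (left_triv \<iota> Y) p
    - directional A Y (left_triv \<iota> X) p + br (left_triv \<iota> X p) (left_triv \<iota> Y p)) p c"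
  proof (cases "c \<in> A \<and> p \<in> fst c")
    case True
    have t: "X p \<in> tangent_space A p" "Y p \<in> tangent_space A p"
      using X Y by (auto simp: vfields_def)
    have "\<iota> (br ?x ?y) p c = frechet_derivative (\<lambda>u. \<iota> ?y (chart_inv c u) c) (at (snd c p)) (X p c)
        - frechet_derivative (\<lambda>u. \<iota> ?x (chart_inv c u) c) (at (snd c p)) (Y p c)"
      using True vfields_frame[OF X] vfields_frame[OF Y] by (simp add: \<iota>_bracket vf_bracket_def)
    then show ?thesis
      using frechet_derivative_frame[OF Y, of c p "X p" X] frechet_derivative_frame[OF X, of c p "Y p" Y] True t
      by (simp add: vf_bracket_def frame_field_def \<iota>_add linear_diff[OF linear_\<iota>])
  next
    case False
    then show ?thesis
      using tangent_space_outside[OF \<iota>_tangent, of c p] by (auto simp: vf_bracket_def frame_field_def)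
  qed
qed

end

section \<open>Non-parallel canonical abelian structures\<close>

lemma even_perm3_cases:
  assumes "even_perm3 i j k"
  obtains "l = i" | "l = j" | "l = k"
  using assms exhaust_3[of l] by (auto simp: even_perm3_def)

lemma even_perm3_exists: "\<exists>j k. even_perm3 i j k"
  using exhaust_3[of i] by (auto simp: even_perm3_def)

text \<open>Coordinates with respect to a basis of \<open>so3\<close> such that \<open>[E\<^sub>i, E\<^sub>j] = E\<^sub>k\<close> for even permutations.\<close>

definition skew3 :: "real \<Rightarrow> real \<Rightarrow> real \<Rightarrow> real^3^3" where
  "skew3 a b c = vector [vector [0, - c, b], vector [c, 0, - a], vector [- b, a, 0]]"

lemma skew3_entries:
  "skew3 a b c $ 1 $ 1 = 0" "skew3 a b c $ 1 $ 2 = - c" "skew3 a b c $ 1 $ 3 = b"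
  "skew3 a b c $ 2 $ 1 = c" "skew3 a b c $ 2 $ 2 = 0" "skew3 a b c $ 2 $ 3 = - a"
  "skew3 a b c $ 3 $ 1 = - b" "skew3 a b c $ 3 $ 2 = a" "skew3 a b c $ 3 $ 3 = 0"
  by (simp_all add: skew3_def)

lemma matrix3_eqI:
  fixes M N :: "real^3^3"
  assumes "M $ 1 $ 1 = N $ 1 $ 1" "M $ 1 $ 2 = N $ 1 $ 2" "M $ 1 $ 3 = N $ 1 $ 3"
    "M $ 2 $ 1 = N $ 2 $ 1" "M $ 2 $ 2 = N $ 2 $ 2" "M $ 2 $ 3 = N $ 2 $ 3"
    "M $ 3 $ 1 = N $ 3 $ 1" "M $ 3 $ 2 = N $ 3 $ 2" "M $ 3 $ 3 = N $ 3 $ 3"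
  shows "M = N"
  unfolding vec_eq_iff forall_3 using assms by blast

lemma skew3_so3: "skew3 a b c \<in> so3"
  unfolding so3_def mem_Collect_eq
  by (rule matrix3_eqI) (simp_all add: transpose_def skew3_entries)

lemma so3_skew3:
  assumes "A \<in> so3"
  shows "A = skew3 (A $ 3 $ 2) (A $ 1 $ 3) (A $ 2 $ 1)"
proof -
  have t: "A $ j $ i = - A $ i $ j" for i j
  proof -
    have "transpose A $ i $ j = (- A) $ i $ j"
      using assms by (simp add: so3_def)
    then show ?thesis
      unfolding transpose_def by simp
  qed
  have d: "A $ i $ i = 0" for i
    using t[of i i] by linarith
  show ?thesis
    by (rule matrix3_eqI) (simp_all add: skew3_entries d t[of 2 1] t[of 3 2] t[of 1 3])
qed

lemma commutator_skew3:
  "commutator (skew3 a b c) (skew3 a' b' c') = skew3 (b * c' - c * b') (c * a' - a * c') (a * b' - b * a')"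
  by (rule matrix3_eqI) (simp_all add: commutator_def matrix_matrix_mult_def sum_3 skew3_entries algebra_simps)

text \<open>After cancellation by means of \<open>skew\<close>, the torsion hypothesis says
  \<open>a y z x = a z x y\<close>. Cyclic invariance and skewness in the last two arguments
  together make \<open>a\<close> alternating.\<close>

lemma alternating_of_skew_torsion:
  fixes a :: "'a \<Rightarrow> 'a \<Rightarrow> 'a \<Rightarrow> real"
  assumes skew: "\<And>x y z. a x y z = - a x z y"
    and torsion: "\<And>x y z. a x y z - a y x z = - (a x z y - a z x y)"
  shows "a x y z = - a y x z"
  using skew[of x y z] skew[of y z x] skew[of z x y] torsion[of x y z] torsion[of y z x] by linarith

lemma wedge3_skew: "wedge3 a b c X Y Z = - wedge3 a b c Y X Z" "wedge3 a b c X Y Z = - wedge3 a b c X Z Y"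
  by (simp_all add: wedge3_def algebra_simps)

locale nonparallel_canonical =
  fixes n :: nat and br :: "'a::euclidean_space \<Rightarrow> 'a \<Rightarrow> 'a"
    and \<phi> :: "3 \<Rightarrow> 'a \<Rightarrow> 'a" and \<xi> :: "3 \<Rightarrow> 'a" and \<eta> :: "3 \<Rightarrow> 'a \<Rightarrow> real"
    and \<beta> \<delta> :: real
  assumes S: "almost_3_contact_metric_lie_algebra n br \<phi> \<xi> \<eta>"
    and canonical: "canonical_abelian br \<phi> \<xi> \<eta> \<beta>" and \<beta>: "\<beta> \<noteq> 0"
    and \<delta>_def: "\<delta> = reeb_delta br \<xi> \<eta>"
begin

section \<open>Identities of the three almost contact structures\<close>

lemma abelian: "abelian_3_structure br \<phi> \<xi> \<eta>"
  using canonical by (simp add: canonical_abelian_def)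

lemma bil: "bilinear br" and alt: "br x x = 0"
  and jacobi: "br x (br y z) + br y (br z x) + br z (br x y) = 0"
  using S by (auto simp: almost_3_contact_metric_lie_algebra_def real_lie_algebra_def)

lemmas br_simps = bilinear_ladd[OF bil] bilinear_radd[OF bil] bilinear_lmul[OF bil] bilinear_rmul[OF bil]
  bilinear_lneg[OF bil] bilinear_rneg[OF bil] bilinear_lsub[OF bil] bilinear_rsub[OF bil]
  bilinear_lzero[OF bil] bilinear_rzero[OF bil]

lemma skew: "br y x = - br x y"
proof -
  have "br (x + y) (x + y) = (br x x + br x y) + (br y x + br y y)"
    by (simp only: bilinear_ladd[OF bil] bilinear_radd[OF bil] ac_simps)
  then show ?thesis
    by (simp add: alt add_eq_0_iff)
qed

lemma almost_contact: "almost_contact_structure (\<phi> i) (\<xi> i) (\<eta> i)"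
  using S by (auto simp: almost_3_contact_metric_lie_algebra_def)

lemma linear_\<phi>: "linear (\<phi> i)" and linear_\<eta>: "linear (\<eta> i)" and \<eta>_\<xi>_same: "\<eta> i (\<xi> i) = 1"
  and \<phi>_sq: "\<phi> i (\<phi> i x) = - x + \<eta> i x *\<^sub>R \<xi> i"
  using almost_contact[of i] by (auto simp: almost_contact_structure_def)

lemmas \<phi>_\<xi>_same = almost_contact_basic(1)[OF almost_contact]
  and \<eta>_\<phi>_same = almost_contact_basic(2)[OF almost_contact]

lemmas lin_simps = linear_add[OF linear_\<phi>] linear_scale[OF linear_\<phi>] linear_neg[OF linear_\<phi>]
  linear_diff[OF linear_\<phi>] linear_0[OF linear_\<phi>] linear_add[OF linear_\<eta>] linear_scale[OF linear_\<eta>]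
  linear_neg[OF linear_\<eta>] linear_diff[OF linear_\<eta>] linear_0[OF linear_\<eta>]

lemma metric: "\<phi> i x \<bullet> \<phi> i y = x \<bullet> y - \<eta> i x * \<eta> i y"
  using S unfolding almost_3_contact_metric_lie_algebra_def by blast

lemma ad_\<xi>_\<phi>: "br (\<xi> i) (\<phi> i x) = \<phi> i (br (\<xi> i) x)"
  and br_invariant: "\<eta> i x = 0 \<Longrightarrow> \<eta> i y = 0 \<Longrightarrow> br (\<phi> i x) (\<phi> i y) = br x y"
  using abelian by (auto simp: abelian_3_structure_def abelian_almost_contact_def)

lemma
  assumes "even_perm3 i j k"
  shows \<phi>_\<phi>: "\<phi> i (\<phi> j x) = \<phi> k x + \<eta> j x *\<^sub>R \<xi> i" "\<phi> j (\<phi> i x) = - \<phi> k x + \<eta> i x *\<^sub>R \<xi> j"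
    and \<phi>_\<xi>: "\<phi> i (\<xi> j) = \<xi> k" "\<phi> j (\<xi> i) = - \<xi> k"
    and \<eta>_\<phi>: "\<eta> i (\<phi> j x) = \<eta> k x" "\<eta> j (\<phi> i x) = - \<eta> k x"
proof -
  have *: "(\<forall>x. \<phi> k x = \<phi> i (\<phi> j x) - \<eta> j x *\<^sub>R \<xi> i \<and>
             \<phi> k x = - \<phi> j (\<phi> i x) + \<eta> i x *\<^sub>R \<xi> j) \<and>
        \<xi> k = \<phi> i (\<xi> j) \<and> \<xi> k = - \<phi> j (\<xi> i) \<and>
        (\<forall>x. \<eta> k x = \<eta> i (\<phi> j x) \<and> \<eta> k x = - \<eta> j (\<phi> i x))"
    using S assms unfolding almost_3_contact_metric_lie_algebra_def by blast
  have a: "\<phi> k x = \<phi> i (\<phi> j x) - \<eta> j x *\<^sub>R \<xi> i" and b: "\<phi> k x = - \<phi> j (\<phi> i x) + \<eta> i x *\<^sub>R \<xi> j"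
    and c: "\<xi> k = - \<phi> j (\<xi> i)" and d: "\<eta> k x = - \<eta> j (\<phi> i x)"
    using * by blast+
  show "\<phi> i (\<phi> j x) = \<phi> k x + \<eta> j x *\<^sub>R \<xi> i"
    by (simp add: a)
  show "\<phi> j (\<phi> i x) = - \<phi> k x + \<eta> i x *\<^sub>R \<xi> j"
    by (simp add: b)
  show "\<phi> i (\<xi> j) = \<xi> k" "\<eta> i (\<phi> j x) = \<eta> k x"
    using * by simp_all
  show "\<phi> j (\<xi> i) = - \<xi> k"
    by (simp add: c)
  show "\<eta> j (\<phi> i x) = - \<eta> k x"
    by (simp add: d)
qed

text \<open>For \<open>y = \<xi> i\<close> the left side of \<open>metric\<close> vanishes, because
  \<phi>_i kills \<xi>_i; thus \<eta>_i is the metric dual of \<xi>_i.\<close>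

lemma inner_\<xi>: "\<xi> i \<bullet> x = \<eta> i x" "x \<bullet> \<xi> i = \<eta> i x"
  using metric[of i x "\<xi> i"] by (simp_all add: \<phi>_\<xi>_same \<eta>_\<xi>_same inner_commute)

lemma \<eta>_\<xi>:
  assumes p: "even_perm3 i j k"
  shows "\<eta> i (\<xi> j) = 0" "\<eta> j (\<xi> i) = 0"
proof -
  have "\<xi> j = - \<phi> i (\<xi> k)"
    using \<phi>_\<xi>(2)[OF even_perm3_cyc[OF even_perm3_cyc[OF p]]] by simp
  then show "\<eta> i (\<xi> j) = 0"
    by (simp add: lin_simps \<eta>_\<phi>_same)
  then show "\<eta> j (\<xi> i) = 0"
    using inner_\<xi> by metis
qed

lemma even_perms: "even_perm3 1 2 3" "even_perm3 2 3 1" "even_perm3 3 1 2"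
  by (auto simp: even_perm3_def)

lemmas \<eta>_\<xi>_simps = \<eta>_\<xi>_same \<eta>_\<xi>[OF even_perms(1)] \<eta>_\<xi>[OF even_perms(2)] \<eta>_\<xi>[OF even_perms(3)]

text \<open>Applied to \<open>x\<close> and \<open>\<phi> i y\<close>, \<open>metric\<close>
  contains \<open>\<phi> i (\<phi> i y)\<close>, which is \<open>- y\<close> up to a multiple of
  \<open>\<xi> i\<close>, and that is orthogonal to the image of \<phi>_i.\<close>

lemma \<phi>_skew: "\<phi> i x \<bullet> y = - (x \<bullet> \<phi> i y)"
  using metric[of i x "\<phi> i y"] by (simp add: \<phi>_sq \<eta>_\<phi>_same inner_diff_right inner_\<xi>)

lemma horizontal_\<eta>: "x \<in> horizontal \<eta> \<Longrightarrow> \<eta> i x = 0"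
  by (simp add: horizontal_def)

lemma horizontal_\<phi>:
  assumes "x \<in> horizontal \<eta>"
  shows "\<phi> i x \<in> horizontal \<eta>"
proof -
  obtain j k where p: "even_perm3 i j k"
    using even_perm3_exists by blast
  have "\<eta> l (\<phi> i x) = 0" for l
    using \<eta>_\<phi>(2)[OF p, of x] \<eta>_\<phi>(1)[OF even_perm3_cyc[OF even_perm3_cyc[OF p]], of x] \<eta>_\<phi>_same
      horizontal_\<eta>[OF assms] by (cases rule: even_perm3_cases[OF p, of l]) auto
  then show ?thesis
    by (simp add: horizontal_def)
qed

lemma subspace_horizontal: "subspace (horizontal \<eta>)"
  by (auto simp: subspace_def horizontal_def lin_simps)

section \<open>Brackets with the characteristic vectors\<close>

lemma br_vertical:
  assumes p: "even_perm3 i j k"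
  shows "br (\<xi> i) (\<xi> j) = (2 * \<delta>) *\<^sub>R \<xi> k"
proof -
  have q: "even_perm3 k i j"
    using even_perm3_cyc[OF even_perm3_cyc[OF p]] .
  \<comment> \<open>The vanishing of \<open>reeb_Z\<close> puts the bracket into the kernel of
    \<phi>_k, which by \<open>\<phi>_sq\<close> is the line of \<xi>_k.\<close>
  have "\<phi> k (br (\<xi> i) (\<xi> j)) = 0"
    using reeb_invariants_indep(1)[OF S abelian q] canonical by (simp add: canonical_abelian_def)
  then have "- br (\<xi> i) (\<xi> j) + \<eta> k (br (\<xi> i) (\<xi> j)) *\<^sub>R \<xi> k = 0"
    using \<phi>_sq[of k "br (\<xi> i) (\<xi> j)"] by (simp add: lin_simps)
  then show ?thesis
    using reeb_invariants_indep(2)[OF S abelian q] by (simp add: \<delta>_def add_eq_0_iff2)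
qed

text \<open>The condition on \<open>reeb_psi\<close> concerns
  \<open>br (\<xi> i) (\<phi> i x)\<close>. Evaluated at \<open>\<phi> i x\<close> in place of
  \<open>x\<close> it loses the inner \<phi>_i, which squares to -1 on horizontal vectors.\<close>

lemma br_horizontal_\<beta>:
  assumes x: "x \<in> horizontal \<eta>"
  shows "br (\<xi> i) x = (\<beta> / 2) *\<^sub>R \<phi> i x"
proof -
  have "2 *\<^sub>R br (\<xi> i) (\<phi> i (\<phi> i x)) = - \<beta> *\<^sub>R \<phi> i x"
    using canonical reeb_invariants_indep(3)[OF S abelian horizontal_\<phi>[OF x], of i] horizontal_\<phi>[OF x]
    by (simp add: canonical_abelian_def)
  then have "2 *\<^sub>R br (\<xi> i) x = \<beta> *\<^sub>R \<phi> i x"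
    by (simp add: \<phi>_sq horizontal_\<eta>[OF x] br_simps)
  then have "(1 / 2) *\<^sub>R (2 *\<^sub>R br (\<xi> i) x) = (1 / 2) *\<^sub>R (\<beta> *\<^sub>R \<phi> i x)"
    by simp
  then show ?thesis
    by simp
qed

text \<open>The \<xi>_i are orthonormal, and the horizontal space is the orthogonal complement of
  their span because each \<eta>_i is the inner product with \<xi>_i; this leaves 4n + 3 - 3
  dimensions.\<close>

lemma dim_horizontal: "dim (horizontal \<eta>) = 4 * n"
proof -
  let ?R = "range \<xi>"
  \<comment> \<open>Phrased by equality of vectors rather than of indices, since it is applied to
    the set \<open>?R\<close> before \<open>\<xi>\<close> is known to be injective.\<close>
  have o: "\<xi> i \<bullet> \<xi> j = (if \<xi> i = \<xi> j then 1 else 0)" for i j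
    using exhaust_3[of i] exhaust_3[of j] \<eta>_\<xi>_simps by (auto simp: inner_\<xi>)
  have "pairwise orthogonal ?R" "0 \<notin> ?R"
    using o by (auto simp: pairwise_def orthogonal_def) (metis inner_zero_left zero_neq_one)
  then have "independent ?R"
    by (rule pairwise_orthogonal_independent)
  moreover have "inj \<xi>"
  proof (rule injI)
    fix i j assume "\<xi> i = \<xi> j"
    then have "\<eta> i (\<xi> j) = 1"
      using \<eta>_\<xi>_same[of i] by simp
    then show "i = j"
      using exhaust_3[of i] exhaust_3[of j] \<eta>_\<xi>_simps by auto
  qed
  ultimately have "dim (span ?R) = 3"
    by (simp add: dim_eq_card_independent card_image)
  moreover have "{y \<in> UNIV. \<forall>x \<in> span ?R. orthogonal x y} = horizontal \<eta>"
  proof -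
    have "orthogonal x y" if "\<forall>i. \<eta> i y = 0" "x \<in> span ?R" for x y
      unfolding orthogonal_commute[of x y]
      by (rule orthogonal_to_span[OF that(2)]) (use that(1) inner_\<xi> in \<open>auto simp: orthogonal_def\<close>)
    moreover have "\<eta> i y = 0" if "\<forall>x\<in>span ?R. orthogonal x y" for i y
      using that span_base[of "\<xi> i" ?R] inner_\<xi> by (auto simp: orthogonal_def)
    ultimately show ?thesis
      by (auto simp: horizontal_def)
  qed
  ultimately show ?thesis
    using dim_subspace_orthogonal_to_vectors[of "span ?R" UNIV] S
    by (simp add: almost_3_contact_metric_lie_algebra_def)
qed

text \<open>All three terms of the Jacobi identity are multiples of \<open>\<phi> 3 x\<close>: the
  two iterated actions contribute \<beta>^2/4 each and the vertical bracket contributes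
  -\<delta>\<beta>. A nonzero horizontal \<open>x\<close> exists because n \<ge> 1.\<close>

lemma \<beta>_eq: "\<beta> = 2 * \<delta>"
proof -
  have "n \<ge> 1"
    using S by (simp add: almost_3_contact_metric_lie_algebra_def)
  then have "\<not> horizontal \<eta> \<subseteq> {0}"
    using dim_horizontal dim_subset[of "horizontal \<eta>" "{0::'a}"] by auto
  then obtain x where x: "x \<in> horizontal \<eta>" "x \<noteq> 0"
    by blast
  have p: "even_perm3 1 2 3"
    by (rule even_perms)
  note h = horizontal_\<phi>[OF x(1)]
  have "br (\<xi> 1) (br (\<xi> 2) x) = (\<beta>\<^sup>2 / 4) *\<^sub>R \<phi> 3 x"
    using \<phi>_\<phi>(1)[OF p, of x] br_horizontal_\<beta>[OF x(1)] br_horizontal_\<beta>[OF h] horizontal_\<eta>[OF x(1)]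
    by (simp add: br_simps power2_eq_square)
  moreover have "br (\<xi> 2) (br x (\<xi> 1)) = (\<beta>\<^sup>2 / 4) *\<^sub>R \<phi> 3 x"
    using \<phi>_\<phi>(2)[OF p, of x] br_horizontal_\<beta>[OF x(1)] br_horizontal_\<beta>[OF h] horizontal_\<eta>[OF x(1)]
    by (simp add: br_simps power2_eq_square skew[of x "\<xi> 1"])
  moreover have "br x (br (\<xi> 1) (\<xi> 2)) = - (\<delta> * \<beta>) *\<^sub>R \<phi> 3 x"
    using br_vertical[OF p] br_horizontal_\<beta>[OF x(1), of 3] by (simp add: skew[of x "\<xi> 3"] br_simps)
  ultimately have "(\<beta>\<^sup>2 / 4) *\<^sub>R \<phi> 3 x + (\<beta>\<^sup>2 / 4) *\<^sub>R \<phi> 3 x + - (\<delta> * \<beta>) *\<^sub>R \<phi> 3 x = 0"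
    using jacobi[of "\<xi> 1" "\<xi> 2" x] by simp
  then have "(\<beta>\<^sup>2 / 4 + \<beta>\<^sup>2 / 4 + - (\<delta> * \<beta>)) *\<^sub>R \<phi> 3 x = 0"
    by (simp only: scaleR_left_distrib)
  moreover have "\<phi> 3 x \<noteq> 0"
    using \<phi>_sq[of 3 x] x(2) horizontal_\<eta>[OF x(1)] by (auto simp: lin_simps)
  ultimately have "\<beta> * (\<beta> - 2 * \<delta>) = 0"
    by (simp add: power2_eq_square algebra_simps)
  then show ?thesis
    using \<beta> by simp
qed

lemma \<delta>_nonzero: "\<delta> \<noteq> 0"
  using \<beta> \<beta>_eq by simp

lemma br_horizontal: "x \<in> horizontal \<eta> \<Longrightarrow> br (\<xi> i) x = \<delta> *\<^sub>R \<phi> i x"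
  using br_horizontal_\<beta> \<beta>_eq by simp

definition vert :: "'a \<Rightarrow> 'a" where
  "vert x = \<eta> 1 x *\<^sub>R \<xi> 1 + \<eta> 2 x *\<^sub>R \<xi> 2 + \<eta> 3 x *\<^sub>R \<xi> 3"

lemma linear_vert: "linear vert"
  by (intro linearI) (simp_all add: vert_def lin_simps algebra_simps)

lemma \<eta>_vert: "\<eta> i (vert x) = \<eta> i x"
  using exhaust_3[of i] by (auto simp: vert_def lin_simps \<eta>_\<xi>_simps)

lemma horizontal_part: "x - vert x \<in> horizontal \<eta>"
  by (simp add: horizontal_def lin_simps \<eta>_vert)

lemma vert_horizontal: "x \<in> horizontal \<eta> \<Longrightarrow> vert x = 0"
  by (simp add: vert_def horizontal_def)

lemma vert_perm: "even_perm3 i j k \<Longrightarrow> vert x = \<eta> i x *\<^sub>R \<xi> i + \<eta> j x *\<^sub>R \<xi> j + \<eta> k x *\<^sub>R \<xi> k"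
  by (auto simp: vert_def even_perm3_def algebra_simps)

text \<open>On vertical vectors \<open>\<delta> *\<^sub>R \<phi> i y\<close> gives only half of the
  bracket, whose constant is 2\<delta>. The terms in \<xi>_j and \<xi>_k add the other half and
  vanish on horizontal vectors.\<close>

lemma ad_\<xi>:
  assumes p: "even_perm3 i j k"
  shows "br (\<xi> i) y = \<delta> *\<^sub>R (\<phi> i y + \<eta> j y *\<^sub>R \<xi> k - \<eta> k y *\<^sub>R \<xi> j)"
proof -
  have q: "even_perm3 k i j"
    using even_perm3_cyc[OF even_perm3_cyc[OF p]] .
  define h where "h = y - vert y"
  have h: "h \<in> horizontal \<eta>"
    by (simp add: h_def horizontal_part)
  have y: "y = \<eta> i y *\<^sub>R \<xi> i + \<eta> j y *\<^sub>R \<xi> j + \<eta> k y *\<^sub>R \<xi> k + h"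
    using vert_perm[OF p, of y] by (simp add: h_def)
  have k: "br (\<xi> i) (\<xi> k) = - (2 * \<delta>) *\<^sub>R \<xi> j"
    using br_vertical[OF q] skew[of "\<xi> i" "\<xi> k"] by simp
  have "br (\<xi> i) (\<eta> i y *\<^sub>R \<xi> i + \<eta> j y *\<^sub>R \<xi> j + \<eta> k y *\<^sub>R \<xi> k + h) =
      (2 * \<delta> * \<eta> j y) *\<^sub>R \<xi> k - (2 * \<delta> * \<eta> k y) *\<^sub>R \<xi> j + \<delta> *\<^sub>R \<phi> i h"
    using br_vertical[OF p] k
    by (simp add: br_simps alt br_horizontal[OF h] algebra_simps)
  moreover have "\<phi> i (\<eta> i y *\<^sub>R \<xi> i + \<eta> j y *\<^sub>R \<xi> j + \<eta> k y *\<^sub>R \<xi> k + h) =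
      \<eta> j y *\<^sub>R \<xi> k - \<eta> k y *\<^sub>R \<xi> j + \<phi> i h"
    using \<phi>_\<xi>(1)[OF p] \<phi>_\<xi>(2)[OF q] by (simp add: lin_simps \<phi>_\<xi>_same)
  ultimately have "br (\<xi> i) y = (2 * \<delta> * \<eta> j y) *\<^sub>R \<xi> k - (2 * \<delta> * \<eta> k y) *\<^sub>R \<xi> j + \<delta> *\<^sub>R \<phi> i h"
    and "\<phi> i h = \<phi> i y - \<eta> j y *\<^sub>R \<xi> k + \<eta> k y *\<^sub>R \<xi> j"
    unfolding y[symmetric] by simp_all
  moreover have "2 * \<delta> * a = \<delta> * a + \<delta> * a" for a
    by simp
  ultimately show ?thesis
    by (simp only: scaleR_add_left) (simp add: algebra_simps)
qed

text \<open>Both pieces of \<open>ad_\<xi>\<close> are skew: \<phi>_i, and the infinitesimal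
  rotation of the plane of \<xi>_j and \<xi>_k. This is what makes the connection metric.\<close>

lemma ad_\<xi>_skew: "br (\<xi> i) y \<bullet> z = - (y \<bullet> br (\<xi> i) z)"
proof -
  obtain j k where p: "even_perm3 i j k"
    using even_perm3_exists by blast
  show ?thesis
    using \<phi>_skew[of i y z] by (simp add: ad_\<xi>[OF p] inner_add_left inner_add_right inner_diff_left
        inner_diff_right inner_\<xi> algebra_simps)
qed

text \<open>The right side is the derivative of \<phi>_i prescribed along \<xi>_l. For l = i both
  sides vanish because the structure is abelian; otherwise the commutator of \<phi>_l and \<phi>_i
  produces the factor 2 in 2\<delta> = \<beta>.\<close>

lemma ad_\<xi>_commutator:
  assumes p: "even_perm3 i j k"
  shows "br (\<xi> l) (\<phi> i y) - \<phi> i (br (\<xi> l) y) = \<beta> *\<^sub>R (\<eta> k (\<xi> l) *\<^sub>R \<phi> j y - \<eta> j (\<xi> l) *\<^sub>R \<phi> k y)"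
proof -
  have q: "even_perm3 j k i" and r: "even_perm3 k i j"
    using even_perm3_cyc p by blast+
  note simps = \<eta>_\<xi>[OF p] \<eta>_\<xi>[OF q] \<eta>_\<xi>[OF r] \<eta>_\<xi>_same \<phi>_\<phi>[OF p] \<phi>_\<phi>[OF q] \<phi>_\<phi>[OF r]
    \<phi>_\<xi>[OF p] \<phi>_\<xi>[OF q] \<phi>_\<xi>[OF r] \<phi>_\<xi>_same \<eta>_\<phi>[OF p] \<eta>_\<phi>[OF q] \<eta>_\<phi>[OF r] \<eta>_\<phi>_same \<beta>_eq lin_simps
  show ?thesis
  proof (cases rule: even_perm3_cases[OF p, of l])
    case 1
    then show ?thesis
      using ad_\<xi>_\<phi>[of i y] by (simp add: simps)
  next
    case 2
    then show ?thesis
      by (simp add: ad_\<xi>[OF q] simps algebra_simps flip: scaleR_add_left)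
  next
    case 3
    then show ?thesis
      by (simp add: ad_\<xi>[OF r] simps algebra_simps flip: scaleR_add_left)
  qed
qed

lemma br_horizontal_horizontal:
  assumes x: "x \<in> horizontal \<eta>" and y: "y \<in> horizontal \<eta>"
  shows "br x y = 0"
proof -
  have z: "br (\<xi> i) (br x y) = 0" for i
  proof -
    \<comment> \<open>Invariance for \<open>\<phi> i x\<close> and \<open>y\<close> moves \<phi>_i
      across the bracket with a minus sign, so the other two terms of the Jacobi identity
      cancel.\<close>
    have "br (\<phi> i (\<phi> i x)) (\<phi> i y) = br (\<phi> i x) y"
      using br_invariant horizontal_\<eta> horizontal_\<phi> x y by blast
    then have "br (\<phi> i x) y = - br x (\<phi> i y)"
      by (simp add: \<phi>_sq horizontal_\<eta>[OF x] br_simps)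
    moreover have "br x (br y (\<xi> i)) = - \<delta> *\<^sub>R br x (\<phi> i y)" "br y (br (\<xi> i) x) = - \<delta> *\<^sub>R br (\<phi> i x) y"
      using br_horizontal[OF x] br_horizontal[OF y] by (simp_all add: skew[of y] br_simps)
    ultimately show ?thesis
      using jacobi[of "\<xi> i" x y] by simp
  qed
  \<comment> \<open>Since ad \<xi>_i kills \<open>br x y\<close>, dividing by \<delta> shows that
    its image under \<phi>_i is vertical, with known coefficients.\<close>
  have \<phi>z: "\<phi> i (br x y) = \<eta> k (br x y) *\<^sub>R \<xi> j - \<eta> j (br x y) *\<^sub>R \<xi> k" if p: "even_perm3 i j k" for i j k
  proof -
    have "\<delta> *\<^sub>R (\<phi> i (br x y) + \<eta> j (br x y) *\<^sub>R \<xi> k - \<eta> k (br x y) *\<^sub>R \<xi> j) = 0"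
      using z[of i] by (simp only: ad_\<xi>[OF p])
    then have "\<phi> i (br x y) + \<eta> j (br x y) *\<^sub>R \<xi> k - \<eta> k (br x y) *\<^sub>R \<xi> j = 0"
      using \<delta>_nonzero unfolding scaleR_eq_0_iff by blast
    then show ?thesis
      by (simp add: algebra_simps)
  qed
  \<comment> \<open>The value \<open>\<eta> k (\<phi> j (br x y))\<close> computed from
    \<open>\<phi>z\<close> and from \<open>\<eta>_\<phi>\<close> comes out with opposite
    signs.\<close>
  have e: "\<eta> i (br x y) = 0" if p: "even_perm3 i j k" for i j k
  proof -
    have q: "even_perm3 j k i" and r: "even_perm3 k i j"
      using even_perm3_cyc p by blast+
    have "\<eta> k (\<phi> j (br x y)) = \<eta> i (br x y)"
      by (simp add: \<phi>z[OF q] lin_simps \<eta>_\<xi>_same \<eta>_\<xi>[OF r])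
    then show ?thesis
      using \<eta>_\<phi>(2)[OF q, of "br x y"] by simp
  qed
  have "\<phi> 1 (br x y) = 0"
    using \<phi>z[OF even_perms(1)] e[OF even_perms(2)] e[OF even_perms(3)] by simp
  then show ?thesis
    using \<phi>_sq[of 1 "br x y"] e[OF even_perms(1)] by (simp add: lin_simps)
qed

text \<open>The canonical connection on left invariant vector fields: \<open>\<nabla>\<^sub>x y\<close> is the bracket of the vertical part of
  \<open>x\<close> with \<open>y\<close>. It is what the Koszul formula gives for the torsion \<open>2 \<delta> \<eta>\<^sub>1 \<and> \<eta>\<^sub>2 \<and> \<eta>\<^sub>3\<close>.\<close>

definition conn :: "'a \<Rightarrow> 'a \<Rightarrow> 'a" where
  "conn x y = br (vert x) y"

lemma conn_expand: "conn x y = \<eta> 1 x *\<^sub>R br (\<xi> 1) y + \<eta> 2 x *\<^sub>R br (\<xi> 2) y + \<eta> 3 x *\<^sub>R br (\<xi> 3) y"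
  by (simp add: conn_def vert_def br_simps)

lemma bilinear_conn: "bilinear conn"
  unfolding bilinear_def conn_def
  by (auto intro!: linearI simp: br_simps linear_add[OF linear_vert] linear_scale[OF linear_vert])

lemma conn_skew: "conn x y \<bullet> z = - (y \<bullet> conn x z)"
  by (simp add: conn_expand inner_add_left inner_add_right ad_\<xi>_skew[of _ y z])

lemma conn_\<phi>:
  assumes p: "even_perm3 i j k"
  shows "conn x (\<phi> i y) - \<phi> i (conn x y) = \<beta> *\<^sub>R (\<eta> k x *\<^sub>R \<phi> j y - \<eta> j x *\<^sub>R \<phi> k y)"
proof -
  have x: "\<eta> k x = \<eta> 1 x * \<eta> k (\<xi> 1) + \<eta> 2 x * \<eta> k (\<xi> 2) + \<eta> 3 x * \<eta> k (\<xi> 3)" for k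
    using \<eta>_vert[of k x] by (simp add: vert_def lin_simps)
  have "conn x (\<phi> i y) - \<phi> i (conn x y) = \<eta> 1 x *\<^sub>R (br (\<xi> 1) (\<phi> i y) - \<phi> i (br (\<xi> 1) y)) +
      \<eta> 2 x *\<^sub>R (br (\<xi> 2) (\<phi> i y) - \<phi> i (br (\<xi> 2) y)) + \<eta> 3 x *\<^sub>R (br (\<xi> 3) (\<phi> i y) - \<phi> i (br (\<xi> 3) y))"
    by (simp add: conn_expand lin_simps algebra_simps)
  also have "\<dots> = \<beta> *\<^sub>R (\<eta> k x *\<^sub>R \<phi> j y - \<eta> j x *\<^sub>R \<phi> k y)"
    unfolding ad_\<xi>_commutator[OF p] by (subst x[of k], subst x[of j]) (simp add: algebra_simps)
  finally show ?thesis .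
qed

text \<open>The vanishing bracket of the two horizontal parts, expanded. Read the other way: the
  torsion of \<open>conn\<close> at \<open>x\<close> and \<open>y\<close> is
  \<open>br (vert x) (vert y)\<close>.\<close>

lemma br_vert: "br x y = conn x y - conn y x - br (vert x) (vert y)"
proof -
  have "br (x - vert x) (y - vert y) = 0"
    by (intro br_horizontal_horizontal horizontal_part)
  then show ?thesis
    using skew[of "vert y" x] by (simp add: conn_def br_simps algebra_simps)
qed

text \<open>In the coordinates \<eta>_i the vertical bracket is 2\<delta> times the cross product,
  and its inner product with \<open>z\<close> becomes the determinant in
  \<open>conn_torsion\<close>.\<close>

lemma br_vert_vert:
  "br (vert x) (vert y) = (2 * \<delta>) *\<^sub>R ((\<eta> 2 x * \<eta> 3 y - \<eta> 3 x * \<eta> 2 y) *\<^sub>R \<xi> 1 +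
    (\<eta> 3 x * \<eta> 1 y - \<eta> 1 x * \<eta> 3 y) *\<^sub>R \<xi> 2 + (\<eta> 1 x * \<eta> 2 y - \<eta> 2 x * \<eta> 1 y) *\<^sub>R \<xi> 3)"
  using br_vertical[OF even_perms(1)] br_vertical[OF even_perms(2)] br_vertical[OF even_perms(3)]
  by (simp add: vert_def br_simps alt skew[of "\<xi> 2" "\<xi> 1"] skew[of "\<xi> 3" "\<xi> 2"] skew[of "\<xi> 1" "\<xi> 3"] algebra_simps)

lemma conn_torsion:
  "(conn x y - conn y x - br x y) \<bullet> z =
    2 * \<delta> * wedge3 (\<lambda>V. \<eta> 1 V) (\<lambda>V. \<eta> 2 V) (\<lambda>V. \<eta> 3 V) x y z"
  unfolding br_vert[of x y] br_vert_vert
  by (simp add: inner_add_left inner_\<xi> wedge3_def algebra_simps)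

text \<open>A single index i is enough. The hypotheses \<open>skew\<close> and
  \<open>torsion\<close> make the associated trilinear form alternating, and commutation with the
  skew map \<phi>_i lets \<phi>_i pass from one argument to another at the price of a sign.\<close>

lemma skew_\<phi>_linear_zero:
  assumes bilin: "bilinear B"
    and skew: "\<And>x y z. B x y \<bullet> z = - (y \<bullet> B x z)"
    and torsion: "\<And>x y z. (B x y - B y x) \<bullet> z = - ((B x z - B z x) \<bullet> y)"
    and \<phi>: "\<And>x y. B x (\<phi> i y) = \<phi> i (B x y)"
  shows "B x y = 0"
proof -
  define a where "a = (\<lambda>x y z. B x y \<bullet> z)"
  have a23: "a x y z = - a x z y" for x y z
    using skew[of x y z] by (simp add: a_def inner_commute)
  have "a x y z - a y x z = - (a x z y - a z x y)" for x y z
    using torsion[of x y z] by (simp add: a_def inner_diff_left)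
  note a12 = alternating_of_skew_torsion[of a, OF a23 this]
  have \<phi>23: "a x (\<phi> i y) z = - a x y (\<phi> i z)" for x y z
    by (simp add: a_def \<phi> \<phi>_skew)
  \<comment> \<open>Carrying \<phi>_i once around the three arguments costs three signs and ends at
    the starting expression.\<close>
  have \<phi>0: "a (\<phi> i x) y z = 0" for x y z
    using a12[of "\<phi> i x" y z] \<phi>23[of y x z] a23[of y x "\<phi> i z"] a12[of y "\<phi> i z" x]
      a23[of "\<phi> i z" y x] a12[of "\<phi> i z" x y] \<phi>23[of x z y] a12[of x y "\<phi> i z"]
      a23[of "\<phi> i x" y z] a12[of "\<phi> i x" z y] \<phi>23[of z x y] a12[of z x "\<phi> i y"]
      \<phi>23[of x y z] a23[of x "\<phi> i y" z] a12[of x z "\<phi> i y"] a23[of x y "\<phi> i z"]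
      a23[of z "\<phi> i x" y] a23[of z x "\<phi> i y"] by linarith
  \<comment> \<open>The image of \<phi>_i misses the direction \<xi>_i, which is treated separately:
    \<open>B x (\<xi> i)\<close> is a multiple of \<open>\<xi> i\<close> and also orthogonal to
    it.\<close>
  have "\<phi> i (B x (\<xi> i)) = 0" for x
    using \<phi>[of x "\<xi> i"] by (simp add: \<phi>_\<xi>_same bilinear_rzero[OF bilin])
  then have "B x (\<xi> i) = \<eta> i (B x (\<xi> i)) *\<^sub>R \<xi> i" for x
    using \<phi>_sq[of i "B x (\<xi> i)"] by (simp add: lin_simps add_eq_0_iff2)
  moreover have "\<eta> i (B x (\<xi> i)) = 0" for x
    using a23[of x "\<xi> i" "\<xi> i"] by (simp add: a_def inner_\<xi>)
  ultimately have "a x (\<xi> i) z = 0" for x z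
    by (metis a_def inner_zero_left scaleR_zero_left)
  then have \<xi>0: "a (\<xi> i) y z = 0" for y z
    using a12[of "\<xi> i" y z] by simp
  have "x = \<eta> i x *\<^sub>R \<xi> i - \<phi> i (\<phi> i x)"
    by (simp add: \<phi>_sq)
  then have "B x y = \<eta> i x *\<^sub>R B (\<xi> i) y - B (\<phi> i (\<phi> i x)) y"
    by (metis bilinear_lmul[OF bilin] bilinear_lsub[OF bilin])
  then have "B x y \<bullet> z = 0" for z
    using \<phi>0[of "\<phi> i x" y z] \<xi>0[of y z] by (simp add: a_def inner_diff_left)
  then show ?thesis
    using inner_eq_zero_iff by blast
qed

section \<open>The so(3) action and the semidirect product\<close>

text \<open>On horizontal vectors the commutator of \<phi>_i and \<phi>_j is 2\<phi>_k, so the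
  halves \<phi>_i/2 satisfy the relations of the basis behind \<open>skew3\<close>.\<close>

definition so3_action :: "real \<Rightarrow> real \<Rightarrow> real \<Rightarrow> 'a \<Rightarrow> 'a" where
  "so3_action a b c y = (1 / 2) *\<^sub>R (a *\<^sub>R \<phi> 1 y + b *\<^sub>R \<phi> 2 y + c *\<^sub>R \<phi> 3 y)"

lemma so3_action_horizontal: "y \<in> horizontal \<eta> \<Longrightarrow> so3_action a b c y \<in> horizontal \<eta>"
  unfolding so3_action_def
  by (intro subspace_scale[OF subspace_horizontal] subspace_add[OF subspace_horizontal] horizontal_\<phi>)

lemma linear_so3_action: "linear (so3_action a b c)"
  by (intro linearI) (simp_all add: so3_action_def lin_simps algebra_simps)

lemma so3_action_linear:
  "so3_action (r * a + s * a') (r * b + s * b') (r * c + s * c') y =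
    r *\<^sub>R so3_action a b c y + s *\<^sub>R so3_action a' b' c' y"
  by (simp add: so3_action_def algebra_simps)

lemma so3_action_commutator:
  assumes y: "y \<in> horizontal \<eta>"
  shows "so3_action a b c (so3_action a' b' c' y) - so3_action a' b' c' (so3_action a b c y) =
    so3_action (b * c' - c * b') (c * a' - a * c') (a * b' - b * a') y"
proof -
  note h = horizontal_\<eta>[OF y]
  have sq: "\<phi> i (\<phi> i y) = - y" for i
    by (simp add: \<phi>_sq h)
  note m = \<phi>_\<phi>[OF even_perms(1), of y, unfolded h] \<phi>_\<phi>[OF even_perms(2), of y, unfolded h]
    \<phi>_\<phi>[OF even_perms(3), of y, unfolded h]
  \<comment> \<open>The factor 1/2 is kept out of the main computation, in which every mixed product
    appears twice and gives \<open>R + R\<close>.\<close>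
  define T where "T = (\<lambda>a b c y. a *\<^sub>R \<phi> 1 y + b *\<^sub>R \<phi> 2 y + c *\<^sub>R \<phi> 3 y)"
  define R where "R = T (b * c' - c * b') (c * a' - a * c') (a * b' - b * a') y"
  have T: "so3_action a b c z = (1 / 2) *\<^sub>R T a b c z" for a b c z
    by (simp add: so3_action_def T_def)
  have lin: "T a b c (r *\<^sub>R z) = r *\<^sub>R T a b c z" for a b c r z
    by (simp add: T_def lin_simps algebra_simps)
  have "T a b c (T a' b' c' y) - T a' b' c' (T a b c y) = R + R"
    unfolding R_def T_def by (simp add: lin_simps sq m) (simp add: algebra_simps)
  then have "T a b c (T a' b' c' y) - T a' b' c' (T a b c y) = 2 *\<^sub>R R"
    by (simp add: scaleR_2)
  then have "(1 / 4) *\<^sub>R (T a b c (T a' b' c' y) - T a' b' c' (T a b c y)) = (1 / 2) *\<^sub>R R"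
    by simp
  then show ?thesis
    by (simp add: T lin R_def scaleR_diff_right)
qed

lemma conn_horizontal:
  "y \<in> horizontal \<eta> \<Longrightarrow> conn x y = (2 * \<delta>) *\<^sub>R so3_action (\<eta> 1 x) (\<eta> 2 x) (\<eta> 3 x) y"
  by (simp add: conn_expand br_horizontal so3_action_def scaleR_add_right mult.commute)

lemma conn_vert: "conn x (vert y) = br (vert x) (vert y)"
  by (simp add: conn_def)

lemma vert_br_vert: "vert (br (vert x) (vert y)) = br (vert x) (vert y)"
  unfolding br_vert_vert by (simp add: vert_def lin_simps \<eta>_\<xi>_simps scaleR_add_right)

text \<open>In \<open>br_vert\<close>, \<open>conn\<close> acts on horizontal vectors through
  \<open>so3_action\<close> and on vertical ones through the vertical bracket. Together the two
  formulas are a semidirect bracket up to the factor 2\<delta>, which the isomorphism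
  absorbs.\<close>

lemma br_decomposition:
  shows "vert (br x y) = br (vert x) (vert y)"
    and "br x y - vert (br x y) = (2 * \<delta>) *\<^sub>R (so3_action (\<eta> 1 x) (\<eta> 2 x) (\<eta> 3 x) (y - vert y)
      - so3_action (\<eta> 1 y) (\<eta> 2 y) (\<eta> 3 y) (x - vert x))"
proof -
  let ?h = "(2 * \<delta>) *\<^sub>R (so3_action (\<eta> 1 x) (\<eta> 2 x) (\<eta> 3 x) (y - vert y)
      - so3_action (\<eta> 1 y) (\<eta> 2 y) (\<eta> 3 y) (x - vert x))"
  have h: "?h \<in> horizontal \<eta>"
    by (intro subspace_scale[OF subspace_horizontal] subspace_diff[OF subspace_horizontal]
        so3_action_horizontal horizontal_part)
  have c: "conn x (y - vert y) - conn y (x - vert x) = ?h"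
    by (simp add: conn_horizontal[OF horizontal_part] scaleR_diff_right)
  have "conn x y - br (vert x) (vert y) - (conn y x + br (vert x) (vert y)) = ?h"
    using c skew[of "vert y" "vert x"] by (simp add: bilinear_rsub[OF bilinear_conn] conn_vert)
  then have e: "br x y = br (vert x) (vert y) + ?h"
    unfolding br_vert[of x y] by (simp add: algebra_simps)
  then show v: "vert (br x y) = br (vert x) (vert y)"
    by (simp add: linear_add[OF linear_vert] vert_br_vert vert_horizontal[OF h])
  show "br x y - vert (br x y) = ?h"
    using e v by simp
qed

lemma vertical_iff: "x \<in> vertical \<xi> \<longleftrightarrow> vert x = x"
proof
  have s: "subspace {x. vert x = x}"
    by (simp add: subspace_def linear_0[OF linear_vert] linear_add[OF linear_vert] linear_scale[OF linear_vert])
  have "vert (\<xi> i) = \<xi> i" for i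
    using exhaust_3[of i] by (auto simp: vert_def \<eta>_\<xi>_simps)
  then have "range \<xi> \<subseteq> {x. vert x = x}"
    by auto
  then have "vertical \<xi> \<subseteq> {x. vert x = x}"
    unfolding vertical_def by (rule span_minimal[OF _ s])
  then show "x \<in> vertical \<xi> \<Longrightarrow> vert x = x"
    by blast
next
  have "vert x \<in> vertical \<xi>"
    unfolding vert_def vertical_def by (intro span_add span_scale span_base rangeI)
  then show "vert x = x \<Longrightarrow> x \<in> vertical \<xi>"
    by simp
qed

lemma skew3_vert: "skew3 (\<eta> 1 x) (\<eta> 2 x) (\<eta> 3 x) = 0 \<longleftrightarrow> vert x = 0"
proof
  assume "skew3 (\<eta> 1 x) (\<eta> 2 x) (\<eta> 3 x) = 0"
  then have "\<eta> 1 x = 0" "\<eta> 2 x = 0" "\<eta> 3 x = 0"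
    using skew3_entries(8,3,4)[of "\<eta> 1 x" "\<eta> 2 x" "\<eta> 3 x"] by simp_all
  then show "vert x = 0"
    by (simp add: vert_def)
next
  assume "vert x = 0"
  then have "\<eta> i x = 0" for i
    using \<eta>_vert[of i x] by (simp add: lin_simps)
  then show "skew3 (\<eta> 1 x) (\<eta> 2 x) (\<eta> 3 x) = 0"
    by (intro matrix3_eqI) (simp_all add: skew3_entries)
qed

lemma so3_semidirect:
  assumes k: "CARD('k::finite) = 4 * n"
  shows "\<exists>(\<rho> :: real^3^3 \<Rightarrow> real^'k \<Rightarrow> real^'k) F. so3_semidirect_iso br \<rho> F \<and>
    F ` vertical \<xi> = so3 \<times> {0} \<and> F ` horizontal \<eta> = {0} \<times> UNIV"
proof -
  have "dim (horizontal \<eta>) = dim (UNIV :: (real^'k) set)"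
    using k by (simp add: dim_horizontal)
  then obtain f :: "'a \<Rightarrow> real^'k" and g where fg: "linear f" "linear g" "g ` UNIV = horizontal \<eta>"
    "\<And>x. x \<in> horizontal \<eta> \<Longrightarrow> g (f x) = x" "\<And>u. f (g u) = u"
    using isometries_subspaces[OF subspace_horizontal subspace_UNIV] by (metis UNIV_I)
  have gh: "g u \<in> horizontal \<eta>" for u
    using fg(3) by blast
  \<comment> \<open>The three entries are the coordinates of a skew matrix in the form
    \<open>skew3\<close>.\<close>
  define \<rho> where "\<rho> = (\<lambda>(A :: real^3^3) u. f (so3_action (A $ 3 $ 2) (A $ 1 $ 3) (A $ 2 $ 1) (g u)))"
  \<comment> \<open>Scaling by 2\<delta> turns [\<xi>_i, \<xi>_j] = 2\<delta> \<xi>_k into the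
    relations of the basis of so(3); combined with the 1/2 in \<open>so3_action\<close> it
    reproduces ad \<xi>_i = \<delta> \<phi>_i on horizontal vectors.\<close>
  define M where "M = (\<lambda>x. (2 * \<delta>) *\<^sub>R skew3 (\<eta> 1 x) (\<eta> 2 x) (\<eta> 3 x))"
  define F where "F = (\<lambda>x. (M x, f (x - vert x)))"
  have M_skew3: "M x = skew3 (2 * \<delta> * \<eta> 1 x) (2 * \<delta> * \<eta> 2 x) (2 * \<delta> * \<eta> 3 x)" for x
    unfolding M_def by (rule matrix3_eqI) (simp_all add: skew3_entries)
  have M_vert: "M (vert x) = M x" for x
    by (simp add: M_def \<eta>_vert)
  have \<rho>_skew3: "\<rho> (skew3 a b c) u = f (so3_action a b c (g u))" for a b c u
    by (simp add: \<rho>_def skew3_entries)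
  have g\<rho>: "g (\<rho> A u) = so3_action (A $ 3 $ 2) (A $ 1 $ 3) (A $ 2 $ 1) (g u)" for A u
    unfolding \<rho>_def by (rule fg(4)[OF so3_action_horizontal[OF gh]])
  have "linear (\<rho> A)" for A
    unfolding \<rho>_def using linear_compose[OF linear_compose[OF fg(2) linear_so3_action] fg(1)]
    by (simp add: o_def)
  moreover have "\<rho> (r *\<^sub>R A + s *\<^sub>R B) u = r *\<^sub>R \<rho> A u + s *\<^sub>R \<rho> B u" for r s A B u
    by (simp add: \<rho>_def so3_action_linear linear_add[OF fg(1)] linear_scale[OF fg(1)])
  moreover have "\<rho> (commutator A B) u = \<rho> A (\<rho> B u) - \<rho> B (\<rho> A u)" if A: "A \<in> so3" and B: "B \<in> so3" for A B u
  proof -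
    have "\<rho> (commutator A B) u = f (so3_action (A $ 3 $ 2) (A $ 1 $ 3) (A $ 2 $ 1) (g (\<rho> B u))
        - so3_action (B $ 3 $ 2) (B $ 1 $ 3) (B $ 2 $ 1) (g (\<rho> A u)))"
      unfolding g\<rho> so3_action_commutator[OF gh]
      by (subst so3_skew3[OF A], subst so3_skew3[OF B]) (simp only: commutator_skew3 \<rho>_skew3)
    then show ?thesis
      by (simp add: linear_diff[OF fg(1)] \<rho>_def)
  qed
  ultimately have rep: "so3_representation \<rho>"
    by (simp add: so3_representation_def)
  have lin: "linear F"
  proof (rule linearI)
    have "M (x + y) = M x + M y" for x y
      unfolding M_skew3 by (rule matrix3_eqI) (simp_all add: skew3_entries lin_simps algebra_simps)
    moreover have "f (x + y - vert (x + y)) = f (x - vert x) + f (y - vert y)" for x y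
      by (simp add: linear_add[OF linear_vert] linear_diff[OF fg(1)] linear_add[OF fg(1)])
    ultimately show "F (x + y) = F x + F y" for x y
      by (simp add: F_def)
    have "M (r *\<^sub>R x) = r *\<^sub>R M x" for r x
      unfolding M_skew3 by (rule matrix3_eqI) (simp_all add: skew3_entries lin_simps)
    moreover have "f (r *\<^sub>R x - vert (r *\<^sub>R x)) = r *\<^sub>R f (x - vert x)" for r x
      by (simp add: linear_scale[OF linear_vert] linear_diff[OF fg(1)] linear_scale[OF fg(1)] scaleR_diff_right)
    ultimately show "F (r *\<^sub>R x) = r *\<^sub>R F x" for r x
      by (simp add: F_def)
  qed
  have hom: "F (br x y) = semidirect_bracket \<rho> (F x) (F y)" for x y
  proof -
    have "M (br x y) = M (br (vert x) (vert y))"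
      using M_vert[of "br x y"] by (simp add: br_decomposition(1))
    also have "\<dots> = commutator (M x) (M y)"
      unfolding M_skew3 commutator_skew3 br_vert_vert
      by (rule matrix3_eqI) (simp_all add: skew3_entries lin_simps \<eta>_\<xi>_simps algebra_simps)
    finally have 1: "M (br x y) = commutator (M x) (M y)" .
    have act: "\<rho> (M x) (f (y - vert y)) = f ((2 * \<delta>) *\<^sub>R so3_action (\<eta> 1 x) (\<eta> 2 x) (\<eta> 3 x) (y - vert y))" for x y
      unfolding M_skew3 \<rho>_skew3 fg(4)[OF horizontal_part] so3_action_def
      by (simp add: algebra_simps)
    have "f (br x y - vert (br x y)) = \<rho> (M x) (f (y - vert y)) - \<rho> (M y) (f (x - vert x))"
      unfolding act br_decomposition(2) by (simp add: scaleR_diff_right linear_diff[OF fg(1)])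
    with 1 show ?thesis
      by (simp add: F_def semidirect_bracket_def)
  qed
  have M0: "M x = 0 \<longleftrightarrow> vert x = 0" for x
    using \<delta>_nonzero skew3_vert by (simp add: M_def)
  have f0: "f (x - vert x) = 0 \<longleftrightarrow> x = vert x" for x
    using fg(4)[OF horizontal_part, of x] linear_0[OF fg(1)] linear_0[OF fg(2)] by (metis eq_iff_diff_eq_0)
  have "inj F"
    unfolding linear_injective_0[OF lin] using M0 f0 by (auto simp: F_def zero_prod_def)
  have MA: "\<exists>v. vert v = v \<and> M v = A" if A: "A \<in> so3" for A
  proof (intro exI conjI)
    \<comment> \<open>The coordinates of \<open>A\<close>, divided by the nonzero scaling factor of
      \<open>M\<close>.\<close>
    let ?v = "(A $ 3 $ 2 / (2 * \<delta>)) *\<^sub>R \<xi> 1 + (A $ 1 $ 3 / (2 * \<delta>)) *\<^sub>R \<xi> 2 + (A $ 2 $ 1 / (2 * \<delta>)) *\<^sub>R \<xi> 3"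
    have \<eta>: "\<eta> 1 ?v = A $ 3 $ 2 / (2 * \<delta>)" "\<eta> 2 ?v = A $ 1 $ 3 / (2 * \<delta>)" "\<eta> 3 ?v = A $ 2 $ 1 / (2 * \<delta>)"
      by (simp_all add: lin_simps \<eta>_\<xi>_simps)
    show "vert ?v = ?v"
      unfolding vert_def \<eta> by simp
    show "M ?v = A"
      unfolding M_skew3 \<eta> using so3_skew3[OF A] \<delta>_nonzero by simp
  qed
  have Fv: "F v = (M v, 0)" if "vert v = v" for v
    using that f0[of v] by (simp add: F_def)
  have Fh: "F (g u) = (0, u)" for u
    using vert_horizontal[OF gh, of u] M0[of "g u"] by (simp add: F_def fg(5))
  have M_so3: "M x \<in> so3" for x
    by (simp add: M_skew3 skew3_so3)
  have "range F = so3 \<times> UNIV"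
  proof
    show "range F \<subseteq> so3 \<times> UNIV"
      by (auto simp: F_def M_so3)
    show "so3 \<times> UNIV \<subseteq> range F"
    proof clarify
      fix A :: "real^3^3" and u :: "real^'k"
      assume "A \<in> so3"
      then obtain v where "vert v = v" "M v = A"
        using MA by blast
      then have "F (v + g u) = (A, u)"
        using Fv Fh by (simp add: linear_add[OF lin])
      then show "(A, u) \<in> range F"
        by (metis rangeI)
    qed
  qed
  with \<open>inj F\<close> rep lin hom have "so3_semidirect_iso br \<rho> F"
    by (simp add: so3_semidirect_iso_def bij_betw_def)
  moreover have "F ` vertical \<xi> = so3 \<times> {0}"
  proof
    show "F ` vertical \<xi> \<subseteq> so3 \<times> {0}"
      using Fv M_so3 by (auto simp: vertical_iff)
    show "so3 \<times> {0} \<subseteq> F ` vertical \<xi>"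
    proof clarify
      fix A :: "real^3^3"
      assume "A \<in> so3"
      then obtain v where "vert v = v" "M v = A"
        using MA by blast
      then show "(A, 0) \<in> F ` vertical \<xi>"
        using Fv[of v] vertical_iff[of v] by (metis imageI)
    qed
  qed
  moreover have "F ` horizontal \<eta> = {0} \<times> UNIV"
    unfolding fg(3)[symmetric] image_image Fh by auto
  ultimately show ?thesis
    by blast
qed

end

section \<open>The canonical connection\<close>

context lie_group_with_algebra
begin

section \<open>Connections evaluated on left invariant fields\<close>

lemma \<iota>_vf: "\<iota> (x + y) = vf_add (\<iota> x) (\<iota> y)" "\<iota> (r *\<^sub>R x) = vf_scale (\<lambda>p. r) (\<iota> x)"
  by (simp_all add: fun_eq_iff vf_add_def vf_scale_def \<iota>_add \<iota>_scale)

text \<open>The derivative of the factor in the Leibniz rule does not involve the connection, so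
  agreement spreads along \<open>vfields_induct\<close>: in the second argument, and in the first
  for a left invariant second argument.\<close>

lemma affine_connection_eqI:
  assumes D: "affine_connection A D" and D': "affine_connection A D'"
    and eq: "\<And>x y. D (\<iota> x) (\<iota> y) = D' (\<iota> x) (\<iota> y)"
    and X: "X \<in> vfields A" and Y: "Y \<in> vfields A"
  shows "D X Y = D' X Y"
  using Y
proof (induction Y rule: vfields_induct)
  case (left_invariant y)
  show ?case
    using X
  proof (induction X rule: vfields_induct)
    case (add X X')
    then show ?case
      using D D' \<iota>_vfields[of y] by (simp add: affine_connection_def)
  next
    case (scale f X)
    then show ?case
      using D D' \<iota>_vfields[of y] by (simp add: affine_connection_def)
  qed (rule eq)
next
  case (add Y Y')
  then show ?case
    using D D' X by (simp add: affine_connection_def)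
next
  case (scale f Y)
  then show ?case
    using D D' X by (simp add: affine_connection_def)
qed

lemma smooth_fun_const: "smooth_fun A (\<lambda>p. r)"
  by (simp add: smooth_fun_iff smooth_valued_const)

text \<open>Scalars act as constant functions, for which the Leibniz term vanishes. The bilinear map
  may depend on \<open>p\<close>, since \<open>D\<close> is not assumed left invariant.\<close>

lemma bilinear_affine_connection:
  assumes D: "affine_connection A D"
  shows "bilinear (\<lambda>x y. left_triv \<iota> (D (\<iota> x) (\<iota> y)) p)"
proof -
  note v = \<iota>_vfields
  have in_vf: "D (\<iota> x) (\<iota> y) \<in> vfields A" for x y
    using D v by (simp add: affine_connection_def)
  have "D (\<iota> (x + x')) (\<iota> y) = vf_add (D (\<iota> x) (\<iota> y)) (D (\<iota> x') (\<iota> y))"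
    and "D (\<iota> y) (\<iota> (x + x')) = vf_add (D (\<iota> y) (\<iota> x)) (D (\<iota> y) (\<iota> x'))" for x x' y
    using D v by (simp_all add: affine_connection_def \<iota>_vf)
  moreover have "D (\<iota> (r *\<^sub>R x)) (\<iota> y) = vf_scale (\<lambda>p. r) (D (\<iota> x) (\<iota> y))"
    and "D (\<iota> y) (\<iota> (r *\<^sub>R x)) = vf_add (vf_scale (vf_apply A (\<iota> y) (\<lambda>p. r)) (\<iota> x)) (vf_scale (\<lambda>p. r) (D (\<iota> y) (\<iota> x)))"
    for r x y
    using D v smooth_fun_const by (simp_all add: affine_connection_def \<iota>_vf)
  moreover have "vf_apply A (\<iota> y) (\<lambda>p. r) = (\<lambda>p. 0)" for r y
    by (simp add: fun_eq_iff vf_apply_eq directional_const)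
  moreover have "vf_add (vf_scale (\<lambda>p. 0) X) Y = Y" for X Y :: "('p, 'm) vfield"
    by (simp add: vf_add_def vf_scale_def)
  ultimately show ?thesis
    by (auto simp: bilinear_def left_triv_vf_add left_triv_vf_scale in_vf intro!: linearI)
qed

lemma smooth_valued_vf_bracket:
  assumes X: "X \<in> vfields A" and Y: "Y \<in> vfields A" and "bilinear br"
  shows "smooth_valued A (\<lambda>p. directional A X (left_triv \<iota> Y) p - directional A Y (left_triv \<iota> X) p +
    br (left_triv \<iota> X p) (left_triv \<iota> Y p))"
proof -
  note x = smooth_valued_left_triv[OF X] and y = smooth_valued_left_triv[OF Y]
  have "smooth_valued A (\<lambda>p. directional A X (left_triv \<iota> Y) p + - directional A Y (left_triv \<iota> X) p)"
    by (intro smooth_valued_add[OF atlas] smooth_valued_linear[OF atlas, of uminus]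
        smooth_directional[OF atlas] x y X Y linear_uminus)
  moreover have "smooth_valued A (\<lambda>p. br (left_triv \<iota> X p) (left_triv \<iota> Y p))"
    using smooth_valued_bilinear[OF atlas _ x y] assms(3) by (simp add: bilinear_conv_bounded_bilinear)
  ultimately show ?thesis
    using smooth_valued_add[OF atlas] by fastforce
qed

lemma left_triv_torsion:
  assumes D: "affine_connection A D" and X: "X \<in> vfields A" and Y: "Y \<in> vfields A" and br: "bilinear br"
  shows "left_triv \<iota> (torsion A D X Y) p = left_triv \<iota> (D X Y) p - left_triv \<iota> (D Y X) p -
    (directional A X (left_triv \<iota> Y) p - directional A Y (left_triv \<iota> X) p +
      br (left_triv \<iota> X p) (left_triv \<iota> Y p))"
proof -
  have d: "D X Y \<in> vfields A" "D Y X \<in> vfields A"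
    using D X Y by (auto simp: affine_connection_def)
  have b: "vf_bracket A X Y \<in> vfields A"
    using frame_field_vfields[OF smooth_valued_vf_bracket[OF X Y br]] by (simp add: vf_bracket_frame[OF X Y])
  show ?thesis
    unfolding torsion_def left_triv_vf_diff[OF vfields_diff[OF d] b] left_triv_vf_diff[OF d]
    by (simp add: vf_bracket_frame[OF X Y])
qed

lemma left_triv_\<iota>_fun: "left_triv \<iota> (\<iota> x) = (\<lambda>p. x)"
  by (simp add: fun_eq_iff)

text \<open>Left invariant fields have constant coefficients in the frame, so no derivatives survive
  in the bracket.\<close>

lemma torsion_form_\<iota>:
  assumes D: "affine_connection A D" and br: "bilinear br"
  shows "torsion_form A \<iota> D (\<iota> x) (\<iota> y) (\<iota> z) p =
    (left_triv \<iota> (D (\<iota> x) (\<iota> y)) p - left_triv \<iota> (D (\<iota> y) (\<iota> x)) p - br x y) \<bullet> z"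
  by (simp add: torsion_form_def li_metric_def left_triv_torsion[OF D \<iota>_vfields \<iota>_vfields br]
      left_triv_\<iota>_fun directional_const)

lemma li_endo_\<iota>: "li_endo \<iota> \<phi> (\<iota> x) = \<iota> (\<phi> x)"
  by (simp add: li_endo_def)

text \<open>The metric is constant on left invariant fields, so its derivative contributes
  nothing.\<close>

lemma metric_connection_skew:
  assumes "metric_connection A \<iota> D"
  shows "left_triv \<iota> (D (\<iota> x) (\<iota> y)) p \<bullet> z = - (y \<bullet> left_triv \<iota> (D (\<iota> x) (\<iota> z)) p)"
proof -
  have "vf_apply A (\<iota> x) (li_metric \<iota> (\<iota> y) (\<iota> z)) p =
      li_metric \<iota> (D (\<iota> x) (\<iota> y)) (\<iota> z) p + li_metric \<iota> (\<iota> y) (D (\<iota> x) (\<iota> z)) p"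
    using assms \<iota>_vfields unfolding metric_connection_def by blast
  moreover have "li_metric \<iota> (\<iota> y) (\<iota> z) = (\<lambda>p. y \<bullet> z)"
    by (simp add: fun_eq_iff li_metric_def)
  ultimately show ?thesis
    by (simp add: vf_apply_eq directional_const) (simp add: li_metric_def)
qed

end

section \<open>The explicit connection and its characterisation\<close>

locale lie_group_canonical =
  lie_group_with_algebra A mul e iv br \<iota> + nonparallel_canonical n br \<phi> \<xi> \<eta> \<beta> \<delta>
  for A :: "('p::{t2_space,second_countable_topology}, 'm::euclidean_space) chart set"
    and mul e iv and br :: "'a::euclidean_space \<Rightarrow> 'a \<Rightarrow> 'a" and \<iota> n \<phi> \<xi> \<eta> \<beta> \<delta>
begin

text \<open>The extension of \<open>conn\<close> from left invariant fields to all fields by the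
  Leibniz rule: the flat derivative of the frame coefficients plus an algebraic term.\<close>

definition nabla :: "('p, 'm) vfield \<Rightarrow> ('p, 'm) vfield \<Rightarrow> ('p, 'm) vfield" where
  "nabla X Y = frame_field \<iota> (\<lambda>p. directional A X (left_triv \<iota> Y) p + conn (left_triv \<iota> X p) (left_triv \<iota> Y p))"

lemma left_triv_nabla:
  "left_triv \<iota> (nabla X Y) p = directional A X (left_triv \<iota> Y) p + conn (left_triv \<iota> X p) (left_triv \<iota> Y p)"
  by (simp add: nabla_def)

lemmas conn_simps = bilinear_ladd[OF bilinear_conn] bilinear_radd[OF bilinear_conn]
  bilinear_lmul[OF bilinear_conn] bilinear_rmul[OF bilinear_conn]

lemma nabla_vfields:
  assumes X: "X \<in> vfields A" and Y: "Y \<in> vfields A"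
  shows "nabla X Y \<in> vfields A"
proof -
  have "smooth_valued A (\<lambda>p. conn (left_triv \<iota> X p) (left_triv \<iota> Y p))"
    using smooth_valued_bilinear[OF atlas _ smooth_valued_left_triv[OF X] smooth_valued_left_triv[OF Y]]
      bilinear_conn by (simp add: bilinear_conv_bounded_bilinear)
  then show ?thesis
    unfolding nabla_def
    by (intro frame_field_vfields smooth_valued_add[OF atlas]
        smooth_directional[OF atlas smooth_valued_left_triv[OF Y] X])
qed

lemma affine_nabla: "affine_connection A nabla"
  unfolding affine_connection_def
proof (intro conjI ballI allI impI)
  fix X Y Z :: "('p, 'm) vfield"
  assume X: "X \<in> vfields A" and Y: "Y \<in> vfields A"
  show "nabla X Y \<in> vfields A"
    using nabla_vfields[OF X Y] .
  assume Z: "Z \<in> vfields A"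
  note v = nabla_vfields vfields_add[OF atlas] X Y Z
  show "nabla (vf_add X Y) Z = vf_add (nabla X Z) (nabla Y Z)"
    by (rule vfields_eqI) (simp_all add: v left_triv_nabla left_triv_vf_add conn_simps
        directional_linear_field[OF atlas smooth_valued_left_triv])
  have "left_triv \<iota> (vf_add Y Z) = (\<lambda>p. left_triv \<iota> Y p + left_triv \<iota> Z p)"
    by (simp add: fun_eq_iff v left_triv_vf_add)
  then show "nabla X (vf_add Y Z) = vf_add (nabla X Y) (nabla X Z)"
    by (intro vfields_eqI) (simp_all add: v left_triv_nabla left_triv_vf_add conn_simps
        directional_add[OF atlas smooth_valued_left_triv smooth_valued_left_triv])
next
  fix f :: "'p \<Rightarrow> real" and X Y :: "('p, 'm) vfield"
  assume f: "smooth_fun A f" and X: "X \<in> vfields A" and Y: "Y \<in> vfields A"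
  have sf: "smooth_valued A f"
    using f by (simp add: smooth_fun_iff)
  have Xf: "smooth_fun A (directional A X f)"
    using smooth_directional[OF atlas sf X] by (simp add: smooth_fun_iff)
  note v = nabla_vfields vfields_add[OF atlas] vfields_scale[OF atlas] X Y f Xf
  show "nabla (vf_scale f X) Y = vf_scale f (nabla X Y)"
    by (rule vfields_eqI) (simp_all add: v left_triv_nabla left_triv_vf_scale conn_simps scaleR_add_right
        directional_linear_field[OF atlas smooth_valued_left_triv])
  have "left_triv \<iota> (vf_scale f Y) = (\<lambda>p. f p *\<^sub>R left_triv \<iota> Y p)"
    by (simp add: fun_eq_iff v left_triv_vf_scale)
  then show "nabla X (vf_scale f Y) = vf_add (vf_scale (vf_apply A X f) Y) (vf_scale f (nabla X Y))"
    by (intro vfields_eqI) (simp_all add: v left_triv_nabla left_triv_vf_scale left_triv_vf_add conn_simps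
        scaleR_add_right vf_apply_eq
        directional_bilinear[OF atlas bounded_bilinear_scaleR sf smooth_valued_left_triv])
qed

lemma metric_nabla: "metric_connection A \<iota> nabla"
  unfolding metric_connection_def
proof (intro conjI affine_nabla ballI allI)
  fix X Y Z :: "('p, 'm) vfield" and p
  assume X: "X \<in> vfields A" and Y: "Y \<in> vfields A" and Z: "Z \<in> vfields A"
  have "li_metric \<iota> Y Z = (\<lambda>p. left_triv \<iota> Y p \<bullet> left_triv \<iota> Z p)"
    by (simp add: fun_eq_iff li_metric_def)
  then show "vf_apply A X (li_metric \<iota> Y Z) p = li_metric \<iota> (nabla X Y) Z p + li_metric \<iota> Y (nabla X Z) p"
    using directional_bilinear[OF atlas bounded_bilinear_inner smooth_valued_left_triv[OF Y] smooth_valued_left_triv[OF Z]]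
      conn_skew[of "left_triv \<iota> X p" "left_triv \<iota> Y p" "left_triv \<iota> Z p"]
    by (simp add: vf_apply_eq) (simp add: li_metric_def left_triv_nabla inner_add_left inner_add_right)
qed

lemma torsion_nabla:
  assumes X: "X \<in> vfields A" and Y: "Y \<in> vfields A"
  shows "torsion_form A \<iota> nabla X Y Z p = 2 * \<delta> * wedge3 (\<lambda>V. li_form \<iota> (\<eta> 1) V p)
    (\<lambda>V. li_form \<iota> (\<eta> 2) V p) (\<lambda>V. li_form \<iota> (\<eta> 3) V p) X Y Z"
  using conn_torsion[of "left_triv \<iota> X p" "left_triv \<iota> Y p" "left_triv \<iota> Z p"]
  by (simp add: torsion_form_def li_metric_def left_triv_torsion[OF affine_nabla X Y bil] left_triv_nabla
      wedge3_def li_form_def algebra_simps)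

text \<open>In the frame \<phi>_i is a constant linear map and commutes with the derivative of the
  coefficients, so only \<open>conn_\<phi>\<close> remains.\<close>

lemma nabla_li_endo:
  assumes p: "even_perm3 i j k" and X: "X \<in> vfields A" and Y: "Y \<in> vfields A"
  shows "vf_diff (nabla X (li_endo \<iota> (\<phi> i) Y)) (li_endo \<iota> (\<phi> i) (nabla X Y)) =
    vf_scale (\<lambda>p. \<beta>) (vf_diff (vf_scale (li_form \<iota> (\<eta> k) X) (li_endo \<iota> (\<phi> j) Y))
      (vf_scale (li_form \<iota> (\<eta> j) X) (li_endo \<iota> (\<phi> k) Y)))"
proof (rule vfields_eqI)
  have \<eta>: "smooth_fun A (li_form \<iota> (\<eta> l) X)" for l
    using smooth_valued_linear[OF atlas linear_\<eta>[of l] smooth_valued_left_triv[OF X]]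
    by (simp add: smooth_fun_iff li_form_def[abs_def])
  note v = nabla_vfields vfields_diff vfields_scale[OF atlas] X Y \<eta> smooth_fun_const li_endo_vfields[OF linear_\<phi>]
  show "vf_diff (nabla X (li_endo \<iota> (\<phi> i) Y)) (li_endo \<iota> (\<phi> i) (nabla X Y)) \<in> vfields A"
    "vf_scale (\<lambda>p. \<beta>) (vf_diff (vf_scale (li_form \<iota> (\<eta> k) X) (li_endo \<iota> (\<phi> j) Y))
      (vf_scale (li_form \<iota> (\<eta> j) X) (li_endo \<iota> (\<phi> k) Y))) \<in> vfields A"
    by (simp_all add: v)
  fix p
  have e: "left_triv \<iota> (li_endo \<iota> f Z) = (\<lambda>p. f (left_triv \<iota> Z p))" for f Z
    by (simp add: fun_eq_iff li_endo_eq)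
  show "left_triv \<iota> (vf_diff (nabla X (li_endo \<iota> (\<phi> i) Y)) (li_endo \<iota> (\<phi> i) (nabla X Y))) p =
    left_triv \<iota> (vf_scale (\<lambda>p. \<beta>) (vf_diff (vf_scale (li_form \<iota> (\<eta> k) X) (li_endo \<iota> (\<phi> j) Y))
      (vf_scale (li_form \<iota> (\<eta> j) X) (li_endo \<iota> (\<phi> k) Y)))) p"
    using conn_\<phi>[OF p, of "left_triv \<iota> X p" "left_triv \<iota> Y p"]
    by (simp add: v left_triv_vf_diff left_triv_vf_scale left_triv_nabla e lin_simps li_form_def
        directional_linear[OF atlas linear_\<phi> smooth_valued_left_triv[OF Y]])
qed

lemma eq_nabla:
  assumes D: "metric_connection A \<iota> D"
    and B: "\<And>p. (\<forall>x y. left_triv \<iota> (D (\<iota> x) (\<iota> y)) p - conn x y = 0)"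
    and X: "X \<in> vfields A" and Y: "Y \<in> vfields A"
  shows "D X Y = nabla X Y"
proof (rule affine_connection_eqI[OF _ affine_nabla _ X Y])
  show aff: "affine_connection A D"
    using D by (simp add: metric_connection_def)
  show "D (\<iota> x) (\<iota> y) = nabla (\<iota> x) (\<iota> y)" for x y
    by (rule vfields_eqI) (use aff B \<iota>_vfields nabla_vfields in
      \<open>simp_all add: affine_connection_def left_triv_nabla left_triv_\<iota>_fun directional_const\<close>)
qed

text \<open>At each point the difference on left invariant fields satisfies the hypotheses of
  \<open>skew_\<phi>_linear_zero\<close>; the prescribed derivative of \<phi>_1 alone is
  used.\<close>

lemma canonical_eq_nabla:
  assumes D: "canonical_connection A \<iota> \<phi> \<eta> \<beta> D" and X: "X \<in> vfields A" and Y: "Y \<in> vfields A"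
  shows "D X Y = nabla X Y"
proof (rule eq_nabla[OF _ _ X Y])
  show m: "metric_connection A \<iota> D"
    using D by (simp add: canonical_connection_def)
  then have aff: "affine_connection A D"
    by (simp add: metric_connection_def)
  fix p
  let ?D = "\<lambda>x y. left_triv \<iota> (D (\<iota> x) (\<iota> y)) p"
  let ?B = "\<lambda>x y. ?D x y - conn x y"
  have "?B x y = 0" for x y
  proof (rule skew_\<phi>_linear_zero[where i = 1 and B = ?B])
    show "bilinear ?B"
      using bilinear_affine_connection[OF aff, of p] bilinear_conn
      by (auto simp: bilinear_def intro: linear_compose_sub)
    show "?B x y \<bullet> z = - (y \<bullet> ?B x z)" for x y z
      using metric_connection_skew[OF m, of x y p z] conn_skew[of x y z]
      by (simp add: inner_diff_left inner_diff_right)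
    show "(?B x y - ?B y x) \<bullet> z = - ((?B x z - ?B z x) \<bullet> y)" for x y z
    proof -
      have "torsion_form A \<iota> D (\<iota> x) (\<iota> y) (\<iota> z) p = - torsion_form A \<iota> D (\<iota> x) (\<iota> z) (\<iota> y) p"
        using D \<iota>_vfields unfolding canonical_connection_def totally_skew_torsion_def by blast
      moreover have "(conn x y - conn y x - br x y) \<bullet> z = - ((conn x z - conn z x - br x z) \<bullet> y)"
        unfolding conn_torsion by (subst wedge3_skew(2)) simp
      ultimately show ?thesis
        unfolding torsion_form_\<iota>[OF aff bil] by (simp add: inner_diff_left)
    qed
    show "?B x (\<phi> 1 y) = \<phi> 1 (?B x y)" for x y
    proof -
      have v: "D (\<iota> x) (\<iota> y) \<in> vfields A" for x y
        using aff \<iota>_vfields by (simp add: affine_connection_def)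
      have "vf_diff (D (\<iota> x) (li_endo \<iota> (\<phi> 1) (\<iota> y))) (li_endo \<iota> (\<phi> 1) (D (\<iota> x) (\<iota> y))) =
          vf_scale (\<lambda>p. \<beta>) (vf_diff (vf_scale (li_form \<iota> (\<eta> 3) (\<iota> x)) (li_endo \<iota> (\<phi> 2) (\<iota> y)))
            (vf_scale (li_form \<iota> (\<eta> 2) (\<iota> x)) (li_endo \<iota> (\<phi> 3) (\<iota> y))))"
        using D \<iota>_vfields even_perms(1) unfolding canonical_connection_def by blast
      moreover have "li_form \<iota> (\<eta> l) (\<iota> x) = (\<lambda>p. \<eta> l x)" for l
        by (simp add: fun_eq_iff li_form_def)
      ultimately have "vf_diff (D (\<iota> x) (\<iota> (\<phi> 1 y))) (li_endo \<iota> (\<phi> 1) (D (\<iota> x) (\<iota> y))) =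
          \<iota> (\<beta> *\<^sub>R (\<eta> 3 x *\<^sub>R \<phi> 2 y - \<eta> 2 x *\<^sub>R \<phi> 3 y))"
        by (simp add: li_endo_\<iota> vf_scale_def vf_diff_def fun_eq_iff \<iota>_scale linear_diff[OF linear_\<iota>])
      then have "left_triv \<iota> (vf_diff (D (\<iota> x) (\<iota> (\<phi> 1 y))) (li_endo \<iota> (\<phi> 1) (D (\<iota> x) (\<iota> y)))) p =
          \<beta> *\<^sub>R (\<eta> 3 x *\<^sub>R \<phi> 2 y - \<eta> 2 x *\<^sub>R \<phi> 3 y)"
        by simp
      \<comment> \<open>The prescribed derivative does not involve the connection, so it is the same
        for \<open>D\<close> and \<open>conn\<close> and drops out of the difference.\<close>
      then have "?D x (\<phi> 1 y) - \<phi> 1 (?D x y) = conn x (\<phi> 1 y) - \<phi> 1 (conn x y)"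
        unfolding conn_\<phi>[OF even_perms(1)] left_triv_vf_diff[OF v li_endo_vfields[OF linear_\<phi> v]]
        by (simp add: li_endo_eq)
      then show ?thesis
        by (simp add: lin_simps algebra_simps)
    qed
  qed
  then show "\<forall>x y. ?B x y = 0"
    by blast
qed

text \<open>As for the Levi-Civita connection, equal torsions make the difference symmetric in its
  first two arguments. With skewness in the last two it is also alternating, hence zero.\<close>

lemma torsion_eq_nabla:
  assumes m: "metric_connection A \<iota> D"
    and T: "\<And>X Y Z p. X \<in> vfields A \<Longrightarrow> Y \<in> vfields A \<Longrightarrow> Z \<in> vfields A \<Longrightarrow>
      torsion_form A \<iota> D X Y Z p = torsion_form A \<iota> nabla X Y Z p"
    and X: "X \<in> vfields A" and Y: "Y \<in> vfields A"
  shows "D X Y = nabla X Y"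
proof (rule eq_nabla[OF m _ X Y])
  have aff: "affine_connection A D"
    using m by (simp add: metric_connection_def)
  fix p
  let ?D = "\<lambda>x y. left_triv \<iota> (D (\<iota> x) (\<iota> y)) p"
  define a where "a = (\<lambda>x y z. (?D x y - conn x y) \<bullet> z)"
  have s: "a x y z = - a x z y" for x y z
    using metric_connection_skew[OF m, of x y p z] conn_skew[of x y z]
    by (simp add: a_def inner_diff_left inner_diff_right inner_commute)
  have t: "a x y z - a y x z = 0" for x y z
    using T[OF \<iota>_vfields \<iota>_vfields \<iota>_vfields, of x y z p]
    by (simp add: torsion_form_\<iota>[OF aff bil] torsion_form_\<iota>[OF affine_nabla bil] left_triv_nabla left_triv_\<iota>_fun
        directional_const a_def inner_diff_left)
  have a0: "a x y z = 0" for x y z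
  proof -
    have "a x y z = - a y x z"
      by (rule alternating_of_skew_torsion[of a, OF s]) (simp only: t)
    then show ?thesis
      using t[of x y z] by linarith
  qed
  show "\<forall>x y. ?D x y - conn x y = 0"
  proof (intro allI)
    fix x y
    show "?D x y - conn x y = 0"
      using a0[of x y "?D x y - conn x y"] unfolding a_def inner_eq_zero_iff .
  qed
qed

lemma totally_skew_torsionI:
  assumes T: "\<And>X Y Z p. X \<in> vfields A \<Longrightarrow> Y \<in> vfields A \<Longrightarrow> Z \<in> vfields A \<Longrightarrow>
    torsion_form A \<iota> D X Y Z p = r * wedge3 (a p) (b p) (c p) X Y Z"
  shows "totally_skew_torsion A \<iota> D"
  unfolding totally_skew_torsion_def
proof (intro conjI allI ballI)
  fix X Y Z p
  assume v: "X \<in> vfields A" "Y \<in> vfields A" "Z \<in> vfields A"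
  show "torsion_form A \<iota> D X Y Z p = - torsion_form A \<iota> D Y X Z p"
    using wedge3_skew(1)[of "a p" "b p" "c p" X Y Z] by (simp add: T v)
  show "torsion_form A \<iota> D X Y Z p = - torsion_form A \<iota> D X Z Y p"
    using wedge3_skew(2)[of "a p" "b p" "c p" X Y Z] by (simp add: T v)
qed

lemma canonical_nabla: "canonical_connection A \<iota> \<phi> \<eta> \<beta> nabla"
  unfolding canonical_connection_def
proof (intro conjI allI impI ballI)
  show "totally_skew_torsion A \<iota> nabla"
    by (rule totally_skew_torsionI[OF torsion_nabla])
qed (rule metric_nabla, rule nabla_li_endo)

text \<open>From right to left, the torsion first identifies \<open>D\<close> with
  \<open>nabla\<close> on vector fields. The condition on the derivatives then transfers because
  \<open>li_endo\<close> of each \<phi>_i maps vector fields to vector fields.\<close>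

lemma canonical_iff:
  "canonical_connection A \<iota> \<phi> \<eta> \<beta> D \<longleftrightarrow> metric_connection A \<iota> D \<and>
    (\<forall>X\<in>vfields A. \<forall>Y\<in>vfields A. \<forall>Z\<in>vfields A. \<forall>p. torsion_form A \<iota> D X Y Z p =
      2 * \<delta> * wedge3 (\<lambda>V. li_form \<iota> (\<eta> 1) V p) (\<lambda>V. li_form \<iota> (\<eta> 2) V p) (\<lambda>V. li_form \<iota> (\<eta> 3) V p) X Y Z)"
  (is "?L \<longleftrightarrow> ?R")
proof
  assume L: ?L
  have "torsion_form A \<iota> D X Y Z p = torsion_form A \<iota> nabla X Y Z p"
    if "X \<in> vfields A" "Y \<in> vfields A" for X Y Z p
    using canonical_eq_nabla[OF L] that by (simp add: torsion_form_def torsion_def)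
  then show ?R
    using L torsion_nabla by (simp add: canonical_connection_def)
next
  assume R: ?R
  have eq: "D X Y = nabla X Y" if "X \<in> vfields A" "Y \<in> vfields A" for X Y
    by (rule torsion_eq_nabla[OF _ _ that]) (use R torsion_nabla in auto)
  show ?L
    unfolding canonical_connection_def
  proof (intro conjI allI impI ballI)
    show "metric_connection A \<iota> D"
      using R by blast
    show "totally_skew_torsion A \<iota> D"
      by (rule totally_skew_torsionI) (use R in blast)
    fix i j k and X Y :: "('p, 'm) vfield"
    assume p: "even_perm3 i j k" and X: "X \<in> vfields A" and Y: "Y \<in> vfields A"
    show "vf_diff (D X (li_endo \<iota> (\<phi> i) Y)) (li_endo \<iota> (\<phi> i) (D X Y)) =
      vf_scale (\<lambda>p. \<beta>) (vf_diff (vf_scale (li_form \<iota> (\<eta> k) X) (li_endo \<iota> (\<phi> j) Y))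
        (vf_scale (li_form \<iota> (\<eta> j) X) (li_endo \<iota> (\<phi> k) Y)))"
      unfolding eq[OF X Y] eq[OF X li_endo_vfields[OF linear_\<phi> Y]] by (rule nabla_li_endo[OF p X Y])
  qed
qed

lemma ex_canonical: "\<exists>D. canonical_connection A \<iota> \<phi> \<eta> \<beta> D"
  using canonical_nabla by blast

lemma canonical_unique:
  assumes "canonical_connection A \<iota> \<phi> \<eta> \<beta> D" "canonical_connection A \<iota> \<phi> \<eta> \<beta> D'"
    and "X \<in> vfields A" "Y \<in> vfields A"
  shows "D X Y = D' X Y"
  unfolding canonical_eq_nabla[OF assms(1,3,4)] canonical_eq_nabla[OF assms(2,3,4)] ..

end

theorem proposition6p21:
  fixes br :: "'a::euclidean_space \<Rightarrow> 'a \<Rightarrow> 'a"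
    and \<phi> :: "3 \<Rightarrow> 'a \<Rightarrow> 'a" and \<xi> :: "3 \<Rightarrow> 'a" and \<eta> :: "3 \<Rightarrow> 'a \<Rightarrow> real"
    and n :: nat and \<beta> \<delta> :: real
  assumes "almost_3_contact_metric_lie_algebra n br \<phi> \<xi> \<eta>"
    and "canonical_abelian br \<phi> \<xi> \<eta> \<beta>" and "\<beta> \<noteq> 0"
    and "\<delta> = reeb_delta br \<xi> \<eta>"
  shows "\<beta> = 2 * \<delta> \<and>
    (CARD('k::finite) = 4 * n \<longrightarrow>
      (\<exists>(\<rho> :: real^3^3 \<Rightarrow> real^'k \<Rightarrow> real^'k) F. so3_semidirect_iso br \<rho> F \<and>
        F ` vertical \<xi> = so3 \<times> {0} \<and> F ` horizontal \<eta> = {0} \<times> UNIV)) \<and>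
    (\<forall>i j k. even_perm3 i j k \<longrightarrow> br (\<xi> i) (\<xi> j) = (2 * \<delta>) *\<^sub>R \<xi> k) \<and>
    (\<forall>i. \<forall>x\<in>horizontal \<eta>. br (\<xi> i) x = \<delta> *\<^sub>R \<phi> i x) \<and>
    (\<forall>x\<in>horizontal \<eta>. \<forall>y\<in>horizontal \<eta>. br x y = 0) \<and>
    (\<forall>(A :: ('p::{t2_space,second_countable_topology}, 'm::euclidean_space) chart set) mul e iv \<iota>.
      lie_group A mul e iv \<longrightarrow> lie_algebra_of_group A mul br \<iota> \<longrightarrow>
      (\<exists>D. canonical_connection A \<iota> \<phi> \<eta> \<beta> D) \<and>
      (\<forall>D D'. canonical_connection A \<iota> \<phi> \<eta> \<beta> D \<longrightarrow> canonical_connection A \<iota> \<phi> \<eta> \<beta> D' \<longrightarrow>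
         (\<forall>X\<in>vfields A. \<forall>Y\<in>vfields A. D X Y = D' X Y)) \<and>
      (\<forall>D. canonical_connection A \<iota> \<phi> \<eta> \<beta> D \<longleftrightarrow>
         metric_connection A \<iota> D \<and>
         (\<forall>X\<in>vfields A. \<forall>Y\<in>vfields A. \<forall>Z\<in>vfields A. \<forall>p.
            torsion_form A \<iota> D X Y Z p =
            2 * \<delta> * wedge3 (\<lambda>V. li_form \<iota> (\<eta> 1) V p) (\<lambda>V. li_form \<iota> (\<eta> 2) V p)
                      (\<lambda>V. li_form \<iota> (\<eta> 3) V p) X Y Z)))"
proof -
  interpret nonparallel_canonical n br \<phi> \<xi> \<eta> \<beta> \<delta>
    using assms by unfold_locales
  \<comment> \<open>The group is quantified inside the conclusion, so its locale is entered through
    a general fact.\<close>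
  have G: "lie_group_canonical A mul e iv br \<iota> n \<phi> \<xi> \<eta> \<beta> \<delta>"
    if "lie_group A mul e iv" "lie_algebra_of_group A mul br \<iota>"
    for A :: "('p, 'm) chart set" and mul e iv \<iota>
    using that by unfold_locales
  show ?thesis
    by (intro conjI allI impI ballI)
      (assumption | rule \<beta>_eq so3_semidirect br_vertical br_horizontal br_horizontal_horizontal
        lie_group_canonical.ex_canonical[OF G] lie_group_canonical.canonical_iff[OF G]
        lie_group_canonical.canonical_unique[OF G])+
qed

end
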